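(* For every fixed $\eta \in (0,1)$ we have $$f_\eta(n)=\Theta\bigl(\max\{\log n,\ n^{2\eta-1}\}\bigr)\qquad\text{as } n\to\infty,$$ where $f_\eta(n)$ is the maximum integer $f$ such that every $n$-vertex triangle-free graph with minimum degree at least $n^{\eta}$ contains an induced bipartite subgraph with minimum degree at least $f$. The implicit constants may depend on $\eta$.
   Context: Graphs are finite and simple. *)

theory Defs
  imports
    Complex_Main
    "HOL-Library.Landau_Symbols"
    "Graph_Theory.Pair_Digraph"
    "Graph_Theory.Digraph_Component"
begin

text \<open>
  A finite simple graph is a \<^const>\<open>pair_graph\<close>: each undirected edge \<open>{u, v}\<close> is represented
  by the two arcs \<open>(u, v)\<close> and \<open>(v, u)\<close>. Hence the out-degree of a vertex is its degree, and
  in a loop-free graph the vertices \<open>u, v, w\<close> below are automatically distinct.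
\<close>

definition triangle_free :: "('a, 'b) pre_digraph \<Rightarrow> bool" where
  "triangle_free G \<longleftrightarrow>
     \<not> (\<exists>u v w. (u, v) \<in> arcs_ends G \<and> (v, w) \<in> arcs_ends G \<and> (w, u) \<in> arcs_ends G)"

definition bipartite :: "('a, 'b) pre_digraph \<Rightarrow> bool" where
  "bipartite G \<longleftrightarrow>
     (\<exists>A B. A \<union> B = verts G \<and> A \<inter> B = {} \<and> arcs_ends G \<subseteq> A \<times> B \<union> B \<times> A)"

text \<open>Only meaningful for graphs with a finite non-empty vertex set.\<close>

definition min_degree :: "('a, 'b) pre_digraph \<Rightarrow> nat" where
  "min_degree G = Min (out_degree G ` verts G)"

text \<open>
  Vertices are natural numbers, which loses no generality because every finite graph is
  isomorphic to such a graph. The subgraph \<open>H\<close> has to be non-empty, since the minimum degree of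
  the null graph is undefined.
\<close>

definition forces_induced_bipartite :: "real \<Rightarrow> nat \<Rightarrow> nat \<Rightarrow> bool" where
  "forces_induced_bipartite \<eta> n f \<longleftrightarrow>
     (\<forall>G :: nat pair_pre_digraph.
        pair_graph G \<and> card (pverts G) = n \<and> triangle_free (with_proj G) \<and>
        real n powr \<eta> \<le> real (min_degree (with_proj G)) \<longrightarrow>
        (\<exists>H. induced_subgraph H (with_proj G) \<and> verts H \<noteq> {} \<and>
             bipartite H \<and> f \<le> min_degree H))"

text \<open>
  For \<open>\<eta> < 1\<close> and all sufficiently large \<open>n\<close> the maximum exists: the balanced complete bipartite
  graph satisfies the hypotheses, so every admissible \<open>f\<close> is less than \<open>n\<close>, and \<open>f = 0\<close> is
  admissible because a single vertex is an induced bipartite subgraph. For the remaining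
  \<open>n\<close> the value may be unspecified, which does not affect the asymptotics.
\<close>

definition max_forced_degree :: "real \<Rightarrow> nat \<Rightarrow> nat" where
  "max_forced_degree \<eta> n = (GREATEST f. forces_induced_bipartite \<eta> n f)"

end

(*
Lower bound. Two independent sets I and J with at least k (|I| + |J|) edges between them contain an
induced bipartite subgraph of minimum degree at least k. With I and J the neighbourhoods of two
random vertices this gives d^2 / (4n), where d is the minimum degree. For the logarithm, pass to a
subgraph that is k-degenerate and has minimum degree at least k >= d, and use a random independent
set of Martinsson that contains every vertex with probability of order (ln k) / k.

Upper bound for eta <= 1/2. A constant blow-up of a random graph of edge probability c / sqrt m,
made triangle-free by alteration: independent sets have O(sqrt m ln m) vertices, and sets of that
size span O(ln m) edges per vertex.

Upper bound for eta > 1/2. A blow-up loses nothing as soon as the base graph loses no logarithm,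
so it suffices to treat a small polynomial t. Take N vertices X and N / t hubs, join them at random
with degrees of order D = sqrt (N t) after replacing every hub by t twins, and add to X a much
sparser random triangle-free graph, restricted to the pairs without a common hub. The result is
triangle-free. An independent subset of X of nearly D vertices must have many pairs with a common
hub, hence a single hub sees a positive fraction of it; so it has O(D) vertices and can be peeled
into pieces of hub neighbourhoods plus a small rest. For such pieces a union bound over few sets
shows that the number of edges to any set W of hubs is O(size + t |W|), which is what bounds the
minimum degree by O(t).
*)
theory Submission
  imports Defs "HOL-Real_Asymp.Real_Asymp"
begin

section \<open>Symmetric relations; from dense pairs to minimum degree; the quadratic lower
  bound\<close>

section \<open>Graphs as symmetric relations\<close>


text \<open>Why the case eta > 1/2 needs its own graph: blowing up the random graph on m vertices by
  a polynomial factor B gives degree about B sqrt m and order n = B m, but only the bound O(B ln m),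
  a logarithm above d^2 / n. That logarithm is the price of a union bound over arbitrary sets of
  about sqrt m vertices, where each vertex costs ln m. The hub graph pays less in three ways. By its
  twins a hub has weight t in the bounds but is a single choice in the union bound, so a polynomial
  t absorbs the logarithm. For sets of at most D / h vertices the desired bound exceeds the mean by
  a factor h, and ln h is a constant fraction of ln N. Sets inside one hub neighbourhood are chosen
  among O(D) vertices instead of N, so large sets are cut into such pieces. The polynomial t puts
  the degree exponent of the base graph slightly above 1/2. A parameter l brings it as close to 1/2
  as desired, at the cost of constants growing with l, and the blow-up, which preserves the ratio of
  order to degree, then reaches eta.\<close>

definition sgraph :: "'a set \<Rightarrow> 'a rel \<Rightarrow> bool" where
  "sgraph V E \<longleftrightarrow> finite V \<and> E \<subseteq> V \<times> V \<and> sym E \<and> irrefl E"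

definition nbrs :: "'a rel \<Rightarrow> 'a set \<Rightarrow> 'a \<Rightarrow> 'a set" where
  "nbrs E S v = {u \<in> S. (v, u) \<in> E}"

abbreviation deg :: "'a rel \<Rightarrow> 'a set \<Rightarrow> 'a \<Rightarrow> nat" where
  "deg E S v \<equiv> card (nbrs E S v)"

definition trifree :: "'a rel \<Rightarrow> bool" where
  "trifree E \<longleftrightarrow> \<not> (\<exists>u v w. (u, v) \<in> E \<and> (v, w) \<in> E \<and> (w, u) \<in> E)"

definition indep :: "'a rel \<Rightarrow> 'a set \<Rightarrow> bool" where
  "indep E S \<longleftrightarrow> E \<inter> S \<times> S = {}"

definition bip :: "'a rel \<Rightarrow> 'a set \<Rightarrow> bool" where
  "bip E S \<longleftrightarrow> (\<exists>A B. A \<union> B = S \<and> A \<inter> B = {} \<and> indep E A \<and> indep E B)"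

lemma sgraphD:
  assumes "sgraph V E"
  shows "finite V" "E \<subseteq> V \<times> V" "(u, v) \<in> E \<Longrightarrow> (v, u) \<in> E" "(u, u) \<notin> E" "finite E"
  using assms finite_subset[of E "V \<times> V"] by (auto simp: sgraph_def sym_def irrefl_def)

lemma finite_nbrs [simp]: "finite S \<Longrightarrow> finite (nbrs E S v)"
  by (simp add: nbrs_def)

lemma nbrs_subset: "nbrs E S v \<subseteq> S"
  by (auto simp: nbrs_def)

lemma indep_mono: "indep E S \<Longrightarrow> T \<subseteq> S \<Longrightarrow> indep E T"
  by (auto simp: indep_def)

lemma bip_mono: "bip E S \<Longrightarrow> T \<subseteq> S \<Longrightarrow> bip E T"
  unfolding bip_def
proof (elim exE conjE)
  fix A B assume "T \<subseteq> S" "A \<union> B = S" "A \<inter> B = {}" "indep E A" "indep E B"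
  then show "\<exists>A B. A \<union> B = T \<and> A \<inter> B = {} \<and> indep E A \<and> indep E B"
    by (intro exI[of _ "A \<inter> T"] exI[of _ "B \<inter> T"]) (auto intro: indep_mono)
qed

lemma indep_nbrs: "trifree E \<Longrightarrow> sym E \<Longrightarrow> indep E (nbrs E S v)"
  unfolding indep_def nbrs_def trifree_def using symD[of E] by blast

lemma pair_graph_iff: "pair_graph \<lparr>pverts = V, parcs = E\<rparr> \<longleftrightarrow> sgraph V E"
proof
  assume "pair_graph \<lparr>pverts = V, parcs = E\<rparr>"
  then interpret pair_graph "\<lparr>pverts = V, parcs = E\<rparr>" .
  show "sgraph V E"
    using finite_verts sym_arcs no_loops wellformed'
    by (simp add: sgraph_def irrefl_def arcs_ends_def with_proj_def symmetric_def arc_to_ends_def)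
      (metis fst_conv mem_Sigma_iff snd_conv subrelI)
next
  assume *: "sgraph V E"
  then show "pair_graph \<lparr>pverts = V, parcs = E\<rparr>"
    by unfold_locales
      (auto simp: sgraph_def irrefl_def sym_def symmetric_def arcs_ends_def arc_to_ends_def
        intro: finite_subset[of E "V \<times> V"])
qed

lemma arcs_ends_with_proj [simp]: "arcs_ends (with_proj G) = parcs G"
  by (auto simp: arcs_ends_def arc_to_ends_def with_proj_def)

lemma out_degree_induced:
  assumes "induced_subgraph H (with_proj \<lparr>pverts = V, parcs = E\<rparr>)" "v \<in> verts H"
  shows "out_degree H v = deg E (verts H) v"
proof -
  have t: "tail H = fst" "arcs H = {e \<in> E. fst e \<in> verts H \<and> snd e \<in> verts H}"
    using assms by (auto simp: induced_subgraph_def subgraph_def compatible_def)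
  have "{e \<in> arcs H. tail H e = v} = Pair v ` nbrs E (verts H) v"
    using assms(2) by (auto simp: t nbrs_def)
  then show ?thesis
    by (simp add: out_degree_def out_arcs_def card_image inj_on_def)
qed

lemma arcs_ends_induced:
  assumes "induced_subgraph H (with_proj \<lparr>pverts = V, parcs = E\<rparr>)"
  shows "arcs_ends H = E \<inter> verts H \<times> verts H"
proof -
  have t: "tail H = fst" "head H = snd" "arcs H = {e \<in> E. fst e \<in> verts H \<and> snd e \<in> verts H}"
    using assms by (auto simp: induced_subgraph_def subgraph_def compatible_def)
  show ?thesis by (auto simp: arcs_ends_def arc_to_ends_def t)
qed

lemma bip_iff:
  assumes "sym E"
  shows "bip E S \<longleftrightarrow> (\<exists>A B. A \<union> B = S \<and> A \<inter> B = {} \<and> E \<inter> S \<times> S \<subseteq> A \<times> B \<union> B \<times> A)"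
  unfolding bip_def indep_def by (intro ex_cong1) auto

text \<open>Positivity of \<open>n\<close> keeps \<open>Min\<close> away from the empty set, where
  \<open>min_degree\<close> is unspecified; on the other side the subgraph is required to be
  nonempty.\<close>

lemma forces_iff:
  assumes "n > 0"
  shows "forces_induced_bipartite \<eta> n f \<longleftrightarrow>
    (\<forall>V E :: nat rel. sgraph V E \<and> card V = n \<and> trifree E \<and> (\<forall>v\<in>V. real n powr \<eta> \<le> deg E V v)
       \<longrightarrow> (\<exists>S \<subseteq> V. S \<noteq> {} \<and> bip E S \<and> (\<forall>v\<in>S. f \<le> deg E S v)))" (is "?L \<longleftrightarrow> ?R")
proof -
  have 1: "real n powr \<eta> \<le> real (min_degree (with_proj \<lparr>pverts = V, parcs = E\<rparr>)) \<longleftrightarrow>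
      (\<forall>v\<in>V. real n powr \<eta> \<le> deg E V v)"
    if "sgraph V E" "card V = n" for V and E :: "nat rel"
  proof -
    let ?G = "with_proj \<lparr>pverts = V, parcs = E\<rparr>"
    have ind: "induced_subgraph ?G ?G"
      using that(1) by (intro wf_digraph.induced_subgraph_refl) (auto simp: wf_digraph_def sgraph_def)
    have fin: "finite V" "V \<noteq> {}" using that assms by (auto simp: sgraph_def)
    have "(real n powr \<eta> \<le> real (min_degree ?G)) \<longleftrightarrow> (nat \<lceil>real n powr \<eta>\<rceil> \<le> min_degree ?G)"
      by linarith
    also have "\<dots> \<longleftrightarrow> (\<forall>v\<in>V. nat \<lceil>real n powr \<eta>\<rceil> \<le> out_degree ?G v)"
      unfolding min_degree_def using fin by (subst Min_ge_iff) auto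
    also have "\<dots> \<longleftrightarrow> (\<forall>v\<in>V. real n powr \<eta> \<le> deg E V v)"
      using out_degree_induced[OF ind] by (intro ball_cong) (auto simp: nat_le_iff ceiling_le_iff)
    finally show ?thesis .
  qed
  have 2: "(\<exists>H. induced_subgraph H (with_proj \<lparr>pverts = V, parcs = E\<rparr>) \<and> verts H \<noteq> {} \<and>
             bipartite H \<and> f \<le> min_degree H) \<longleftrightarrow>
      (\<exists>S \<subseteq> V. S \<noteq> {} \<and> bip E S \<and> (\<forall>v\<in>S. f \<le> deg E S v))" (is "?l \<longleftrightarrow> ?r")
    if g: "sgraph V E" for V and E :: "nat rel"
  proof
    assume ?l
    then obtain H where H: "induced_subgraph H (with_proj \<lparr>pverts = V, parcs = E\<rparr>)" "verts H \<noteq> {}"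
      "bipartite H" "f \<le> min_degree H" by blast
    have sub: "verts H \<subseteq> V" using H(1) by (auto simp: induced_subgraph_def subgraph_def)
    then have fin: "finite (verts H)" using g by (auto simp: sgraph_def intro: finite_subset)
    have "bip E (verts H)"
      using H(3) arcs_ends_induced[OF H(1)] g by (subst bip_iff) (auto simp: bipartite_def sgraph_def)
    moreover have "\<forall>v\<in>verts H. f \<le> deg E (verts H) v"
      using H(2,4) fin out_degree_induced[OF H(1)] by (auto simp: min_degree_def)
    ultimately show ?r using sub H(2) by blast
  next
    assume ?r
    then obtain S where S: "S \<subseteq> V" "S \<noteq> {}" "bip E S" "\<forall>v\<in>S. f \<le> deg E S v" by blast
    define H where "H = with_proj \<lparr>pverts = S, parcs = E \<inter> S \<times> S\<rparr>"
    have vH: "verts H = S" by (simp add: H_def)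
    have fin: "finite S" using g S(1) by (auto simp: sgraph_def intro: finite_subset)
    have g': "sgraph S (E \<inter> S \<times> S)" using g fin by (auto simp: sgraph_def sym_def irrefl_def)
    have wf: "wf_digraph H" "wf_digraph (with_proj \<lparr>pverts = V, parcs = E\<rparr>)"
      using g g' by (auto simp: H_def wf_digraph_def sgraph_def)
    have ind: "induced_subgraph H (with_proj \<lparr>pverts = V, parcs = E\<rparr>)"
      using S(1) wf by (auto simp: induced_subgraph_def subgraph_def compatible_def H_def)
    have "bipartite H"
      using S(3) arcs_ends_induced[OF ind] g by (subst (asm) bip_iff) (auto simp: bipartite_def sgraph_def vH)
    moreover have "f \<le> min_degree H"
      using S(2,4) fin out_degree_induced[OF ind] by (auto simp: min_degree_def vH)
    ultimately show ?l using ind S(2) vH by blast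
  qed
  have 3: "triangle_free (with_proj \<lparr>pverts = V, parcs = E\<rparr>) = trifree E" for V and E :: "nat rel"
    by (simp add: triangle_free_def trifree_def)
  have all: "(\<forall>G :: nat pair_pre_digraph. P G) \<longleftrightarrow> (\<forall>V E. P \<lparr>pverts = V, parcs = E\<rparr>)" for P
  proof (intro iffI allI)
    fix G :: "nat pair_pre_digraph" assume "\<forall>V E. P \<lparr>pverts = V, parcs = E\<rparr>"
    then show "P G" by (cases G) auto
  qed auto
  show ?thesis
    unfolding forces_induced_bipartite_def all pair_graph_iff 3 pair_pre_digraph.select_convs
    by (intro iff_allI imp_cong conj_cong refl) (simp_all add: 1 2)
qed

text \<open>A set with many edges per vertex that is minimal with this property has large minimum degree.\<close>

lemma dense_pair_imp_min_degree:
  fixes k :: real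
  assumes g: "sgraph V E" and I: "indep E I" "I \<subseteq> V" and J: "indep E J" "J \<subseteq> V"
    and e: "k * (card I + card J) < card (E \<inter> I \<times> J)" and k: "k \<ge> 0"
  shows "\<exists>S \<subseteq> V. S \<noteq> {} \<and> bip E S \<and> (\<forall>v\<in>S. k \<le> deg E S v)"
proof -
  note [simp] = sgraphD(1,5)[OF g]
  \<comment> \<open>Arcs are counted in both directions, hence the factor 2: the condition is an
    average degree of at least \<open>2 * k\<close>.\<close>
  define P where "P S \<longleftrightarrow> S \<subseteq> I \<union> J \<and> S \<noteq> {} \<and> 2 * k * card S \<le> card (E \<inter> S \<times> S)" for S
  have fin: "finite S" if "S \<subseteq> V" for S using that finite_subset[of S V] by simp
  \<comment> \<open>The two sets may overlap, so the second side is \<open>J - I\<close>.\<close>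
  have bIJ: "bip E (I \<union> J)"
    unfolding bip_def using I J by (intro exI[of _ I] exI[of _ "J - I"]) (auto intro: indep_mono)
  have "P (I \<union> J)"
  proof -
    have "card (E \<inter> J \<times> I) = card (E \<inter> I \<times> J)"
    proof -
      have "E \<inter> J \<times> I = prod.swap ` (E \<inter> I \<times> J)" using sgraphD(3)[OF g] by force
      then show ?thesis by (metis card_image inj_swap inj_on_subset subset_UNIV)
    qed
    \<comment> \<open>An arc in both products would have both ends in the independent set
      \<open>I\<close>.\<close>
    moreover have "(E \<inter> I \<times> J) \<inter> (E \<inter> J \<times> I) = {}"
      using I by (auto simp: indep_def)
    ultimately have "2 * card (E \<inter> I \<times> J) = card ((E \<inter> I \<times> J) \<union> (E \<inter> J \<times> I))"
      by (subst card_Un_disjoint) auto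
    also have "\<dots> \<le> card (E \<inter> (I \<union> J) \<times> (I \<union> J))"
      by (intro card_mono) auto
    finally have 1: "2 * card (E \<inter> I \<times> J) \<le> card (E \<inter> (I \<union> J) \<times> (I \<union> J))" .
    have "card (I \<union> J) \<le> card I + card J" by (rule card_Un_le)
    then have "k * card (I \<union> J) \<le> k * (card I + card J)" using k by (intro mult_left_mono) auto
    with e 1 have "2 * k * card (I \<union> J) \<le> card (E \<inter> (I \<union> J) \<times> (I \<union> J))" by linarith
    moreover have "I \<union> J \<noteq> {}" using e k by auto
    ultimately show ?thesis by (simp add: P_def)
  qed
  then obtain S where S: "P S" and min: "\<And>T. P T \<Longrightarrow> card S \<le> card T"
    using exists_least_iff[of "\<lambda>n. \<exists>S. P S \<and> card S = n"] by (metis not_le)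
  have SV: "S \<subseteq> V" using S I J by (auto simp: P_def)
  have "k \<le> deg E S v" if v: "v \<in> S" for v
  \<comment> \<open>Deleting the only vertex leaves the empty set, which \<open>P\<close> excludes,
    so minimality says nothing; but then there are no arcs and \<open>k\<close> cannot be
    positive.\<close>
  proof (cases "S = {v}")
    case True
    then have "E \<inter> S \<times> S = {}" using sgraphD(4)[OF g] by auto
    then have "2 * k * card S \<le> 0" using S unfolding P_def by simp
    then have "k \<le> 0" using True by simp
    then show ?thesis by simp
  next
    case False
    let ?T = "S - {v}"
    have cT: "card ?T < card S" using v fin[OF SV] by (meson card_Diff1_less)
    then have "\<not> P ?T" using min leD by blast
    moreover have "?T \<noteq> {}" "?T \<subseteq> I \<union> J" using False S v by (auto simp: P_def)
    ultimately have 1: "card (E \<inter> ?T \<times> ?T) < 2 * k * card ?T"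
      unfolding P_def by (meson not_le)
    have "E \<inter> S \<times> S \<subseteq> (E \<inter> ?T \<times> ?T) \<union> Pair v ` nbrs E S v \<union> (\<lambda>u. (u, v)) ` nbrs E S v"
      using sgraphD(3)[OF g] by (auto simp: nbrs_def image_iff)
    then have "card (E \<inter> S \<times> S) \<le> card ((E \<inter> ?T \<times> ?T) \<union> Pair v ` nbrs E S v \<union> (\<lambda>u. (u, v)) ` nbrs E S v)"
      using fin[OF SV] by (intro card_mono) auto
    also have "\<dots> \<le> card (E \<inter> ?T \<times> ?T) + card (Pair v ` nbrs E S v) + card ((\<lambda>u. (u, v)) ` nbrs E S v)"
      by (meson card_Un_le add_right_mono le_trans)
    also have "\<dots> = card (E \<inter> ?T \<times> ?T) + 2 * deg E S v"
      by (simp add: card_image inj_on_def)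
    finally have 2: "card (E \<inter> S \<times> S) \<le> card (E \<inter> ?T \<times> ?T) + 2 * deg E S v" .
    have 3: "real (card ?T) = real (card S) - 1"
      using card.remove[OF fin[OF SV] v] by simp
    have "2 * k * card S \<le> card (E \<inter> S \<times> S)" using S by (simp add: P_def)
    also have "\<dots> \<le> card (E \<inter> ?T \<times> ?T) + 2 * real (deg E S v)" using 2 by linarith
    also have "\<dots> < 2 * k * (real (card S) - 1) + 2 * real (deg E S v)" using 1 unfolding 3 by (rule add_strict_right_mono)
    finally show ?thesis unfolding right_diff_distrib by linarith
  qed
  moreover have "bip E S" using bip_mono[OF bIJ] S by (simp add: P_def)
  ultimately show ?thesis using SV S unfolding P_def by blast
qed

lemma card_Times_filter:
  assumes "finite A" "finite B"
  shows "(\<Sum>a\<in>A. card {b \<in> B. P a b}) = card {(a, b) \<in> A \<times> B. P a b}"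
proof -
  have "{(a, b) \<in> A \<times> B. P a b} = (SIGMA a:A. {b \<in> B. P a b})" by auto
  then show ?thesis using assms by simp
qed

lemma sum_deg: "finite V \<Longrightarrow> E \<subseteq> V \<times> V \<Longrightarrow> (\<Sum>v\<in>V. deg E V v) = card E"
  unfolding nbrs_def by (subst card_Times_filter) (auto intro: arg_cong[where f = card])

text \<open>The two sides are the neighbourhoods of two independent uniformly random vertices.\<close>

lemma min_degree_square:
  fixes d :: real
  assumes g: "sgraph V E" and t: "trifree E" and V: "V \<noteq> {}"
    and d: "\<And>v. v \<in> V \<Longrightarrow> d \<le> deg E V v" and d0: "d > 0"
  shows "\<exists>S \<subseteq> V. S \<noteq> {} \<and> bip E S \<and> (\<forall>v\<in>S. d ^ 2 / (4 * card V) \<le> deg E S v)"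
proof -
  note [simp] = sgraphD(1,5)[OF g]
  let ?n = "card V" and ?N = "nbrs E V"
  define k where "k = d ^ 2 / (4 * ?n)"
  have n0: "?n > 0" using V by (simp add: card_gt_0_iff)
  have iE: "(u, v) \<in> E \<Longrightarrow> u \<in> V \<and> v \<in> V" for u v using sgraphD(2)[OF g] by blast
  have cE: "card E > 0"
  proof -
    obtain v where "v \<in> V" using V by auto
    then have "deg E V v > 0" using d[of v] d0 by linarith
    then show ?thesis by (auto simp: nbrs_def card_gt_0_iff)
  qed
  \<comment> \<open>Exchange of summation: an arc (x, y) is counted for exactly those (u, v) with u
    a neighbour of x and v a neighbour of y.\<close>
  have s1: "(\<Sum>u\<in>V. \<Sum>v\<in>V. real (card (E \<inter> ?N u \<times> ?N v))) = (\<Sum>(x, y)\<in>E. real (deg E V x * deg E V y))"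
  proof -
    have "card (E \<inter> ?N u \<times> ?N v) = (\<Sum>(x, y)\<in>E. of_bool ((u, x) \<in> E) * of_bool ((v, y) \<in> E))" for u v
    proof -
      have "E \<inter> ?N u \<times> ?N v = {e \<in> E. (u, fst e) \<in> E \<and> (v, snd e) \<in> E}"
        using iE by (auto simp: nbrs_def)
      then show ?thesis by (simp add: case_prod_unfold flip: of_bool_conj) (simp add: of_bool_def sum.If_cases Int_def)
    qed
    then have "(\<Sum>u\<in>V. \<Sum>v\<in>V. card (E \<inter> ?N u \<times> ?N v)) =
        (\<Sum>u\<in>V. \<Sum>v\<in>V. \<Sum>(x, y)\<in>E. of_bool ((u, x) \<in> E) * of_bool ((v, y) \<in> E))" by simp
    also have "\<dots> = (\<Sum>(x, y)\<in>E. \<Sum>u\<in>V. \<Sum>v\<in>V. of_bool ((u, x) \<in> E) * of_bool ((v, y) \<in> E))"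
      unfolding case_prod_unfold by (subst (2) sum.swap, subst sum.swap) (rule refl)
    also have "\<dots> = (\<Sum>(x, y)\<in>E. (\<Sum>u\<in>V. of_bool ((u, x) \<in> E)) * (\<Sum>v\<in>V. of_bool ((v, y) \<in> E)))"
      by (simp only: sum_product)
    also have "\<dots> = (\<Sum>(x, y)\<in>E. deg E V x * deg E V y)"
    proof -
      have "(\<Sum>u\<in>V. of_bool ((u, x) \<in> E)) = deg E V x" for x
      proof -
        have "{u \<in> V. (u, x) \<in> E} = nbrs E V x" using sgraphD(3)[OF g] by (auto simp: nbrs_def)
        then show ?thesis by (simp add: of_bool_def sum.If_cases Int_def)
      qed
      then show ?thesis by simp
    qed
    finally have "real (\<Sum>u\<in>V. \<Sum>v\<in>V. card (E \<inter> ?N u \<times> ?N v)) = real (\<Sum>(x, y)\<in>E. deg E V x * deg E V y)"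
      by simp
    then show ?thesis by (simp add: case_prod_unfold)
  qed
  have s2: "(\<Sum>u\<in>V. \<Sum>v\<in>V. real (deg E V u + deg E V v)) = 2 * ?n * card E"
  proof -
    have "(\<Sum>v\<in>V. real (deg E V v)) = card E" using sum_deg[of V E] sgraphD(2)[OF g] by (metis of_nat_sum sgraphD(1)[OF g])
    then show ?thesis by (simp add: sum.distrib flip: sum_distrib_left)
  qed
  \<comment> \<open>With the 4 in \<open>k\<close> the size term sums to
    \<open>d^2 / 2 * card E\<close>, half of the lower bound on the arcs, so the comparison is
    strict.\<close>
  have "(\<Sum>u\<in>V. \<Sum>v\<in>V. k * real (deg E V u + deg E V v)) = k * (2 * ?n * card E)"
    by (simp only: s2[symmetric] sum_distrib_left)
  also have "\<dots> = d^2 / 2 * card E" using n0 V by (simp add: k_def)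
  also have "\<dots> < d^2 * card E" using d0 cE by simp
  also have "\<dots> = (\<Sum>(x, y)\<in>E. d^2)" by simp
  also have "\<dots> \<le> (\<Sum>(x, y)\<in>E. real (deg E V x * deg E V y))"
  proof (intro sum_mono, clarify)
    fix x y assume "(x, y) \<in> E"
    then have "d * d \<le> real (deg E V x) * real (deg E V y)"
      using d iE d0 by (intro mult_mono) auto
    then show "d^2 \<le> real (deg E V x * deg E V y)" by (simp add: power2_eq_square)
  qed
  finally have less: "(\<Sum>u\<in>V. \<Sum>v\<in>V. k * real (deg E V u + deg E V v)) <
      (\<Sum>u\<in>V. \<Sum>v\<in>V. real (card (E \<inter> ?N u \<times> ?N v)))" using s1 by simp
  have "\<exists>u\<in>V. \<exists>v\<in>V. k * real (deg E V u + deg E V v) < real (card (E \<inter> ?N u \<times> ?N v))"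
  proof (rule ccontr)
    assume "\<not> ?thesis"
    then have "(\<Sum>u\<in>V. \<Sum>v\<in>V. real (card (E \<inter> ?N u \<times> ?N v))) \<le>
        (\<Sum>u\<in>V. \<Sum>v\<in>V. k * real (deg E V u + deg E V v))"
      by (intro sum_mono) (simp add: not_less)
    with less show False by simp
  qed
  then obtain u v where "u \<in> V" "v \<in> V" "k * real (deg E V u + deg E V v) < real (card (E \<inter> ?N u \<times> ?N v))"
    by blast
  then show ?thesis
    unfolding k_def[symmetric] using g t
    by (intro dense_pair_imp_min_degree[of V E "?N u" "?N v"] indep_nbrs nbrs_subset)
       (simp_all add: sgraph_def, simp add: k_def)
qed

section \<open>Martinsson's weights, degeneracy, and the logarithmic lower bound\<close>

section \<open>Random independent sets in degenerate graphs\<close>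


text \<open>
  Martinsson's random independent set. Vertices are processed in the given order; a vertex that has
  an earlier selected neighbour has weight 0, and otherwise its weight grows with every unselected
  neighbour so that it is a martingale. It is selected with probability equal to its weight, unless
  that exceeds 1/2.
\<close>

locale weighted_greedy =
  fixes adj :: "nat \<Rightarrow> nat \<Rightarrow> bool" and p0 :: real
  assumes adj_sym: "adj i j \<Longrightarrow> adj j i" and adj_irrefl: "\<not> adj i i"
    and adj_trifree: "adj i j \<Longrightarrow> adj j k \<Longrightarrow> \<not> adj i k"
    and p0_nonneg: "p0 \<ge> 0"
begin

text \<open>The random history is represented by its outcome \<open>S\<close>, of which only
  elements below \<open>i\<close> are read. Selection probabilities thus become plain recursive
  functions and no probability space is needed.\<close>

function sel :: "nat \<Rightarrow> nat set \<Rightarrow> real" where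
  "sel i S = (let w = (if \<exists>j<i. adj j i \<and> j \<in> S then 0
      else p0 / (\<Prod>j<i. if adj j i then 1 - sel j S else 1)) in if w \<le> 1/2 then w else 0)"
  by auto
termination by (relation "measure fst") auto

declare sel.simps [simp del]

text \<open>Weight of \<open>v\<close> once the vertices below \<open>t\<close> are processed.
  Separating the time \<open>t\<close> from the vertex turns the martingale property into a
  statement about one step of \<open>t\<close>.\<close>

definition wt :: "nat \<Rightarrow> nat \<Rightarrow> nat set \<Rightarrow> real" where
  "wt t v S = (if \<exists>j<t. adj j v \<and> j \<in> S then 0
      else p0 / (\<Prod>j<t. if adj j v then 1 - sel j S else 1))"

lemma sel_eq: "sel i S = (if wt i i S \<le> 1/2 then wt i i S else 0)"
  by (subst sel.simps) (simp add: wt_def Let_def)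

lemma sel_le_half: "sel i S \<le> 1/2"
  by (simp add: sel_eq)

lemma wt_nonneg: "wt t v S \<ge> 0"
proof -
  have "1 - sel j S \<ge> 0" for j using sel_le_half[of j S] by simp
  then show ?thesis by (auto simp: wt_def intro!: divide_nonneg_nonneg p0_nonneg prod_nonneg)
qed

lemma sel_nonneg: "sel i S \<ge> 0"
  by (simp add: sel_eq wt_nonneg)

lemma sel_le_wt: "sel i S \<le> wt i i S"
  by (simp add: sel_eq wt_nonneg)

lemma sel_cong: "(\<And>j. j < i \<Longrightarrow> j \<in> S \<longleftrightarrow> j \<in> T) \<Longrightarrow> sel i S = sel i T"
proof (induction i rule: less_induct)
  case (less i)
  have "sel j S = sel j T" if "j < i" for j
    using less.prems that less_trans by (intro less.IH) blast+
  then have 1: "(\<Prod>j<i. if adj j i then 1 - sel j S else 1) = (\<Prod>j<i. if adj j i then 1 - sel j T else 1)"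
    by (intro prod.cong) simp_all
  have 2: "(\<exists>j<i. adj j i \<and> j \<in> S) \<longleftrightarrow> (\<exists>j<i. adj j i \<and> j \<in> T)"
    using less.prems by blast
  have 3: "wt i i S = wt i i T" by (simp only: wt_def 1 2)
  show ?case by (simp only: sel_eq[of i] 3)
qed

lemma wt_cong:
  assumes "\<And>j. j < t \<Longrightarrow> j \<in> S \<longleftrightarrow> j \<in> T" shows "wt t v S = wt t v T"
proof -
  have "sel j S = sel j T" if "j < t" for j
    using assms that less_trans by (intro sel_cong) blast
  then have 1: "(\<Prod>j<t. if adj j v then 1 - sel j S else 1) = (\<Prod>j<t. if adj j v then 1 - sel j T else 1)"
    by (intro prod.cong) simp_all
  have 2: "(\<exists>j<t. adj j v \<and> j \<in> S) \<longleftrightarrow> (\<exists>j<t. adj j v \<and> j \<in> T)"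
    using assms by blast
  show ?thesis by (simp only: wt_def 1 2)
qed

text \<open>Expectation over the first \<open>n\<close> decisions as a tower of conditional
  expectations, the last decision being averaged out first.\<close>

primrec Ex :: "nat \<Rightarrow> (nat set \<Rightarrow> real) \<Rightarrow> real" where
  "Ex 0 f = f {}"
| "Ex (Suc n) f = Ex n (\<lambda>S. sel n S * f (insert n S) + (1 - sel n S) * f S)"

definition feasible :: "nat \<Rightarrow> nat set \<Rightarrow> bool" where
  "feasible n S \<longleftrightarrow> S \<subseteq> {..<n} \<and> (\<forall>i\<in>S. \<forall>j\<in>S. \<not> adj i j)"

text \<open>This is where independence of the selected set enters: a vertex with an earlier selected
  neighbour is chosen with probability 0, so only independent outcomes carry weight and need to be
  compared.\<close>

lemma Ex_mono: "(\<And>S. feasible n S \<Longrightarrow> f S \<le> g S) \<Longrightarrow> Ex n f \<le> Ex n g"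
proof (induction n arbitrary: f g)
  case 0
  then show ?case by (simp add: feasible_def)
next
  case (Suc n)
  have "sel n S * f (insert n S) + (1 - sel n S) * f S \<le> sel n S * g (insert n S) + (1 - sel n S) * g S"
    if S: "feasible n S" for S
  proof (intro add_mono)
    show "(1 - sel n S) * f S \<le> (1 - sel n S) * g S"
      using S sel_le_half[of n S] by (intro mult_left_mono Suc.prems) (auto simp: feasible_def)
    show "sel n S * f (insert n S) \<le> sel n S * g (insert n S)"
    proof (cases "\<exists>j<n. adj j n \<and> j \<in> S")
      case True
      then have "sel n S = 0" by (simp add: sel_eq wt_def)
      then show ?thesis by simp
    next
      case False
      then have "\<not> adj j n" "\<not> adj n j" if "j \<in> S" for j
        using that S adj_sym unfolding feasible_def by blast+
      then have "feasible (Suc n) (insert n S)"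
        using S adj_irrefl by (auto simp: feasible_def)
      then show ?thesis by (intro mult_left_mono Suc.prems sel_nonneg)
    qed
  qed
  then show ?case by (simp add: Suc.IH)
qed

lemma Ex_cong: "(\<And>S. S \<subseteq> {..<n} \<Longrightarrow> f S = g S) \<Longrightarrow> Ex n f = Ex n g"
  by (intro antisym Ex_mono) (auto simp: feasible_def)

lemma Ex_add: "Ex n (\<lambda>S. f S + g S) = Ex n f + Ex n g"
proof (induction n arbitrary: f g)
  case (Suc n)
  show ?case by (simp add: Suc.IH[symmetric] algebra_simps)
qed simp

lemma Ex_mult: "Ex n (\<lambda>S. c * f S) = c * Ex n f"
proof (induction n arbitrary: f)
  case (Suc n)
  show ?case by (simp add: Suc.IH[symmetric] algebra_simps)
qed simp

lemma Ex_const: "Ex n (\<lambda>S. c) = c"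
  by (induction n) (simp_all add: algebra_simps)

lemma Ex_diff: "Ex n (\<lambda>S. f S - g S) = Ex n f - Ex n g"
  using Ex_add[of n f "\<lambda>S. (-1) * g S"] Ex_mult[of n "-1" g] by simp

lemma Ex_sum: "finite A \<Longrightarrow> Ex n (\<lambda>S. \<Sum>a\<in>A. f a S) = (\<Sum>a\<in>A. Ex n (f a))"
  by (induction A rule: finite_induct) (simp_all add: Ex_const Ex_add)

lemma Ex_restrict:
  assumes "t \<le> n" and f: "\<And>S T. (\<And>j. j < t \<Longrightarrow> j \<in> S \<longleftrightarrow> j \<in> T) \<Longrightarrow> f S = f T"
  shows "Ex n f = Ex t f"
  using assms(1)
proof (induction n rule: dec_induct)
  case (step n)
  have "f (insert n S) = f S" for S using step.hyps by (intro f) auto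
  then have "Ex (Suc n) f = Ex n f" by (simp add: algebra_simps)
  then show ?case using step.IH by simp
qed simp

lemma wt_Suc_insert: "adj t v \<Longrightarrow> wt (Suc t) v (insert t S) = 0"
  by (auto simp: wt_def)

lemma wt_Suc_adj:
  assumes "adj t v" "S \<subseteq> {..<t}"
  shows "(1 - sel t S) * wt (Suc t) v S = wt t v S"
proof -
  have 1: "1 - sel t S \<noteq> 0" using sel_le_half[of t S] by linarith
  have 2: "(\<exists>j<Suc t. adj j v \<and> j \<in> S) \<longleftrightarrow> (\<exists>j<t. adj j v \<and> j \<in> S)"
    using assms(2) by (auto simp: less_Suc_eq)
  show ?thesis unfolding wt_def 2 using assms(1) 1
    by (cases "\<exists>j<t. adj j v \<and> j \<in> S") (simp_all only: if_True if_False prod.lessThan_Suc, simp_all)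
qed

lemma wt_Suc_nonadj: "\<not> adj t v \<Longrightarrow> wt (Suc t) v S = wt t v S"
  by (auto simp: wt_def less_Suc_eq)

lemma wt_insert: "i \<le> t \<Longrightarrow> wt i v (insert t S) = wt i v S"
  by (intro wt_cong) auto

text \<open>Processing a neighbour \<open>t\<close> of \<open>v\<close> sets the weight to 0 with
  probability \<open>sel t S\<close> and otherwise divides it by \<open>1 - sel t S\<close>, so
  every step preserves the mean. The cap 1/2 keeps the divisor away from 0.\<close>

lemma Ex_wt: "Ex t (wt t v) = p0"
proof (induction t)
  case 0
  then show ?case by (simp add: wt_def)
next
  case (Suc t)
  have "Ex (Suc t) (wt (Suc t) v) = Ex t (wt t v)"
    unfolding Ex.simps
  proof (intro Ex_cong)
    fix S :: "nat set" assume S: "S \<subseteq> {..<t}"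
    show "sel t S * wt (Suc t) v (insert t S) + (1 - sel t S) * wt (Suc t) v S = wt t v S"
      by (cases "adj t v") (simp add: wt_Suc_insert wt_Suc_adj S, simp add: wt_Suc_nonadj wt_insert algebra_simps)
  qed
  with Suc show ?case by simp
qed

text \<open>
  Since the graph is triangle-free, no vertex is adjacent to both \<open>u\<close> and \<open>v\<close>, so the product of
  their weights is a martingale as well.
\<close>

lemma Ex_wt_mult:
  assumes uv: "adj u v"
  shows "Ex t (\<lambda>S. wt (min t u) u S * wt t v S) = p0 * p0"
proof (induction t)
  case 0
  then show ?case by (simp add: wt_def)
next
  case (Suc t)
  have "Ex (Suc t) (\<lambda>S. wt (min (Suc t) u) u S * wt (Suc t) v S) = Ex t (\<lambda>S. wt (min t u) u S * wt t v S)"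
    unfolding Ex.simps
  proof (intro Ex_cong)
    fix S :: "nat set" assume S: "S \<subseteq> {..<t}"
    show "sel t S * (wt (min (Suc t) u) u (insert t S) * wt (Suc t) v (insert t S)) +
        (1 - sel t S) * (wt (min (Suc t) u) u S * wt (Suc t) v S) = wt (min t u) u S * wt t v S"
    \<comment> \<open>At most one factor moves at time \<open>t\<close>: either \<open>t\<close> is
      an earlier neighbour of \<open>u\<close>, hence not one of \<open>v\<close>, or the weight of
      \<open>u\<close> does not change, being frozen from time \<open>u\<close> on.\<close>
    proof (cases "t < u \<and> adj t u")
      case True
      then have "\<not> adj t v" using uv adj_trifree by blast
      moreover have "min (Suc t) u = Suc t" "min t u = t" using True by auto
      ultimately show ?thesis using True wt_Suc_adj[OF _ S, of u]
        by (simp add: wt_Suc_insert wt_Suc_nonadj flip: mult.assoc)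
    next
      case False
      have 1: "wt (min (Suc t) u) u T = wt (min t u) u T" for T
        using False by (cases "t < u") (auto simp: wt_Suc_nonadj min_def)
      have 2: "wt (min t u) u (insert t S) = wt (min t u) u S" by (intro wt_insert) simp
      have "sel t S * wt (Suc t) v (insert t S) + (1 - sel t S) * wt (Suc t) v S = wt t v S"
        by (cases "adj t v") (simp add: wt_Suc_insert wt_Suc_adj S, simp add: wt_Suc_nonadj wt_insert algebra_simps)
      then have "wt (min t u) u S * (sel t S * wt (Suc t) v (insert t S) + (1 - sel t S) * wt (Suc t) v S) =
        wt (min t u) u S * wt t v S" by simp
      then show ?thesis unfolding 1 2 by (simp add: algebra_simps)
    qed
  qed
  with Suc show ?case by simp
qed

lemma Ex_member:
  assumes "i < n" shows "Ex n (\<lambda>S. of_bool (i \<in> S)) = Ex i (sel i)"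
proof -
  have "Ex n (\<lambda>S. of_bool (i \<in> S)) = Ex (Suc i) (\<lambda>S. of_bool (i \<in> S))"
    using assms by (intro Ex_restrict) auto
  also have "\<dots> = Ex i (sel i)"
    unfolding Ex.simps by (intro Ex_cong) auto
  finally show ?thesis .
qed

lemma Ex_sel_le: "Ex i (sel i) \<le> p0"
  using Ex_mono[of i "sel i" "wt i i"] sel_le_wt Ex_wt[of i i] by simp

text \<open>
  Under the measure with density \<open>wt i i / p0\<close> the selection probabilities of the earlier neighbours
  of \<open>i\<close> have a small sum, by Markov's inequality, and a small sum keeps \<open>wt i i\<close> below the cap.
\<close>

lemma Ex_sel_ge:
  assumes k: "real (card {j. j < i \<and> adj j i}) \<le> k" and k0: "k > 0" and p0: "p0 > 0"
    and cap: "p0 * exp (4 * k * p0) \<le> 1/2"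
  shows "p0 / 2 \<le> Ex i (sel i)"
proof -
  define B where "B = {j. j < i \<and> adj j i}"
  have fB: "finite B" by (simp add: B_def)
  \<comment> \<open>The change of measure and Markov's inequality in pointwise form: if the sum of
    the \<open>sel j S\<close> is at most twice \<open>k * p0\<close>, the cap is inactive and
    \<open>sel\<close> equals \<open>wt\<close>; otherwise the left side is at most 0.\<close>
  have point: "wt i i S - (\<Sum>j\<in>B. wt i i S * sel j S) / (2 * k * p0) \<le> sel i S" for S
  proof (cases "(\<Sum>j\<in>B. sel j S) \<le> 2 * k * p0")
    case True
    have "wt i i S \<le> p0 / (\<Prod>j\<in>B. 1 - sel j S)"
    proof -
      have "(\<Prod>j<i. if adj j i then 1 - sel j S else 1) = (\<Prod>j\<in>B. 1 - sel j S)"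
        unfolding B_def by (subst prod.inter_filter[symmetric]) (auto simp: lessThan_def)
      moreover have "(\<Prod>j\<in>B. 1 - sel j S) \<ge> 0"
        using sel_le_half[of _ S] by (intro prod_nonneg) (smt (verit) divide_less_eq_1)
      ultimately show ?thesis using p0 by (simp add: wt_def)
    qed
    also have "\<dots> \<le> p0 * exp (2 * (\<Sum>j\<in>B. sel j S))"
    proof -
      \<comment> \<open>Here the cap is used: the inequality needs s to be at most 1/2.\<close>
      have "exp (- 2 * s) \<le> 1 - s" if "0 \<le> s" "s \<le> 1/2" for s :: real
      proof -
        have "1 \<le> (1 - s) * (1 + 2 * s)"
        proof -
          have "0 \<le> s * (1 - 2 * s)" using that by (intro mult_nonneg_nonneg) auto
          then show ?thesis by (simp add: algebra_simps)
        qed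
        also have "\<dots> \<le> (1 - s) * exp (2 * s)"
          using that by (intro mult_left_mono) (auto intro: exp_ge_add_one_self)
        finally have "1 / exp (2 * s) \<le> 1 - s" by (simp add: divide_simps)
        then show ?thesis by (simp add: exp_minus inverse_eq_divide)
      qed
      then have "(\<Prod>j\<in>B. exp (- 2 * sel j S)) \<le> (\<Prod>j\<in>B. 1 - sel j S)"
        using sel_nonneg sel_le_half by (intro prod_mono) auto
      then have "exp (- 2 * (\<Sum>j\<in>B. sel j S)) \<le> (\<Prod>j\<in>B. 1 - sel j S)"
        using fB by (simp add: exp_sum sum_distrib_left)
      moreover from this have "(\<Prod>j\<in>B. 1 - sel j S) > 0" by (rule less_le_trans[OF exp_gt_zero])
      ultimately have "p0 / (\<Prod>j\<in>B. 1 - sel j S) \<le> p0 / exp (- 2 * (\<Sum>j\<in>B. sel j S))"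
        using p0 by (intro divide_left_mono) simp_all
      then show ?thesis by (simp add: exp_minus divide_simps)
    qed
    also have "\<dots> \<le> p0 * exp (4 * k * p0)"
      using True p0 by (intro mult_left_mono) auto
    finally have "sel i S = wt i i S" using cap by (simp add: sel_eq)
    moreover have "(\<Sum>j\<in>B. wt i i S * sel j S) \<ge> 0"
      by (intro sum_nonneg mult_nonneg_nonneg wt_nonneg sel_nonneg)
    ultimately show ?thesis using k0 p0 by simp
  next
    case False
    then have "1 \<le> (\<Sum>j\<in>B. sel j S) / (2 * k * p0)" using k0 p0 by (simp add: field_simps)
    then have "wt i i S * 1 \<le> wt i i S * ((\<Sum>j\<in>B. sel j S) / (2 * k * p0))"
      by (intro mult_left_mono wt_nonneg)
    then have "wt i i S - (\<Sum>j\<in>B. wt i i S * sel j S) / (2 * k * p0) \<le> 0"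
      by (simp add: sum_distrib_left)
    then show ?thesis using sel_nonneg[of i S] by linarith
  qed
  \<comment> \<open>By the product martingale each of the at most \<open>k\<close> neighbours
    contributes at most \<open>p0 * p0\<close>, so the correction term in \<open>point\<close> costs
    at most half of \<open>p0\<close>.\<close>
  have "Ex i (\<lambda>S. wt i i S * sel j S) \<le> p0 * p0" if "j \<in> B" for j
  proof -
    have j: "j < i" "adj j i" using that by (auto simp: B_def)
    have "Ex i (\<lambda>S. wt i i S * sel j S) \<le> Ex i (\<lambda>S. wt (min i j) j S * wt i i S)"
    proof (intro Ex_mono)
      fix S have "wt i i S * sel j S \<le> wt i i S * wt j j S"
        by (intro mult_left_mono wt_nonneg sel_le_wt)
      then show "wt i i S * sel j S \<le> wt (min i j) j S * wt i i S" using j by (simp add: mult.commute)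
    qed
    then show ?thesis using Ex_wt_mult[OF j(2), of i] by simp
  qed
  then have "(\<Sum>j\<in>B. Ex i (\<lambda>S. wt i i S * sel j S)) \<le> (\<Sum>j\<in>B. p0 * p0)" by (intro sum_mono)
  also have "\<dots> \<le> k * (p0 * p0)" using k p0 by (simp add: B_def mult_right_mono)
  finally have 1: "(\<Sum>j\<in>B. Ex i (\<lambda>S. wt i i S * sel j S)) / (2 * k * p0) \<le> p0 / 2"
    using k0 p0 by (simp add: field_simps)
  have "p0 / 2 \<le> p0 - (\<Sum>j\<in>B. Ex i (\<lambda>S. wt i i S * sel j S)) / (2 * k * p0)"
    using 1 by simp
  also have "\<dots> = Ex i (\<lambda>S. wt i i S - 1 / (2 * k * p0) * (\<Sum>j\<in>B. wt i i S * sel j S))"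
    unfolding Ex_diff Ex_mult Ex_sum[OF fB] Ex_wt by simp
  also have "\<dots> \<le> Ex i (sel i)"
    using point by (intro Ex_mono) simp
  finally show ?thesis .
qed

text \<open>Two independent runs: an arc is caught with probability at least p0^2 / 4, there are at
  least m k arcs, and both sets together have at most 2 m p0 vertices on average. The two sides
  balance at 8 c = p0 k.\<close>

lemma exists_dense_pair:
  fixes m :: nat and k c :: real
  assumes bck: "\<And>i. i < m \<Longrightarrow> real (card {j. j < i \<and> adj j i}) \<le> k"
    and deg: "\<And>i. i < m \<Longrightarrow> k \<le> real (card {j. j < m \<and> adj i j})"
    and k0: "k > 0" and p0: "p0 > 0" and m: "m > 0" and cap: "p0 * exp (4 * k * p0) \<le> 1/2"
    and c: "8 * c < p0 * k" "c \<ge> 0"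
  shows "\<exists>I J. feasible m I \<and> feasible m J \<and>
    c * (card I + card J) < card {(x, y). x \<in> I \<and> y \<in> J \<and> adj x y}"
proof -
  define A where "A = {(x, y). x < m \<and> y < m \<and> adj x y}"
  define q where "q i = Ex i (sel i)" for i
  have A_eq: "A = (SIGMA x:{..<m}. {y. y < m \<and> adj x y})" by (auto simp: A_def)
  have fA: "finite A" by (rule finite_subset[of _ "{..<m} \<times> {..<m}"]) (auto simp: A_def)
  define F where "F I J = (\<Sum>a\<in>A. of_bool (fst a \<in> I) * of_bool (snd a \<in> J)) -
     c * ((\<Sum>x<m. of_bool (x \<in> I)) + (\<Sum>x<m. of_bool (x \<in> J)))" for I J :: "nat set"
  have q: "p0 / 2 \<le> q i" "q i \<le> p0" if "i < m" for i
    unfolding q_def using Ex_sel_ge[OF bck[OF that] k0 p0 cap] Ex_sel_le[of i] by auto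
  have inner: "Ex m (F I) = (\<Sum>a\<in>A. q (snd a) * of_bool (fst a \<in> I)) -
     (c * (\<Sum>x<m. of_bool (x \<in> I)) + c * (\<Sum>x<m. q x))" for I
  proof -
    have "Ex m (F I) = (\<Sum>a\<in>A. of_bool (fst a \<in> I) * Ex m (\<lambda>J. of_bool (snd a \<in> J))) -
       c * ((\<Sum>x<m. of_bool (x \<in> I)) + (\<Sum>x<m. Ex m (\<lambda>J. of_bool (x \<in> J))))"
      unfolding F_def Ex_diff Ex_mult Ex_add Ex_const Ex_sum[OF fA] Ex_sum[OF finite_lessThan] by simp
    also have "(\<Sum>x<m. Ex m (\<lambda>J. of_bool (x \<in> J))) = (\<Sum>x<m. q x)"
      by (intro sum.cong) (auto simp: Ex_member q_def)
    also have "(\<Sum>a\<in>A. of_bool (fst a \<in> I) * Ex m (\<lambda>J. of_bool (snd a \<in> J))) =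
       (\<Sum>a\<in>A. q (snd a) * of_bool (fst a \<in> I))"
      by (intro sum.cong) (auto simp: Ex_member q_def A_def)
    finally show ?thesis by (simp add: algebra_simps)
  qed
  have "Ex m (\<lambda>I. Ex m (F I)) = (\<Sum>a\<in>A. q (snd a) * Ex m (\<lambda>I. of_bool (fst a \<in> I))) -
     (c * (\<Sum>x<m. Ex m (\<lambda>I. of_bool (x \<in> I))) + c * (\<Sum>x<m. q x))"
    unfolding inner Ex_diff Ex_mult Ex_add Ex_const Ex_sum[OF fA] Ex_sum[OF finite_lessThan] by simp
  also have "(\<Sum>x<m. Ex m (\<lambda>J. of_bool (x \<in> J))) = (\<Sum>x<m. q x)"
    by (intro sum.cong) (auto simp: Ex_member q_def)
  also have "(\<Sum>a\<in>A. q (snd a) * Ex m (\<lambda>I. of_bool (fst a \<in> I))) = (\<Sum>a\<in>A. q (snd a) * q (fst a))"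
    by (intro sum.cong) (auto simp: Ex_member q_def A_def)
  finally have val: "Ex m (\<lambda>I. Ex m (F I)) = (\<Sum>a\<in>A. q (snd a) * q (fst a)) - (2 * c) * (\<Sum>x<m. q x)"
    by simp
  have "(2 * c) * (\<Sum>x<m. q x) \<le> (2 * c) * (m * p0)"
    using sum_bounded_above[of "{..<m}" q p0] q c by (intro mult_left_mono) auto
  also have "\<dots> = (8 * c) * (m * p0 / 4)" by simp
  also have "\<dots> < (p0 * k) * (m * p0 / 4)"
    using c m p0 by (intro mult_strict_right_mono) auto
  also have "\<dots> = (m * k) * (p0 / 2 * (p0 / 2))" by simp
  also have "\<dots> \<le> card A * (p0 / 2 * (p0 / 2))"
  proof (intro mult_right_mono)
    have "m * k = (\<Sum>x<m. k)" by simp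
    also have "\<dots> \<le> (\<Sum>x<m. real (card {y. y < m \<and> adj x y}))" using deg by (intro sum_mono) auto
    also have "\<dots> = card A" unfolding A_eq by simp
    finally show "m * k \<le> card A" .
  qed (use p0 in auto)
  also have "\<dots> = (\<Sum>a\<in>A. p0 / 2 * (p0 / 2))" by simp
  also have "\<dots> \<le> (\<Sum>a\<in>A. q (snd a) * q (fst a))"
    using q p0 by (intro sum_mono mult_mono) (auto simp: A_def intro: order_trans[of 0 "p0/2"])
  finally have pos: "Ex m (\<lambda>I. Ex m (F I)) > 0" using val by simp
  have "\<exists>I J. feasible m I \<and> feasible m J \<and> F I J > 0"
  proof (rule ccontr)
    assume "\<not> ?thesis"
    then have "Ex m (\<lambda>I. Ex m (F I)) \<le> Ex m (\<lambda>I. Ex m (\<lambda>J. 0))"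
      by (intro Ex_mono) (auto simp: not_less)
    with pos show False by (simp add: Ex_const)
  qed
  then obtain I J where IJ: "feasible m I" "feasible m J" "F I J > 0" by blast
  have 1: "(\<Sum>x<m. of_bool (x \<in> I)) = real (card I)" if "feasible m I" for I
    using that by (simp add: of_bool_def sum.If_cases feasible_def Int_absorb1)
  have "(\<Sum>a\<in>A. of_bool (fst a \<in> I) * of_bool (snd a \<in> J)) = real (card {a \<in> A. fst a \<in> I \<and> snd a \<in> J})"
    using fA by (simp flip: of_bool_conj) (simp add: of_bool_def sum.If_cases Int_def)
  moreover have "{a \<in> A. fst a \<in> I \<and> snd a \<in> J} = {(x, y). x \<in> I \<and> y \<in> J \<and> adj x y}"
    using IJ by (auto simp: A_def feasible_def)
  ultimately have "F I J = real (card {(x, y). x \<in> I \<and> y \<in> J \<and> adj x y}) - c * (card I + card J)"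
    unfolding F_def using 1 IJ by simp
  then show ?thesis using IJ by (intro exI[of _ I] exI[of _ J]) simp
qed

end

text \<open>Take the largest minimum degree \<open>k\<close> of a nonempty induced subgraph; it is
  attained on \<open>S\<close>, and maximality is exactly degeneracy. Having the same
  \<open>k\<close> in both bounds matters because the selection probability is tuned to
  \<open>k\<close>.\<close>

lemma degeneracy_core:
  assumes "finite V" "V \<noteq> {}" "\<And>v. v \<in> V \<Longrightarrow> d \<le> deg E V v"
  shows "\<exists>S k. S \<subseteq> V \<and> S \<noteq> {} \<and> d \<le> k \<and> (\<forall>v\<in>S. k \<le> deg E S v) \<and>
    (\<forall>T\<subseteq>S. T \<noteq> {} \<longrightarrow> (\<exists>v\<in>T. deg E T v \<le> k))"
proof -
  define P where "P k \<longleftrightarrow> (\<exists>S\<subseteq>V. S \<noteq> {} \<and> (\<forall>v\<in>S. k \<le> deg E S v))" for k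
  have bound: "k \<le> card V" if Pk: "P k" for k
  proof -
    obtain S v where S: "S \<subseteq> V" "v \<in> S" "k \<le> deg E S v" using Pk by (auto simp: P_def)
    have "deg E S v \<le> card V" using S assms(1) nbrs_subset[of E S v] by (intro card_mono) auto
    then show ?thesis using S by simp
  qed
  have Pd: "P d" using assms by (auto simp: P_def)
  define k where "k = Greatest P"
  have Pk: "P k" unfolding k_def using Pd bound by (rule GreatestI_nat)
  have le: "j \<le> k" if "P j" for j unfolding k_def using that bound by (rule Greatest_le_nat)
  obtain S where S: "S \<subseteq> V" "S \<noteq> {}" "\<forall>v\<in>S. k \<le> deg E S v" using Pk by (auto simp: P_def)
  have "\<exists>v\<in>T. deg E T v \<le> k" if "T \<subseteq> S" "T \<noteq> {}" for T
  proof (rule ccontr)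
    assume "\<not> ?thesis"
    then have "P (Suc k)" unfolding P_def using that S(1) by (intro exI[of _ T]) (auto simp: not_le)
    then show False using le[of "Suc k"] by simp
  qed
  then show ?thesis using S le[OF Pd] by blast
qed

text \<open>The order is built from its end: a vertex of small degree is removed and placed
  last.\<close>

lemma degeneracy_order:
  assumes "finite S" "\<And>T. T \<subseteq> S \<Longrightarrow> T \<noteq> {} \<Longrightarrow> \<exists>v\<in>T. deg E T v \<le> k"
  shows "\<exists>f. bij_betw f {..<card S} S \<and> (\<forall>i<card S. card {j. j < i \<and> (f i, f j) \<in> E} \<le> k)"
  using assms
proof (induction "card S" arbitrary: S)
  case 0
  then show ?case by (intro exI[of _ undefined]) (auto simp: bij_betw_def)
next
  case (Suc n)
  then have "S \<noteq> {}" by auto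
  then obtain v where v: "v \<in> S" "deg E S v \<le> k" using Suc.prems(2)[of S] by auto
  have cn: "card (S - {v}) = n" using Suc.hyps(2) Suc.prems(1) v by simp
  have "\<exists>f. bij_betw f {..<card (S - {v})} (S - {v}) \<and>
      (\<forall>i<card (S - {v}). card {j. j < i \<and> (f i, f j) \<in> E} \<le> k)"
  proof (rule Suc.hyps(1))
    show "\<exists>v\<in>T. deg E T v \<le> k" if "T \<subseteq> S - {v}" "T \<noteq> {}" for T
      using that by (intro Suc.prems(2)) auto
  qed (use cn Suc.prems(1) in auto)
  then obtain f where f: "bij_betw f {..<n} (S - {v})" "\<forall>i<n. card {j. j < i \<and> (f i, f j) \<in> E} \<le> k"
    unfolding cn by blast
  let ?f = "f(n := v)"
  have "bij_betw ?f {..<n} (S - {v})" using f(1) by (subst bij_betw_cong[of _ _ f]) auto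
  then have "bij_betw ?f ({..<n} \<union> {n}) ((S - {v}) \<union> {?f n})" by (intro notIn_Un_bij_betw) auto
  then have bij: "bij_betw ?f {..<card S} S"
    using v Suc.hyps(2)[symmetric] by (simp add: lessThan_Suc insert_absorb Un_commute)
  have "card {j. j < i \<and> (?f i, ?f j) \<in> E} \<le> k" if "i < card S" for i
  proof (cases "i = n")
    case True
    have inj: "inj_on f {..<n}" using f(1) by (simp add: bij_betw_def)
    have "f ` {j. j < n \<and> (v, f j) \<in> E} \<subseteq> nbrs E S v"
      using f(1) by (auto simp: nbrs_def bij_betw_def)
    then have "card (f ` {j. j < n \<and> (v, f j) \<in> E}) \<le> deg E S v"
      using Suc.prems(1) by (intro card_mono) auto
    moreover have "card (f ` {j. j < n \<and> (v, f j) \<in> E}) = card {j. j < n \<and> (v, f j) \<in> E}"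
      by (intro card_image inj_on_subset[OF inj]) auto
    moreover have "{j. j < i \<and> (?f i, ?f j) \<in> E} = {j. j < n \<and> (v, f j) \<in> E}" using True by auto
    ultimately show ?thesis using v(2) by simp
  next
    case False
    then have i: "i < n" using that Suc.hyps(2) by simp
    have "{j. j < i \<and> (?f i, ?f j) \<in> E} = {j. j < i \<and> (f i, f j) \<in> E}" using i by auto
    then show ?thesis using f(2) i by simp
  qed
  with bij show ?case by blast
qed

lemma min_degree_log:
  fixes d :: nat
  assumes g: "sgraph V E" and t: "trifree E" and V: "V \<noteq> {}"
    and d: "\<And>v. v \<in> V \<Longrightarrow> d \<le> deg E V v" and d2: "d \<ge> 2"
  shows "\<exists>S \<subseteq> V. S \<noteq> {} \<and> bip E S \<and> (\<forall>v\<in>S. ln (real d) / 128 \<le> deg E S v)"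
proof -
  obtain S k where S: "S \<subseteq> V" "S \<noteq> {}" "d \<le> k" "\<forall>v\<in>S. k \<le> deg E S v"
     "\<forall>T\<subseteq>S. T \<noteq> {} \<longrightarrow> (\<exists>v\<in>T. deg E T v \<le> k)"
    using degeneracy_core[OF sgraphD(1)[OF g] V d] by blast
  have fS: "finite S" using S(1) sgraphD(1)[OF g] by (rule finite_subset)
  define m where "m = card S"
  obtain f where f: "bij_betw f {..<m} S" "\<forall>i<m. card {j. j < i \<and> (f i, f j) \<in> E} \<le> k"
    using degeneracy_order[of S E k] fS S(5) unfolding m_def by blast
  have m0: "m > 0" using S(2) fS by (simp add: m_def card_gt_0_iff)
  have inj: "inj_on f {..<m}" and img: "f ` {..<m} = S" using f(1) by (auto simp: bij_betw_def)
  have k2: "k \<ge> 2" using d2 S(3) by simp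
  define adj where "adj i j \<longleftrightarrow> i < m \<and> j < m \<and> (f i, f j) \<in> E" for i j
  \<comment> \<open>The exponent \<open>4 * k * p0\<close> becomes \<open>ln k / 2\<close>, so
    weights grow by at most \<open>sqrt k\<close> in the good case and stay below the cap, while
    \<open>p0 * k\<close> keeps the order of \<open>ln k\<close>.\<close>
  define p0 where "p0 = ln (real k) / (8 * real k)"
  have p0: "p0 > 0" using k2 by (simp add: p0_def)
  interpret weighted_greedy adj p0
  proof
    show "adj i j \<Longrightarrow> adj j i" for i j using sgraphD(3)[OF g] by (auto simp: adj_def)
    show "\<not> adj i i" for i using sgraphD(4)[OF g] by (auto simp: adj_def)
    show "adj i j \<Longrightarrow> adj j l \<Longrightarrow> \<not> adj i l" for i j l
      using t sgraphD(3)[OF g] unfolding adj_def trifree_def by blast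
  qed (use p0 in simp)
  have cap: "p0 * exp (4 * real k * p0) \<le> 1/2"
  proof -
    have "exp (4 * real k * p0) = exp (ln (real k) / 2)" using k2 by (simp add: p0_def)
    also have "\<dots> = sqrt k" using k2 by (simp add: ln_sqrt[symmetric])
    finally have e: "exp (4 * real k * p0) = sqrt k" .
    have "ln (real k) = 2 * ln (sqrt k)" using k2 by (simp add: ln_sqrt)
    also have "\<dots> \<le> 2 * sqrt k" using ln_bound[of "sqrt k"] k2 by simp
    finally have "ln (real k) * sqrt k \<le> 2 * sqrt k * sqrt k" by (intro mult_right_mono) auto
    then have "ln (real k) * sqrt k \<le> 2 * k" by (simp add: mult.assoc)
    then show ?thesis unfolding e using k2 by (simp add: p0_def field_simps)
  qed
  have "\<exists>I J. feasible m I \<and> feasible m J \<and>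
    ln (real k) / 128 * (card I + card J) < card {(x, y). x \<in> I \<and> y \<in> J \<and> adj x y}"
  proof (rule exists_dense_pair[OF _ _ _ p0 m0 cap])
    show "real (card {j. j < i \<and> adj j i}) \<le> real k" if "i < m" for i
    proof -
      have "{j. j < i \<and> adj j i} = {j. j < i \<and> (f i, f j) \<in> E}"
        using that sgraphD(3)[OF g] by (auto simp: adj_def)
      then show ?thesis using f(2) that by simp
    qed
    show "real k \<le> real (card {j. j < m \<and> adj i j})" if "i < m" for i
    proof -
      have "nbrs E S (f i) = f ` {j. j < m \<and> adj i j}"
        using that by (auto simp: nbrs_def adj_def img[symmetric])
      moreover have "card (f ` {j. j < m \<and> adj i j}) = card {j. j < m \<and> adj i j}"
        by (intro card_image inj_on_subset[OF inj]) auto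
      ultimately show ?thesis using S(4) that img by (metis imageI lessThan_iff of_nat_le_iff)
    qed
    show "8 * (ln (real k) / 128) < p0 * real k" using k2 by (simp add: p0_def)
  qed (use k2 in auto)
  then obtain I J where IJ: "feasible m I" "feasible m J"
    "ln (real k) / 128 * (card I + card J) < card {(x, y). x \<in> I \<and> y \<in> J \<and> adj x y}" by blast
  have sub: "I \<subseteq> {..<m}" "J \<subseteq> {..<m}" using IJ by (auto simp: feasible_def)
  have ind: "indep E (f ` I)" "indep E (f ` J)"
    using IJ(1,2) sub by (auto simp: indep_def feasible_def adj_def subset_iff)
  have cI: "card (f ` I) = card I" "card (f ` J) = card J"
    using sub by (auto intro: card_image inj_on_subset[OF inj])
  have "card {(x, y). x \<in> I \<and> y \<in> J \<and> adj x y} = card (E \<inter> f ` I \<times> f ` J)"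
  proof (rule bij_betw_same_card[of "map_prod f f"], unfold bij_betw_def, intro conjI)
    show "inj_on (map_prod f f) {(x, y). x \<in> I \<and> y \<in> J \<and> adj x y}"
      by (intro inj_on_subset[OF map_prod_inj_on[OF inj inj]]) (use sub in auto)
    show "map_prod f f ` {(x, y). x \<in> I \<and> y \<in> J \<and> adj x y} = E \<inter> f ` I \<times> f ` J"
      using sub by (auto simp: adj_def image_iff subset_iff)
  qed
  then have "ln (real k) / 128 * (card (f ` I) + card (f ` J)) < card (E \<inter> f ` I \<times> f ` J)"
    using IJ(3) cI by simp
  then have "\<exists>T \<subseteq> V. T \<noteq> {} \<and> bip E T \<and> (\<forall>v\<in>T. ln (real k) / 128 \<le> deg E T v)"
    using sub img S(1) k2 by (intro dense_pair_imp_min_degree[OF g ind(1) _ ind(2)]) auto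
  moreover have "ln (real d) / 128 \<le> ln (real k) / 128" using d2 S(3) by simp
  ultimately show ?thesis by (meson order_trans)
qed

section \<open>Tail bounds for binomial random subsets, and destroying triangles by deletion\<close>

section \<open>Random sets and alteration\<close>


text \<open>The law of the binomial random subset of \<open>\<Omega>\<close>, with every element
  present independently with probability \<open>p\<close>; finite sums suffice.\<close>

definition pr :: "'a set \<Rightarrow> real \<Rightarrow> ('a set \<Rightarrow> bool) \<Rightarrow> real" where
  "pr \<Omega> p P = (\<Sum>E | E \<subseteq> \<Omega> \<and> P E. p ^ card E * (1 - p) ^ card (\<Omega> - E))"

context
  fixes \<Omega> :: "'a set" and p :: real
  assumes fin: "finite \<Omega>" and p01: "0 \<le> p" "p \<le> 1"
begin

lemma pr_True: "pr \<Omega> p (\<lambda>_. True) = 1"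
proof -
  have "(\<Prod>e\<in>\<Omega>. p + (1 - p)) = (\<Sum>E\<in>Pow \<Omega>. (\<Prod>e\<in>E. p) * (\<Prod>e\<in>\<Omega>-E. 1 - p))"
    using fin by (rule prod_add)
  then show ?thesis by (simp add: pr_def Pow_def)
qed

lemma pr_mono: "(\<And>E. E \<subseteq> \<Omega> \<Longrightarrow> P E \<Longrightarrow> Q E) \<Longrightarrow> pr \<Omega> p P \<le> pr \<Omega> p Q"
  unfolding pr_def using fin p01 by (intro sum_mono2) auto

lemma pr_less_1_imp_ex: "pr \<Omega> p P < 1 \<Longrightarrow> \<exists>E\<subseteq>\<Omega>. \<not> P E"
  using pr_mono[of "\<lambda>_. True" P] pr_True by force

lemma pr_Un: "pr \<Omega> p (\<lambda>E. P E \<or> Q E) \<le> pr \<Omega> p P + pr \<Omega> p Q"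
proof -
  let ?w = "\<lambda>E. p ^ card E * (1 - p) ^ card (\<Omega> - E)"
  have "{E. E \<subseteq> \<Omega> \<and> (P E \<or> Q E)} = {E. E \<subseteq> \<Omega> \<and> P E} \<union> {E. E \<subseteq> \<Omega> \<and> Q E}" by auto
  moreover have "sum ?w ({E. E \<subseteq> \<Omega> \<and> P E} \<union> {E. E \<subseteq> \<Omega> \<and> Q E}) \<le>
      sum ?w {E. E \<subseteq> \<Omega> \<and> P E} + sum ?w {E. E \<subseteq> \<Omega> \<and> Q E}"
    using fin p01 by (subst sum.union_inter[symmetric]) (auto intro!: sum_nonneg)
  ultimately show ?thesis by (simp add: pr_def)
qed

lemma pr_UN:
  assumes "finite J" shows "pr \<Omega> p (\<lambda>E. \<exists>j\<in>J. P j E) \<le> (\<Sum>j\<in>J. pr \<Omega> p (P j))"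
  using assms
proof (induction J rule: finite_induct)
  case empty
  then show ?case by (simp add: pr_def)
next
  case (insert j J)
  then show ?case using pr_Un[of "P j" "\<lambda>E. \<exists>j\<in>J. P j E"] by simp
qed

lemma pr_superset:
  assumes "F \<subseteq> \<Omega>" shows "pr \<Omega> p (\<lambda>E. F \<subseteq> E) = p ^ card F"
proof -
  \<comment> \<open>The zero factor removes from the expanded product every set that misses an
    element of \<open>F\<close>.\<close>
  let ?b = "\<lambda>e. if e \<in> F then 0 else 1 - p"
  have "(\<Prod>e\<in>\<Omega>. p + ?b e) = (\<Sum>E\<in>Pow \<Omega>. (\<Prod>e\<in>E. p) * (\<Prod>e\<in>\<Omega>-E. ?b e))"
    using fin by (rule prod_add)
  also have "\<dots> = (\<Sum>E\<in>{E. E \<subseteq> \<Omega> \<and> F \<subseteq> E}. (\<Prod>e\<in>E. p) * (\<Prod>e\<in>\<Omega>-E. ?b e))"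
    using fin assms by (intro sum.mono_neutral_right) auto
  also have "\<dots> = pr \<Omega> p (\<lambda>E. F \<subseteq> E)"
    unfolding pr_def
  proof (intro sum.cong refl)
    fix E assume "E \<in> {E. E \<subseteq> \<Omega> \<and> F \<subseteq> E}"
    then have "(\<Prod>e\<in>\<Omega>-E. ?b e) = (\<Prod>e\<in>\<Omega>-E. 1 - p)" by (intro prod.cong) auto
    then show "(\<Prod>e\<in>E. p) * (\<Prod>e\<in>\<Omega>-E. ?b e) = p ^ card E * (1 - p) ^ card (\<Omega> - E)" by simp
  qed
  finally have "pr \<Omega> p (\<lambda>E. F \<subseteq> E) = (\<Prod>e\<in>\<Omega>. p + ?b e)" by simp
  also have "\<dots> = (\<Prod>e\<in>\<Omega>. if e \<in> F then p else 1)" by (intro prod.cong) auto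
  also have "\<dots> = p ^ card F" using fin assms by (simp add: prod.If_cases Int_absorb1)
  finally show ?thesis .
qed

lemma pr_family:
  assumes "finite \<F>" "\<And>F. F \<in> \<F> \<Longrightarrow> F \<subseteq> \<Omega> \<and> card F = k"
  shows "pr \<Omega> p (\<lambda>E. \<exists>F\<in>\<F>. F \<subseteq> E) \<le> card \<F> * p ^ k"
proof -
  have "pr \<Omega> p (\<lambda>E. \<exists>F\<in>\<F>. F \<subseteq> E) \<le> (\<Sum>F\<in>\<F>. pr \<Omega> p (\<lambda>E. F \<subseteq> E))"
    using assms(1) by (rule pr_UN)
  also have "\<dots> = (\<Sum>F\<in>\<F>. p ^ k)" using assms(2) by (intro sum.cong) (auto simp: pr_superset)
  finally show ?thesis by simp
qed

text \<open>Exponential moment with parameter 1: the moment contributes -3/5 and the threshold 1/2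
  to the exponent, leaving -1/10.\<close>

lemma pr_lower_tail:
  assumes "A \<subseteq> \<Omega>"
  shows "pr \<Omega> p (\<lambda>E. card (E \<inter> A) \<le> p * card A / 2) \<le> exp (- p * card A / 10)"
proof -
  have fA: "finite A" using assms fin by (rule finite_subset)
  let ?f = "\<lambda>e. if e \<in> A then exp (-1) else 1 :: real"
  let ?w = "\<lambda>E. p ^ card E * (1 - p) ^ card (\<Omega> - E)"
  have "(\<Prod>e\<in>\<Omega>. p * ?f e + (1 - p)) = (\<Sum>E\<in>Pow \<Omega>. (\<Prod>e\<in>E. p * ?f e) * (\<Prod>e\<in>\<Omega>-E. 1 - p))"
    using fin by (rule prod_add)
  also have "\<dots> = (\<Sum>E\<in>Pow \<Omega>. ?w E * exp (- real (card (E \<inter> A))))"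
  proof (intro sum.cong refl)
    fix E assume "E \<in> Pow \<Omega>"
    then have "finite E" using fin finite_subset by auto
    then have "(\<Prod>e\<in>E. ?f e) = exp (- real (card (E \<inter> A)))"
      by (simp add: prod.If_cases exp_of_nat_mult[symmetric])
    then show "(\<Prod>e\<in>E. p * ?f e) * (\<Prod>e\<in>\<Omega>-E. 1 - p) = ?w E * exp (- real (card (E \<inter> A)))"
      by (simp add: prod.distrib)
  qed
  finally have gen: "(\<Sum>E\<in>Pow \<Omega>. ?w E * exp (- real (card (E \<inter> A)))) = (\<Prod>e\<in>\<Omega>. p * ?f e + (1 - p))" ..
  have "exp (-1 :: real) \<le> 2/5"
    using exp_lower_Taylor_quadratic[of 1] by (simp add: exp_minus field_simps)
  then have "p * exp (-1) \<le> p * (2/5)" using p01 by (intro mult_left_mono)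
  then have le: "p * exp (-1) + (1 - p) \<le> exp (- (3/5) * p)"
    using exp_ge_add_one_self[of "- (3/5) * p"] by simp
  have "pr \<Omega> p (\<lambda>E. card (E \<inter> A) \<le> p * card A / 2) \<le>
      (\<Sum>E | E \<subseteq> \<Omega> \<and> card (E \<inter> A) \<le> p * card A / 2. ?w E * exp (p * card A / 2 - card (E \<inter> A)))"
    unfolding pr_def
  proof (intro sum_mono)
    fix E assume "E \<in> {E. E \<subseteq> \<Omega> \<and> card (E \<inter> A) \<le> p * card A / 2}"
    then have "?w E * 1 \<le> ?w E * exp (p * card A / 2 - card (E \<inter> A))"
      using p01 by (intro mult_left_mono) auto
    then show "?w E \<le> ?w E * exp (p * card A / 2 - card (E \<inter> A))" by simp
  qed
  also have "\<dots> \<le> (\<Sum>E\<in>Pow \<Omega>. ?w E * exp (p * card A / 2 - card (E \<inter> A)))"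
    using fin p01 by (intro sum_mono2) auto
  also have "\<dots> = exp (p * card A / 2) * (\<Prod>e\<in>\<Omega>. p * ?f e + (1 - p))"
    unfolding gen[symmetric] sum_distrib_left
    by (intro sum.cong refl) (simp only: exp_diff exp_minus, simp add: field_simps)
  also have "(\<Prod>e\<in>\<Omega>. p * ?f e + (1 - p)) = (\<Prod>e\<in>\<Omega>. if e \<in> A then p * exp (-1) + (1 - p) else 1)"
    by (intro prod.cong) auto
  also have "\<dots> = (p * exp (-1) + (1 - p)) ^ card A"
    using fin assms by (simp add: prod.If_cases Int_absorb1)
  also have "exp (p * card A / 2) * (p * exp (-1) + (1 - p)) ^ card A \<le>
      exp (p * card A / 2) * exp (- (3/5) * p) ^ card A"
    using le p01 by (intro mult_left_mono power_mono) auto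
  also have "\<dots> = exp (- p * card A / 10)"
    by (simp add: exp_of_nat_mult[symmetric] exp_add[symmetric])
  finally show ?thesis .
qed

end

text \<open>A single term of the exponential series at \<open>k\<close>.\<close>

lemma power_le_exp_mult_fact: "real k ^ k \<le> exp (real k) * fact k"
proof -
  have "(\<Sum>n\<in>{k}. real k ^ n /\<^sub>R fact n) \<le> (\<Sum>n. real k ^ n /\<^sub>R fact n)"
    by (intro sum_le_suminf summable_exp_generic) auto
  then show ?thesis by (simp add: exp_def divide_simps mult.commute)
qed

lemma binomial_le_exp:
  assumes "k > 0" shows "real (n choose k) \<le> (exp 1 * n / k) ^ k"
proof -
  have 1: "real (n choose k) * fact k \<le> real n ^ k"
    using binomial_fact_pow[of n k] by (metis of_nat_fact of_nat_le_iff of_nat_mult of_nat_power)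
  have "real (n choose k) * real k ^ k \<le> real (n choose k) * (exp (real k) * fact k)"
    by (intro mult_left_mono power_le_exp_mult_fact) auto
  also have "\<dots> = (real (n choose k) * fact k) * exp (real k)" by simp
  also have "\<dots> \<le> real n ^ k * exp (real k)" using 1 by (intro mult_right_mono) auto
  also have "\<dots> = (exp 1 * n) ^ k" by (simp add: power_mult_distrib exp_of_nat_mult[symmetric])
  finally show ?thesis using assms by (simp add: power_divide field_simps)
qed

text \<open>First moment over the \<open>k\<close>-subsets of \<open>A\<close>. Disjointness from
  \<open>F\<close> makes the two requirements independent; later \<open>F\<close> is a star at a hub
  and \<open>A\<close> a rectangle avoiding that hub.\<close>

lemma pr_superset_upper_tail:
  assumes fin: "finite \<Omega>" and p: "0 \<le> p" "p \<le> 1" and F: "F \<subseteq> \<Omega>" and A: "A \<subseteq> \<Omega>" "F \<inter> A = {}"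
    and k: "k > 0"
  shows "pr \<Omega> p (\<lambda>E. F \<subseteq> E \<and> k \<le> card (E \<inter> A)) \<le> p ^ card F * (exp 1 * p * card A / k) ^ k"
proof -
  have fA: "finite A" "finite F" using A F fin finite_subset by blast+
  let ?G = "(\<lambda>G. F \<union> G) ` {G. G \<subseteq> A \<and> card G = k}"
  have "pr \<Omega> p (\<lambda>E. F \<subseteq> E \<and> k \<le> card (E \<inter> A)) \<le> pr \<Omega> p (\<lambda>E. \<exists>G\<in>?G. G \<subseteq> E)"
  proof (intro pr_mono fin p)
    fix E assume *: "F \<subseteq> E \<and> k \<le> card (E \<inter> A)"
    then obtain G where "G \<subseteq> E \<inter> A" "card G = k" by (meson obtain_subset_with_card_n)
    then have "F \<union> G \<in> ?G" "F \<union> G \<subseteq> E" using * by auto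
    then show "\<exists>G\<in>?G. G \<subseteq> E" by blast
  qed
  also have "\<dots> \<le> card ?G * p ^ (card F + k)"
  proof (intro pr_family fin p)
    show "finite ?G" using fA by simp
    fix G' assume "G' \<in> ?G"
    then obtain G where G: "G' = F \<union> G" "G \<subseteq> A" "card G = k" by auto
    have "finite G" using G(2) fA(1) by (rule finite_subset)
    then have "card G' = card F + k"
      using G A(2) fA unfolding G(1) by (subst card_Un_disjoint) auto
    then show "G' \<subseteq> \<Omega> \<and> card G' = card F + k" using G F A by auto
  qed
  also have "\<dots> \<le> real (card A choose k) * p ^ (card F + k)"
  proof (intro mult_right_mono)
    have "card ?G \<le> card {G. G \<subseteq> A \<and> card G = k}" using fA by (intro card_image_le) simp
    then show "real (card ?G) \<le> real (card A choose k)" using fA by (simp add: n_subsets)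
  qed (use p in auto)
  also have "\<dots> \<le> (exp 1 * card A / k) ^ k * p ^ (card F + k)"
    using p k by (intro mult_right_mono binomial_le_exp) auto
  also have "\<dots> = p ^ card F * (exp 1 * p * card A / k) ^ k"
    by (simp add: power_add power_mult_distrib power_divide ac_simps)
  finally show ?thesis .
qed

lemma pr_upper_tail:
  assumes "finite \<Omega>" "0 \<le> p" "p \<le> 1" "A \<subseteq> \<Omega>" "k > 0"
  shows "pr \<Omega> p (\<lambda>E. k \<le> card (E \<inter> A)) \<le> (exp 1 * p * card A / k) ^ k"
  using pr_superset_upper_tail[of \<Omega> p "{}" A k] assms by simp

lemma third_le_exp: "1 / 3 \<le> exp (-1 :: real)"
  using exp_le by (simp add: exp_minus field_simps)

lemma maximal_disjoint_subfamily:
  assumes "finite \<A>"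
  shows "\<exists>\<S>\<subseteq>\<A>. disjoint \<S> \<and> (\<forall>T\<in>\<A>. T \<in> \<S> \<or> T \<inter> \<Union>\<S> \<noteq> {})"
proof -
  define D where "D = {\<S>. \<S> \<subseteq> \<A> \<and> disjoint \<S>}"
  have "finite D" unfolding D_def using assms by simp
  moreover have "D \<noteq> {}" unfolding D_def by (auto intro: exI[of _ "{}"])
  ultimately obtain \<S> where D: "\<S> \<in> D" "\<And>\<S>'. \<S>' \<in> D \<Longrightarrow> \<S> \<subseteq> \<S>' \<Longrightarrow> \<S> = \<S>'"
    using finite_has_maximal[of D] by blast
  then have S: "\<S> \<subseteq> \<A>" "disjoint \<S>" by (simp_all add: D_def)
  have "T \<in> \<S> \<or> T \<inter> \<Union>\<S> \<noteq> {}" if "T \<in> \<A>" for T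
  proof (rule ccontr)
    assume *: "\<not> ?thesis"
    then have "disjoint (insert T \<S>)" using S(2) by (auto simp: disjoint_def)
    then have "insert T \<S> \<in> D" using that S(1) by (simp add: D_def)
    then have "\<S> = insert T \<S>" by (rule D(2)) blast
    then show False using * by auto
  qed
  then show ?thesis using S by blast
qed

text \<open>
  Alteration: delete from a random set a maximal disjoint family of forbidden triples.
  A fixed set \<open>A i\<close> is unlikely to meet many disjoint triples, so it loses few elements.
\<close>

lemma alteration:
  fixes \<Omega> :: "'a set" and p :: real and A :: "'i \<Rightarrow> 'a set" and Q :: "'j \<Rightarrow> 'a set"
  assumes fin: "finite \<Omega>" and p: "0 < p" "p \<le> 1"
    and T: "\<And>T. T \<in> \<T> \<Longrightarrow> T \<subseteq> \<Omega> \<and> card T = 3"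
    and deg: "\<And>e. e \<in> \<Omega> \<Longrightarrow> card {T \<in> \<T>. e \<in> T} \<le> n" and np: "250 * real n * p ^ 2 \<le> 1"
    and I: "finite I" "\<And>i. i \<in> I \<Longrightarrow> A i \<subseteq> \<Omega>" and J: "finite J" "\<And>j. j \<in> J \<Longrightarrow> Q j \<subseteq> \<Omega> \<and> k j > 0"
    and less: "(\<Sum>i\<in>I. 2 * exp (- p * card (A i) / 24)) + (\<Sum>j\<in>J. (exp 1 * p * card (Q j) / k j) ^ k j) < 1"
  shows "\<exists>\<Gamma>\<subseteq>\<Omega>. (\<forall>T\<in>\<T>. \<not> T \<subseteq> \<Gamma>) \<and> (\<forall>i\<in>I. p * card (A i) / 4 \<le> card (\<Gamma> \<inter> A i)) \<and>
     (\<forall>j\<in>J. card (\<Gamma> \<inter> Q j) < k j)"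
proof -
  have fT: "finite \<T>" by (rule finite_subset[of _ "Pow \<Omega>"]) (use T fin in auto)
  define touch where "touch i = {T \<in> \<T>. T \<inter> A i \<noteq> {}}" for i
  \<comment> \<open>Removing fewer than \<open>s\<close> triples costs at most 3/24 of the mean
    \<open>p * card (A i)\<close>; from the half guaranteed by the lower tail more than a quarter
    survives.\<close>
  define s where "s i = nat \<lceil>p * card (A i) / 24\<rceil>" for i
  define many where "many i E \<longleftrightarrow> (\<exists>\<S>\<subseteq>touch i. card \<S> = s i \<and> disjoint \<S> \<and> \<Union>\<S> \<subseteq> E)" for i E
  have ftouch: "finite (touch i)" for i using fT by (simp add: touch_def)
  have ffam: "finite {\<S>. \<S> \<subseteq> touch i \<and> P \<S>}" for i P
    by (rule finite_subset[of _ "Pow (touch i)"]) (use ftouch in auto)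
  \<comment> \<open>An empty \<open>A i\<close> would contribute 2 to the sum in
    \<open>less\<close>.\<close>
  have pos: "card (A i) > 0" if "i \<in> I" for i
  proof (rule ccontr)
    assume "\<not> ?thesis"
    then have "2 \<le> 2 * exp (- p * card (A i) / 24)" by simp
    also have "\<dots> \<le> (\<Sum>i\<in>I. 2 * exp (- p * card (A i) / 24))"
      using that I by (intro member_le_sum) auto
    also have "(\<Sum>j\<in>J. (exp 1 * p * card (Q j) / k j) ^ k j) \<ge> 0" using p by (intro sum_nonneg) auto
    ultimately show False using less by linarith
  qed
  have pr_many: "pr \<Omega> p (many i) \<le> exp (- p * card (A i) / 24)" if i: "i \<in> I" for i
  proof -
    let ?F = "\<Union> ` {\<S>. \<S> \<subseteq> touch i \<and> card \<S> = s i \<and> disjoint \<S>}"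
    have fA: "finite (A i)" using I(2)[OF i] fin by (rule finite_subset)
    have s_ge: "p * card (A i) / 24 \<le> s i" unfolding s_def by linarith
    then have s_pos: "s i > 0" using pos[OF i] p
      unfolding s_def by simp
    have card_touch: "card (touch i) \<le> card (A i) * n"
    proof -
      have "touch i \<subseteq> (\<Union>e\<in>A i. {T \<in> \<T>. e \<in> T})" by (auto simp: touch_def)
      then have "card (touch i) \<le> card (\<Union>e\<in>A i. {T \<in> \<T>. e \<in> T})"
        using fA fT by (intro card_mono) auto
      also have "\<dots> \<le> (\<Sum>e\<in>A i. card {T \<in> \<T>. e \<in> T})" using fA by (rule card_UN_le)
      also have "\<dots> \<le> (\<Sum>e\<in>A i. n)" using I(2)[OF i] deg by (intro sum_mono) auto
      finally show ?thesis by simp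
    qed
    have "pr \<Omega> p (many i) \<le> pr \<Omega> p (\<lambda>E. \<exists>F\<in>?F. F \<subseteq> E)"
      using fin p by (intro pr_mono) (auto simp: many_def)
    also have "\<dots> \<le> card ?F * p ^ (3 * s i)"
    proof (intro pr_family)
      show "finite ?F" by (rule finite_imageI[OF ffam])
      fix F assume "F \<in> ?F"
      then obtain \<S> where S: "F = \<Union>\<S>" "\<S> \<subseteq> touch i" "card \<S> = s i" "disjoint \<S>" by auto
      have ST: "T \<subseteq> \<Omega> \<and> card T = 3" if "T \<in> \<S>" for T using that S(2) T by (auto simp: touch_def)
      then have "card F = (\<Sum>T\<in>\<S>. card T)"
        unfolding S(1) using S(4) fin by (intro card_Union_disjoint) (auto intro: finite_subset)
      also have "\<dots> = 3 * s i" using ST S(3) by simp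
      finally show "F \<subseteq> \<Omega> \<and> card F = 3 * s i" using ST S(1) by auto
    qed (use fin p in auto)
    also have "\<dots> \<le> real (card (touch i) choose s i) * p ^ (3 * s i)"
    proof (intro mult_right_mono)
      have "card ?F \<le> card {\<S>. \<S> \<subseteq> touch i \<and> card \<S> = s i \<and> disjoint \<S>}"
        by (rule card_image_le[OF ffam])
      also have "\<dots> \<le> card {\<S>. \<S> \<subseteq> touch i \<and> card \<S> = s i}"
        by (rule card_mono[OF ffam]) blast
      also have "\<dots> = card (touch i) choose s i" using ftouch by (rule n_subsets)
      finally show "real (card ?F) \<le> real (card (touch i) choose s i)" by simp
    qed (use p in auto)
    also have "\<dots> \<le> (exp 1 * card (touch i) / s i) ^ s i * p ^ (3 * s i)"
      using s_pos p by (intro mult_right_mono binomial_le_exp) auto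
    also have "\<dots> = (exp 1 * card (touch i) / s i * p ^ 3) ^ s i"
      by (simp only: power_mult_distrib power_mult)
    \<comment> \<open>A choice of \<open>s\<close> disjoint triples fixes \<open>3 * s\<close>
      elements, and at most \<open>card (A i) * n\<close> triples are available. With
      \<open>s\<close> at least 1/24 of the mean, the base is at most \<open>72 * n * p ^ 2\<close>,
      which the 250 in \<open>np\<close> pushes below 1/3.\<close>
    also have "\<dots> \<le> exp (-1) ^ s i"
    proof (intro power_mono)
      have "exp 1 * real (card (touch i)) \<le> 3 * real (card (A i) * n)"
        using card_touch exp_le by (intro mult_mono) (simp_all del: of_nat_mult)
      then have "exp 1 * card (touch i) / s i * p ^ 3 \<le> 3 * real (card (A i) * n) / s i * p ^ 3"
        using p by (intro mult_right_mono divide_right_mono) auto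
      also have "\<dots> = (p * card (A i) / 24) / s i * (72 * (n * p ^ 2))"
        by (simp add: power2_eq_square power3_eq_cube)
      also have "\<dots> \<le> 1 * (72 * (n * p ^ 2))"
        using s_ge s_pos by (intro mult_right_mono) (auto simp: divide_le_eq_1)
      also have "\<dots> \<le> 1 / 3" using np by simp
      also note third_le_exp
      finally show "exp 1 * card (touch i) / s i * p ^ 3 \<le> exp (-1)" .
    qed (use p in auto)
    also have "\<dots> = exp (- real (s i))" by (simp add: exp_of_nat_mult[symmetric])
    also have "\<dots> \<le> exp (- p * card (A i) / 24)" using s_ge by simp
    finally show ?thesis .
  qed
  have pr_few: "pr \<Omega> p (\<lambda>E. card (E \<inter> A i) \<le> p * card (A i) / 2) \<le> exp (- p * card (A i) / 24)"
    if i: "i \<in> I" for i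
  proof -
    have "pr \<Omega> p (\<lambda>E. card (E \<inter> A i) \<le> p * card (A i) / 2) \<le> exp (- p * card (A i) / 10)"
      using fin p I(2)[OF i] by (intro pr_lower_tail) auto
    also have "\<dots> \<le> exp (- p * card (A i) / 24)"
    proof -
      have "p * card (A i) / 24 \<le> p * card (A i) / 10" using p by (intro divide_left_mono) auto
      then show ?thesis by simp
    qed
    finally show ?thesis .
  qed
  let ?bad1 = "\<lambda>i E. card (E \<inter> A i) \<le> p * card (A i) / 2 \<or> many i E"
  let ?bad2 = "\<lambda>j E. k j \<le> card (E \<inter> Q j)"
  have "pr \<Omega> p (\<lambda>E. (\<exists>i\<in>I. ?bad1 i E) \<or> (\<exists>j\<in>J. ?bad2 j E)) \<le>
      pr \<Omega> p (\<lambda>E. \<exists>i\<in>I. ?bad1 i E) + pr \<Omega> p (\<lambda>E. \<exists>j\<in>J. ?bad2 j E)"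
    using p by (intro pr_Un fin) auto
  also have "\<dots> \<le> (\<Sum>i\<in>I. pr \<Omega> p (?bad1 i)) + (\<Sum>j\<in>J. pr \<Omega> p (?bad2 j))"
    using p I(1) J(1) by (intro add_mono pr_UN fin) auto
  also have "\<dots> \<le> (\<Sum>i\<in>I. 2 * exp (- p * card (A i) / 24)) + (\<Sum>j\<in>J. (exp 1 * p * card (Q j) / k j) ^ k j)"
  proof (intro add_mono sum_mono)
    fix i assume i: "i \<in> I"
    have "pr \<Omega> p (?bad1 i) \<le> pr \<Omega> p (\<lambda>E. card (E \<inter> A i) \<le> p * card (A i) / 2) + pr \<Omega> p (many i)"
      using p by (intro pr_Un fin) auto
    then show "pr \<Omega> p (?bad1 i) \<le> 2 * exp (- p * card (A i) / 24)"
      using pr_many[OF i] pr_few[OF i] by linarith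
  next
    fix j assume "j \<in> J"
    then show "pr \<Omega> p (?bad2 j) \<le> (exp 1 * p * card (Q j) / k j) ^ k j"
      using fin p J(2) by (intro pr_upper_tail) auto
  qed
  also note less
  finally have "\<exists>E\<subseteq>\<Omega>. \<not> ((\<exists>i\<in>I. ?bad1 i E) \<or> (\<exists>j\<in>J. ?bad2 j E))"
    using p by (intro pr_less_1_imp_ex fin) auto
  then obtain E where E: "E \<subseteq> \<Omega>" "\<And>i. i \<in> I \<Longrightarrow> p * card (A i) / 2 < card (E \<inter> A i)"
    "\<And>i. i \<in> I \<Longrightarrow> \<not> many i E" "\<And>j. j \<in> J \<Longrightarrow> card (E \<inter> Q j) < k j"
    by (auto simp: not_le)
  have fE: "finite E" using E(1) fin by (rule finite_subset)
  obtain \<S> where S: "\<S> \<subseteq> {T \<in> \<T>. T \<subseteq> E}" "disjoint \<S>"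
    "\<And>T. T \<in> \<T> \<Longrightarrow> T \<subseteq> E \<Longrightarrow> T \<in> \<S> \<or> T \<inter> \<Union>\<S> \<noteq> {}"
    using maximal_disjoint_subfamily[of "{T \<in> \<T>. T \<subseteq> E}"] fT by auto
  define \<Gamma> where "\<Gamma> = E - \<Union>\<S>"
  have "\<not> T \<subseteq> \<Gamma>" if "T \<in> \<T>" for T
  proof
    assume "T \<subseteq> \<Gamma>"
    moreover from this have "T \<in> \<S> \<or> T \<inter> \<Union>\<S> \<noteq> {}" using that by (intro S(3)) (auto simp: \<Gamma>_def)
    moreover have "T \<noteq> {}" using T[OF that] by auto
    ultimately show False by (auto simp: \<Gamma>_def)
  qed
  moreover have "p * card (A i) / 4 \<le> card (\<Gamma> \<inter> A i)" if i: "i \<in> I" for i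
  proof -
    let ?S = "{T \<in> \<S>. T \<inter> A i \<noteq> {}}"
    have fS: "finite ?S" using S(1) fT by (auto intro: finite_subset[of _ \<T>])
    have "card ?S < s i"
    proof (rule ccontr)
      assume "\<not> ?thesis"
      then obtain \<S>' where S': "\<S>' \<subseteq> ?S" "card \<S>' = s i" by (meson not_less obtain_subset_with_card_n)
      then have "many i E" unfolding many_def using S(1,2)
        by (intro exI[of _ \<S>']) (auto simp: touch_def disjoint_def subset_iff)
      then show False using E(3) i by blast
    qed
    then have cS: "real (card ?S) < p * card (A i) / 24" unfolding s_def by linarith
    have "E \<inter> A i \<subseteq> (\<Gamma> \<inter> A i) \<union> \<Union>?S" by (auto simp: \<Gamma>_def)
    then have "card (E \<inter> A i) \<le> card ((\<Gamma> \<inter> A i) \<union> \<Union>?S)"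
      using fE fS S(1) by (intro card_mono) (auto simp: \<Gamma>_def intro: finite_subset[OF _ fE])
    also have "\<dots> \<le> card (\<Gamma> \<inter> A i) + card (\<Union>?S)" by (rule card_Un_le)
    also have "card (\<Union>?S) \<le> (\<Sum>T\<in>?S. card T)" using card_UN_le[OF fS, of id] by simp
    also have "(\<Sum>T\<in>?S. card T) = (\<Sum>T\<in>?S. 3)" using S(1) T by (intro sum.cong) auto
    finally have "card (E \<inter> A i) \<le> card (\<Gamma> \<inter> A i) + 3 * card ?S" by simp
    then have "real (card (E \<inter> A i)) \<le> card (\<Gamma> \<inter> A i) + 3 * real (card ?S)" by linarith
    moreover have "p * card (A i) \<ge> 0" using p by simp
    ultimately show ?thesis using E(2)[OF i] cS by linarith
  qed
  moreover have "card (\<Gamma> \<inter> Q j) < k j" if "j \<in> J" for j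
  proof -
    have "card (\<Gamma> \<inter> Q j) \<le> card (E \<inter> Q j)" using fE by (intro card_mono) (auto simp: \<Gamma>_def)
    then show ?thesis using E(4)[OF that] by simp
  qed
  moreover have "\<Gamma> \<subseteq> \<Omega>" using E(1) by (auto simp: \<Gamma>_def)
  ultimately show ?thesis by blast
qed

definition pairs :: "'a set \<Rightarrow> 'a set set" where
  "pairs S = {e. e \<subseteq> S \<and> card e = 2}"

lemma finite_pairs [simp]: "finite S \<Longrightarrow> finite (pairs S)"
  by (rule finite_subset[of _ "Pow S"]) (auto simp: pairs_def)

lemma card_pairs: "finite S \<Longrightarrow> card (pairs S) = card S choose 2"
  unfolding pairs_def by (rule n_subsets)

lemma pairs_mono: "S \<subseteq> T \<Longrightarrow> pairs S \<subseteq> pairs T"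
  by (auto simp: pairs_def)

lemma doubleton_in_pairs [simp]: "{u, v} \<in> pairs S \<longleftrightarrow> u \<in> S \<and> v \<in> S \<and> u \<noteq> v"
  by (auto simp: pairs_def card_insert_if)

text \<open>Random choices are made on unordered pairs, so that an edge is decided once and not
  separately for its two arcs.\<close>

definition graph_of :: "'a set set \<Rightarrow> 'a rel" where
  "graph_of \<Gamma> = {(u, v). {u, v} \<in> \<Gamma>}"

lemma sgraph_graph_of:
  assumes "finite V" "\<Gamma> \<subseteq> pairs V" shows "sgraph V (graph_of \<Gamma>)"
proof -
  have "u \<in> V \<and> v \<in> V \<and> u \<noteq> v" if "{u, v} \<in> \<Gamma>" for u v
    using subsetD[OF assms(2) that] by simp
  moreover from this have "{u, u} \<notin> \<Gamma>" for u by blast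
  ultimately show ?thesis
    using assms(1) unfolding sgraph_def graph_of_def sym_def irrefl_def by (auto simp: insert_commute)
qed

text \<open>The forbidden triples are the edge sets of triangles; an edge lies in at most
  \<open>card V\<close> of them, one for each choice of the third vertex.\<close>

lemma triangle_free_alteration:
  fixes V :: "'a set" and p :: real and A :: "'i \<Rightarrow> 'a set set" and Q :: "'j \<Rightarrow> 'a set set"
  assumes fin: "finite V" and p: "0 < p" "p \<le> 1" and np: "250 * real (card V) * p ^ 2 \<le> 1"
    and I: "finite I" "\<And>i. i \<in> I \<Longrightarrow> A i \<subseteq> pairs V"
    and J: "finite J" "\<And>j. j \<in> J \<Longrightarrow> Q j \<subseteq> pairs V \<and> k j > 0"
    and less: "(\<Sum>i\<in>I. 2 * exp (- p * card (A i) / 24)) + (\<Sum>j\<in>J. (exp 1 * p * card (Q j) / k j) ^ k j) < 1"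
  shows "\<exists>\<Gamma>\<subseteq>pairs V. trifree (graph_of \<Gamma>) \<and> (\<forall>i\<in>I. p * card (A i) / 4 \<le> card (\<Gamma> \<inter> A i)) \<and>
     (\<forall>j\<in>J. card (\<Gamma> \<inter> Q j) < k j)"
proof -
  let ?T = "pairs ` {S. S \<subseteq> V \<and> card S = 3}"
  have "\<exists>\<Gamma>\<subseteq>pairs V. (\<forall>T\<in>?T. \<not> T \<subseteq> \<Gamma>) \<and> (\<forall>i\<in>I. p * card (A i) / 4 \<le> card (\<Gamma> \<inter> A i)) \<and>
     (\<forall>j\<in>J. card (\<Gamma> \<inter> Q j) < k j)"
  proof (rule alteration[OF _ p _ _ np I J less])
    fix T assume "T \<in> ?T"
    then obtain S where S: "T = pairs S" "S \<subseteq> V" "card S = 3" by auto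
    moreover have "finite S" using S fin finite_subset by auto
    ultimately show "T \<subseteq> pairs V \<and> card T = 3"
      using pairs_mono by (auto simp: card_pairs choose_two)
  next
    fix e assume e: "e \<in> pairs V"
    have "{T \<in> ?T. e \<in> T} \<subseteq> (\<lambda>w. pairs (insert w e)) ` V"
    proof
      fix T assume "T \<in> {T \<in> ?T. e \<in> T}"
      then obtain S where S: "T = pairs S" "S \<subseteq> V" "card S = 3" "e \<subseteq> S" "card e = 2"
        by (auto simp: pairs_def)
      have fS: "finite S" using S fin finite_subset by auto
      have "card (S - e) = 1" using S fS by (subst card_Diff_subset) (auto intro: finite_subset)
      then obtain w where w: "S - e = {w}" by (auto simp: card_1_singleton_iff)
      then have "S = insert w e" "w \<in> V" using S by auto
      then show "T \<in> (\<lambda>w. pairs (insert w e)) ` V" using S(1) by auto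
    qed
    then show "card {T \<in> ?T. e \<in> T} \<le> card V"
      using fin by (meson card_image_le card_mono finite_imageI le_trans)
  qed (use fin in auto)
  then obtain \<Gamma> where G: "\<Gamma> \<subseteq> pairs V" "\<And>S. S \<subseteq> V \<Longrightarrow> card S = 3 \<Longrightarrow> \<not> pairs S \<subseteq> \<Gamma>"
    "\<forall>i\<in>I. p * card (A i) / 4 \<le> card (\<Gamma> \<inter> A i)" "\<forall>j\<in>J. card (\<Gamma> \<inter> Q j) < k j"
    by auto
  have "trifree (graph_of \<Gamma>)"
    unfolding trifree_def graph_of_def
  proof (rule notI, elim exE conjE)
    fix u v w assume "(u, v) \<in> {(u, v). {u, v} \<in> \<Gamma>}" "(v, w) \<in> {(u, v). {u, v} \<in> \<Gamma>}"
      "(w, u) \<in> {(u, v). {u, v} \<in> \<Gamma>}"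
    then have uvw: "{u, v} \<in> \<Gamma>" "{v, w} \<in> \<Gamma>" "{w, u} \<in> \<Gamma>" by simp_all
    have *: "u \<in> V" "v \<in> V" "w \<in> V" "u \<noteq> v" "v \<noteq> w" "w \<noteq> u"
      using uvw[THEN subsetD[OF G(1)]] by simp_all
    have "pairs {u, v, w} \<subseteq> \<Gamma>"
    proof
      fix e assume "e \<in> pairs {u, v, w}"
      then obtain x y where "e = {x, y}" "x \<noteq> y" "x \<in> {u, v, w}" "y \<in> {u, v, w}"
        by (auto simp: pairs_def card_2_iff)
      then show "e \<in> \<Gamma>" using uvw by (auto simp: insert_commute)
    qed
    moreover have "card {u, v, w} = 3" using * by auto
    ultimately show False using G(2)[of "{u, v, w}"] * by auto
  qed
  with G show ?thesis by blast
qed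

section \<open>Blow-ups of extremal examples, and the random graph for exponents up to 1/2\<close>

section \<open>Blow-ups and the sparse case\<close>


definition no_dense_bip :: "'a set \<Rightarrow> 'a rel \<Rightarrow> real \<Rightarrow> real \<Rightarrow> bool" where
  "no_dense_bip V E d f \<longleftrightarrow> sgraph V E \<and> trifree E \<and> (\<forall>v\<in>V. d \<le> real (deg E V v)) \<and>
     (\<forall>S\<subseteq>V. S \<noteq> {} \<longrightarrow> bip E S \<longrightarrow> (\<exists>v\<in>S. real (deg E S v) \<le> f))"

lemma card_residue_class:
  fixes m n r :: nat
  assumes "r < m"
  shows "n div m \<le> card {i. i < n \<and> i mod m = r}" "card {i. i < n \<and> i mod m = r} \<le> n div m + 1"
proof -
  have "(\<lambda>q. q * m + r) ` {..<n div m} \<subseteq> {i. i < n \<and> i mod m = r}"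
  proof clarify
    fix q assume "q < n div m"
    then have "(q + 1) * m \<le> n div m * m" by (intro mult_right_mono) auto
    also have "\<dots> \<le> n" by simp
    finally show "q * m + r < n \<and> (q * m + r) mod m = r" using assms by simp
  qed
  then have "card ((\<lambda>q. q * m + r) ` {..<n div m}) \<le> card {i. i < n \<and> i mod m = r}"
    by (intro card_mono) auto
  moreover have "inj (\<lambda>q. q * m + r)" using assms by (auto simp: inj_def)
  ultimately show "n div m \<le> card {i. i < n \<and> i mod m = r}"
    by (simp add: card_image inj_on_subset)
  have "inj_on (\<lambda>i. i div m) {i. i < n \<and> i mod m = r}"
  proof (rule inj_onI)
    fix i j assume "i \<in> {i. i < n \<and> i mod m = r}" "j \<in> {i. i < n \<and> i mod m = r}" "i div m = j div m"
    then show "i = j" using div_mult_mod_eq[of i m] div_mult_mod_eq[of j m] by simp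
  qed
  moreover have "(\<lambda>i. i div m) ` {i. i < n \<and> i mod m = r} \<subseteq> {..n div m}"
    by (auto simp: div_le_mono)
  ultimately have "card {i. i < n \<and> i mod m = r} \<le> card {..n div m}"
    by (intro card_inj_on_le) auto
  then show "card {i. i < n \<and> i mod m = r} \<le> n div m + 1" by simp
qed

text \<open>A bipartite induced subgraph projects to one of the base graph, and a degree upstairs is
  at most the projected degree times the fibre size. Fibres are residue classes, so \<open>n\<close>
  need not be a multiple of \<open>card V\<close>; their size is at most \<open>?B + 1\<close>,
  hence the factor 2.\<close>

lemma blow_up:
  assumes base: "no_dense_bip V E d f" and m: "0 < card V" "card V \<le> n" and nn: "d \<ge> 0" "f \<ge> 0"
  shows "\<exists>E' :: nat rel. no_dense_bip {..<n} E' (real (n div card V) * d) (2 * real (n div card V) * f)"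
proof -
  let ?m = "card V" and ?B = "n div card V"
  have g: "sgraph V E" and t: "trifree E" and d: "\<And>v. v \<in> V \<Longrightarrow> d \<le> deg E V v"
    and f: "\<And>S. S \<subseteq> V \<Longrightarrow> S \<noteq> {} \<Longrightarrow> bip E S \<Longrightarrow> \<exists>v\<in>S. deg E S v \<le> f"
    using base by (auto simp: no_dense_bip_def)
  note fV = sgraphD(1)[OF g]
  have B1: "?B \<ge> 1" using m by (simp add: div_greater_zero_iff Suc_le_eq)
  obtain h where h: "bij_betw h {..<?m} V" using fV ex_bij_betw_nat_finite atLeast0LessThan by metis
  define \<phi> where "\<phi> i = h (i mod ?m)" for i
  have \<phi>V: "\<phi> i \<in> V" for i using h m by (auto simp: \<phi>_def bij_betw_def)
  define fib where "fib v = {i. i < n \<and> \<phi> i = v}" for v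
  have fib: "?B \<le> card (fib v)" "card (fib v) \<le> ?B + 1" if v: "v \<in> V" for v
  proof -
    obtain r where r: "r < ?m" "v = h r" using h v by (auto simp: bij_betw_def)
    have "\<phi> i = v \<longleftrightarrow> i mod ?m = r" for i
      using h r m unfolding \<phi>_def bij_betw_def by (auto dest: inj_onD)
    then have "fib v = {i. i < n \<and> i mod ?m = r}" by (simp add: fib_def)
    then show "?B \<le> card (fib v)" "card (fib v) \<le> ?B + 1"
      using card_residue_class[OF r(1), of n] by simp_all
  qed
  have ffib [simp]: "finite (fib v)" for v by (simp add: fib_def)
  define E' where "E' = {(i, j). i < n \<and> j < n \<and> (\<phi> i, \<phi> j) \<in> E}"
  have "sgraph {..<n} E'"
    using sgraphD[OF g] by (auto simp: sgraph_def E'_def sym_def irrefl_def)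
  moreover have "trifree E'" using t unfolding trifree_def E'_def by blast
  moreover have "real ?B * d \<le> deg E' {..<n} i" if i: "i \<in> {..<n}" for i
  proof -
    have "nbrs E' {..<n} i = (\<Union>w\<in>nbrs E V (\<phi> i). fib w)"
      using i \<phi>V by (auto simp: nbrs_def E'_def fib_def)
    then have "deg E' {..<n} i = (\<Sum>w\<in>nbrs E V (\<phi> i). card (fib w))"
      using fV by (simp, subst card_UN_disjoint) (auto simp: fib_def)
    also have "\<dots> \<ge> (\<Sum>w\<in>nbrs E V (\<phi> i). ?B)"
      using fib by (intro sum_mono) (auto simp: nbrs_def)
    finally have "?B * deg E V (\<phi> i) \<le> deg E' {..<n} i" by (simp add: mult.commute)
    then have "real ?B * deg E V (\<phi> i) \<le> deg E' {..<n} i" by (metis of_nat_le_iff of_nat_mult)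
    moreover have "real ?B * d \<le> real ?B * deg E V (\<phi> i)" using d[OF \<phi>V] by (intro mult_left_mono) auto
    ultimately show ?thesis by linarith
  qed
  moreover have "\<exists>i\<in>S. deg E' S i \<le> 2 * real ?B * f"
    if S: "S \<subseteq> {..<n}" "S \<noteq> {}" "bip E' S" for S
  proof -
    obtain P Q where PQ: "P \<union> Q = S" "indep E' P" "indep E' Q" using S(3) by (auto simp: bip_def)
    \<comment> \<open>A fibre may meet both colour classes. One representative per fibre decides the
      colour of the projected vertex.\<close>
    define r where "r v = (SOME i. i \<in> S \<and> \<phi> i = v)" for v
    have r: "r v \<in> S" "\<phi> (r v) = v" if "v \<in> \<phi> ` S" for v
      using that someI_ex[of "\<lambda>i. i \<in> S \<and> \<phi> i = v"] unfolding r_def by blast+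
    have rn: "r v < n" if "v \<in> \<phi> ` S" for v using r[OF that] S(1) by auto
    define P' where "P' = {v \<in> \<phi> ` S. r v \<in> P}"
    define Q' where "Q' = {v \<in> \<phi> ` S. r v \<notin> P}"
    have r': "(u, v) \<in> E \<Longrightarrow> (r u, r v) \<in> E'" if "u \<in> \<phi> ` S" "v \<in> \<phi> ` S" for u v
      using r(2) rn that by (simp add: E'_def)
    have "r v \<in> Q" if "v \<in> Q'" for v using that r(1)[of v] PQ(1) by (auto simp: Q'_def)
    then have "indep E Q'" using PQ(3) r' unfolding indep_def Q'_def by blast
    moreover have "indep E P'" using PQ(2) r' unfolding indep_def P'_def by blast
    ultimately have "bip E (\<phi> ` S)"
      unfolding bip_def by (intro exI[of _ P'] exI[of _ Q']) (auto simp: P'_def Q'_def)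
    moreover have sub: "\<phi> ` S \<subseteq> V" using \<phi>V by auto
    ultimately obtain v where v: "v \<in> \<phi> ` S" "deg E (\<phi> ` S) v \<le> f" using f S(2) by blast
    have "nbrs E' S (r v) \<subseteq> (\<Union>w\<in>nbrs E (\<phi> ` S) v. fib w)"
      using r(2)[OF v(1)] by (auto simp: nbrs_def E'_def fib_def)
    moreover have fin: "finite (nbrs E (\<phi> ` S) v)" using finite_subset[OF sub fV] by simp
    ultimately have "deg E' S (r v) \<le> card (\<Union>w\<in>nbrs E (\<phi> ` S) v. fib w)"
      by (intro card_mono) auto
    also have "\<dots> \<le> (\<Sum>w\<in>nbrs E (\<phi> ` S) v. card (fib w))" using fin by (rule card_UN_le)
    also have "\<dots> \<le> (\<Sum>w\<in>nbrs E (\<phi> ` S) v. 2 * ?B)"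
    proof (rule sum_mono)
      fix w assume "w \<in> nbrs E (\<phi> ` S) v"
      then have "w \<in> V" using sub by (auto simp: nbrs_def)
      then show "card (fib w) \<le> 2 * ?B" using fib(2)[of w] B1 by linarith
    qed
    finally have "deg E' S (r v) \<le> 2 * ?B * deg E (\<phi> ` S) v" by (simp add: mult.commute)
    then have "real (deg E' S (r v)) \<le> real (2 * ?B * deg E (\<phi> ` S) v)" by (rule of_nat_mono)
    also have "\<dots> = 2 * real ?B * deg E (\<phi> ` S) v" by simp
    also have "\<dots> \<le> 2 * real ?B * f" using v(2) by (intro mult_left_mono) auto
    finally show ?thesis using r(1)[OF v(1)] by blast
  qed
  ultimately show ?thesis unfolding no_dense_bip_def by blast
qed

text \<open>For union bounds over all nonempty sets at once: with \<open>a = 1 / m ^ 2\<close>, a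
  failure probability of \<open>a ^ card S\<close> for every \<open>S\<close> is affordable.\<close>

lemma sum_subsets_le:
  fixes a :: real
  assumes "finite V" "0 \<le> a" "card V * a \<le> 1"
  shows "(\<Sum>S\<in>Pow V - {{}}. a ^ card S) \<le> 2 * card V * a"
proof -
  have "(\<Prod>v\<in>V. a + 1) = (\<Sum>S\<in>Pow V. (\<Prod>v\<in>S. a) * (\<Prod>v\<in>V-S. 1))"
    using assms(1) by (rule prod_add)
  then have "(\<Sum>S\<in>Pow V - {{}}. a ^ card S) = (1 + a) ^ card V - 1"
    using assms(1) by (simp add: sum_diff1 add.commute)
  also have "(1 + a) ^ card V \<le> exp a ^ card V"
    using assms(2) by (intro power_mono exp_ge_add_one_self) auto
  also have "\<dots> = exp (card V * a)" by (simp add: exp_of_nat_mult)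
  also have "\<dots> \<le> 1 + card V * a + (card V * a)^2" using assms by (intro exp_bound) auto
  also have "(card V * a)^2 \<le> card V * a"
    using assms mult_left_mono[of "card V * a" 1 "card V * a"] by (simp add: power2_eq_square)
  finally show ?thesis by (simp add: ac_simps)
qed

lemma sum_deg_graph_of_le:
  assumes "finite S" and that: "\<Gamma> \<subseteq> pairs V"
  shows "(\<Sum>v\<in>S. deg (graph_of \<Gamma>) S v) \<le> 2 * card (\<Gamma> \<inter> pairs S)"
proof -
  let ?E = "graph_of \<Gamma> \<inter> S \<times> S"
  have "(\<Sum>v\<in>S. deg (graph_of \<Gamma>) S v) = card ?E"
    using sum_deg[of S ?E] assms by (simp add: nbrs_def cong: sum.cong conj_cong)
  also have "?E \<subseteq> (\<Union>e\<in>\<Gamma> \<inter> pairs S. {(u, v). {u, v} = e})"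
  proof
    fix x assume x: "x \<in> ?E"
    obtain u v where uv: "x = (u, v)" by force
    then have "{u, v} \<in> \<Gamma>" using x by (simp add: graph_of_def)
    moreover have "{u, v} \<in> pairs S" using subsetD[OF that \<open>{u, v} \<in> \<Gamma>\<close>] x uv by simp
    ultimately show "x \<in> (\<Union>e\<in>\<Gamma> \<inter> pairs S. {(u, v). {u, v} = e})" using uv by auto
  qed
  then have "card ?E \<le> card (\<Union>e\<in>\<Gamma> \<inter> pairs S. {(u, v). {u, v} = e})"
  proof (rule card_mono[rotated])
    have "finite {(u, v). {u, v} = e}" if "e \<in> \<Gamma> \<inter> pairs S" for e
      by (rule finite_subset[of _ "S \<times> S"]) (use that assms in \<open>auto simp: pairs_def\<close>)
    then show "finite (\<Union>e\<in>\<Gamma> \<inter> pairs S. {(u, v). {u, v} = e})" using assms by auto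
  qed
  also have "\<dots> \<le> (\<Sum>e\<in>\<Gamma> \<inter> pairs S. card {(u, v). {u, v} = e})"
    using assms by (intro card_UN_le) auto
  also have "\<dots> \<le> (\<Sum>e\<in>\<Gamma> \<inter> pairs S. 2)"
  proof (intro sum_mono)
    fix e assume "e \<in> \<Gamma> \<inter> pairs S"
    then obtain a b where "e = {a, b}" by (auto simp: pairs_def card_2_iff)
    then have "{(u, v). {u, v} = e} \<subseteq> {(a, b), (b, a)}"
      unfolding \<open>e = {a, b}\<close> doubleton_eq_iff by auto
    then have "card {(u, v). {u, v} = e} \<le> card {(a, b), (b, a)}" by (intro card_mono) simp_all
    also have "\<dots> \<le> 2" by (intro card_insert_le_m1) simp_all
    finally show "card {(u, v). {u, v} = e} \<le> 2" .
  qed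
  finally show ?thesis by (simp add: mult.commute)
qed

lemma indep_graph_of: "indep (graph_of \<Gamma>) S \<Longrightarrow> \<Gamma> \<inter> pairs S = {}"
proof (rule ccontr)
  assume *: "indep (graph_of \<Gamma>) S" "\<Gamma> \<inter> pairs S \<noteq> {}"
  then obtain u v where "{u, v} \<in> \<Gamma>" "{u, v} \<subseteq> S" by (auto simp: pairs_def card_2_iff)
  then have "(u, v) \<in> graph_of \<Gamma> \<inter> S \<times> S" by (simp add: graph_of_def)
  with *(1) show False unfolding indep_def by blast
qed

lemma real_choose_two: "real (n choose 2) = n * (real n - 1) / 2"
proof -
  have "even (n * (n - 1))" by (cases n) auto
  then have "real (n choose 2) = real (n * (n - 1)) / 2"
    unfolding choose_two by (simp add: real_of_nat_div)
  then show ?thesis by (cases n) (auto simp: algebra_simps)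
qed

lemma exp_neg_ln_power: "m > 0 \<Longrightarrow> exp (- (2 * real s * ln (real m))) = (1 / real m ^ 2) ^ s"
proof -
  assume m: "m > 0"
  have "exp (- (2 * real s * ln (real m))) = exp (- (2 * ln (real m))) ^ s"
    by (simp add: ac_simps flip: exp_of_nat_mult)
  also have "exp (- (2 * ln (real m))) = 1 / real m ^ 2"
    using m by (simp add: exp_minus exp_double inverse_eq_divide)
  finally show ?thesis .
qed

lemma sparse_no_dense_bip:
  "\<forall>\<^sub>F m in sequentially. \<exists>(V :: nat set) E. card V = m \<and> no_dense_bip V E (sqrt m / 160) (4000 * ln m)"
proof -
  have "\<forall>\<^sub>F m in sequentially. m \<ge> 3 \<and> 4 / real m \<le> 1/4 \<and> 2 * real m * exp (- sqrt m / 800) \<le> 1/4 \<and>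
    real m - 1 \<ge> real m / 2 \<and> 20000 * sqrt m * ln m \<ge> 1000"
    by (intro eventually_conj) (real_asymp | simp add: eventually_ge_at_top)+
  then show ?thesis
  proof eventually_elim
    case (elim m)
    then have m3: "m \<ge> 3" and small: "4 / real m \<le> 1/4" "2 * real m * exp (- sqrt m / 800) \<le> 1/4"
      and m1: "real m - 1 \<ge> real m / 2" by auto
    define V where "V = {..<m}"
    have fV: "finite V" "card V = m" by (simp_all add: V_def)
    define L where "L = ln (real m)"
    have L1: "L \<ge> 1" using m3 exp_le unfolding L_def by (subst ln_ge_iff) (auto intro: order_trans)
    define q where "q = sqrt (real m)"
    have q: "q > 0" "q * q = m" using m3 by (simp_all add: q_def)
    \<comment> \<open>As large as the alteration allows up to a constant: 250 m p^2 =
      250/256.\<close>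
    define p where "p = 1 / (16 * q)"
    \<comment> \<open>From this size on, the lower-tail exponent
      \<open>p * card (pairs S) / 24\<close> is at least \<open>2 * card S * L\<close>, which pays
      for the choice of \<open>S\<close>.\<close>
    define a where "a = 2000 * q * L"
    have p: "0 < p" "p \<le> 1"
    proof -
      have "q \<ge> 1" using m3 by (simp add: q_def)
      then show "0 < p" "p \<le> 1" by (simp_all add: p_def)
    qed
    \<comment> \<open>Two kinds of lower-tail events share one index set: the star of a vertex, for
      the minimum degree, and the pairs inside a large set, to bound independent sets.\<close>
    define I where "I = V <+> {S. S \<subseteq> V \<and> a \<le> card S}"
    define A where "A = case_sum (\<lambda>v. {e \<in> pairs V. v \<in> e}) pairs"
    \<comment> \<open>A bipartite set is the union of two independent sets, each smaller than
      \<open>a\<close>.\<close>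
    define J where "J = {S. S \<subseteq> V \<and> S \<noteq> {} \<and> card S \<le> 2 * a}"
    \<comment> \<open>For a set in \<open>J\<close> the mean number of chosen pairs is at most
      \<open>125 * card S * L\<close>; a threshold 16 times as large makes the base of the
      upper-tail bound at most 3/16.\<close>
    define k where "k S = nat \<lceil>2000 * card S * L\<rceil>" for S :: "nat set"
    have star: "card {e \<in> pairs V. v \<in> e} = m - 1" if "v \<in> V" for v
    proof -
      have "{e \<in> pairs V. v \<in> e} = (\<lambda>u. {v, u}) ` (V - {v})"
        using that by (auto simp: pairs_def card_2_iff doubleton_eq_iff)
      moreover have "inj_on (\<lambda>u. {v, u}) (V - {v})" by (auto simp: inj_on_def doubleton_eq_iff)
      ultimately show ?thesis using fV that by (simp add: card_image)
    qed
    have fin: "finite I" "finite J" using fV by (simp_all add: I_def J_def)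
    have kpos: "k S > 0" if "S \<in> J" for S
    proof -
      have "card S > 0" using that fV by (auto simp: J_def card_gt_0_iff intro: finite_subset)
      then show ?thesis using L1 by (simp add: k_def)
    qed
    have "\<exists>\<Gamma>\<subseteq>pairs V. trifree (graph_of \<Gamma>) \<and> (\<forall>i\<in>I. p * card (A i) / 4 \<le> card (\<Gamma> \<inter> A i)) \<and>
       (\<forall>S\<in>J. card (\<Gamma> \<inter> pairs S) < k S)"
    proof (rule triangle_free_alteration)
      show "250 * real (card V) * p^2 \<le> 1"
        using q by (simp add: fV p_def power2_eq_square field_simps)
      show "A i \<subseteq> pairs V" if "i \<in> I" for i using that by (auto simp: I_def A_def dest: pairs_mono[THEN subsetD])
      show "pairs S \<subseteq> pairs V \<and> 0 < k S" if "S \<in> J" for S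
        using that pairs_mono kpos[OF that] by (auto simp: J_def)
      have sum0: "(\<Sum>S\<in>Pow V - {{}}. (1 / real m ^ 2) ^ card S) \<le> 2 / m"
        using sum_subsets_le[OF fV(1), of "1 / real m ^ 2"] m3 fV by (simp add: power2_eq_square field_simps)
      have s1: "(\<Sum>v\<in>V. 2 * exp (- p * card (A (Inl v)) / 24)) \<le> 1/4"
      proof -
        have "(\<Sum>v\<in>V. 2 * exp (- p * card (A (Inl v)) / 24)) \<le> (\<Sum>v\<in>V. 2 * exp (- q / 800))"
        proof (intro sum_mono)
          fix v assume v: "v \<in> V"
          have "p * (m / 2) \<le> p * card (A (Inl v))"
            using p m1 m3 star[OF v] by (intro mult_left_mono) (auto simp: A_def of_nat_diff)
          moreover have "p * m = q / 16" using q by (simp add: p_def field_simps)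
          ultimately show "2 * exp (- p * card (A (Inl v)) / 24) \<le> 2 * exp (- q / 800)"
            using q by simp
        qed
        also have "\<dots> \<le> 1/4" using small(2) by (simp add: fV q_def)
        finally show ?thesis .
      qed
      have s2: "(\<Sum>S | S \<subseteq> V \<and> a \<le> card S. 2 * exp (- p * card (A (Inr S)) / 24)) \<le> 1/4"
      proof -
        have "(\<Sum>S | S \<subseteq> V \<and> a \<le> card S. 2 * exp (- p * card (A (Inr S)) / 24)) \<le>
           (\<Sum>S | S \<subseteq> V \<and> a \<le> card S. 2 * (1 / real m ^ 2) ^ card S)"
        proof (intro sum_mono)
          fix S assume "S \<in> {S. S \<subseteq> V \<and> a \<le> card S}"
          then have S: "S \<subseteq> V" "a \<le> card S" by auto
          have fS: "finite S" using S fV finite_subset by auto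
          have cA: "card (A (Inr S)) = card S * (real (card S) - 1) / 2"
            using fS by (simp add: A_def card_pairs real_choose_two)
          have "20000 * q * L \<ge> 1000" using elim by (simp add: q_def L_def)
          then have "0.1 * a \<ge> 1" by (simp add: a_def)
          then have "0.9 * a \<le> real (card S) - 1" using S(2) by linarith
          then have "card S * (0.9 * a) / 2 \<le> card (A (Inr S))"
            unfolding cA by (intro divide_right_mono mult_left_mono) auto
          then have "p * card (A (Inr S)) \<ge> p * (card S * (0.9 * a) / 2)" using p by (intro mult_left_mono) auto
          also have "p * (card S * (0.9 * a) / 2) = card S * L * (900 / 16)"
            using q by (simp add: p_def a_def field_simps)
          finally have "card S * L * (900 / 16) \<le> p * card (A (Inr S))" .
          then have "card S * L * (900/16) / 24 \<le> p * card (A (Inr S)) / 24"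
            by (rule divide_right_mono) simp
          moreover have "0 \<le> real (card S) * L" using L1 by simp
          ultimately have "2 * real (card S) * L \<le> p * card (A (Inr S)) / 24" by linarith
          then have "exp (- p * card (A (Inr S)) / 24) \<le> exp (- (2 * real (card S) * L))" by simp
          also have "\<dots> = (1 / real m ^ 2) ^ card S"
            unfolding L_def using m3 by (intro exp_neg_ln_power) auto
          finally show "2 * exp (- p * card (A (Inr S)) / 24) \<le> 2 * (1 / real m ^ 2) ^ card S" by simp
        qed
        also have "\<dots> \<le> (\<Sum>S\<in>Pow V - {{}}. 2 * (1 / real m ^ 2) ^ card S)"
        proof (intro sum_mono2)
          have "a > 0" using q L1 by (simp add: a_def)
          then show "{S. S \<subseteq> V \<and> a \<le> card S} \<subseteq> Pow V - {{}}" by auto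
        qed (use fV in auto)
        also have "\<dots> \<le> 4 / m" using sum0 by (simp flip: sum_distrib_left)
        also have "\<dots> \<le> 1/4" by (rule small)
        finally show ?thesis .
      qed
      have s3: "(\<Sum>S\<in>J. (exp 1 * p * card (pairs S) / k S) ^ k S) \<le> 1/8"
      proof -
        have "(\<Sum>S\<in>J. (exp 1 * p * card (pairs S) / k S) ^ k S) \<le> (\<Sum>S\<in>J. (1 / real m ^ 2) ^ card S)"
        proof (intro sum_mono)
          fix S assume SJ: "S \<in> J"
          then have S: "S \<subseteq> V" "S \<noteq> {}" "card S \<le> 2 * a" by (auto simp: J_def)
          have fS: "finite S" using S fV finite_subset by auto
          have cS: "card S > 0" using S fS by (simp add: card_gt_0_iff)
          have kS: "2000 * card S * L \<le> k S" unfolding k_def by linarith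
          have "card (pairs S) \<le> real (card S) * card S / 2"
            using fS by (simp add: card_pairs real_choose_two divide_right_mono mult_left_mono)
          also have "\<dots> \<le> card S * (2 * a) / 2" using S(3) by (intro divide_right_mono mult_left_mono) auto
          finally have "p * card (pairs S) \<le> p * (card S * (2 * a) / 2)" using p by (intro mult_left_mono) auto
          also have "\<dots> = 125 * card S * L" using q by (simp add: p_def a_def field_simps)
          also have "\<dots> \<le> k S / 16" using kS by simp
          finally have 1: "p * card (pairs S) \<le> k S / 16" .
          have "exp 1 * (p * card (pairs S)) \<le> 3 * (k S / 16)"
            using exp_le 1 p by (intro mult_mono) auto
          then have "exp 1 * p * card (pairs S) / k S \<le> 1/3"
            using kpos[OF SJ] by (simp add: field_simps)
          also note third_le_exp
          finally have "(exp 1 * p * card (pairs S) / k S) ^ k S \<le> exp (-1) ^ k S"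
            using p by (intro power_mono) auto
          also have "\<dots> = exp (- real (k S))" by (simp add: exp_of_nat_mult[symmetric])
          also have "\<dots> \<le> exp (- (2 * real (card S) * L))"
          proof -
            have "2 * real (card S) * L \<le> 2000 * card S * L" using L1 by (intro mult_right_mono) auto
            then show ?thesis using kS by simp
          qed
          also have "\<dots> = (1 / real m ^ 2) ^ card S"
            unfolding L_def using m3 by (intro exp_neg_ln_power) auto
          finally show "(exp 1 * p * card (pairs S) / k S) ^ k S \<le> (1 / real m ^ 2) ^ card S" .
        qed
        also have "\<dots> \<le> (\<Sum>S\<in>Pow V - {{}}. (1 / real m ^ 2) ^ card S)"
          using fV by (intro sum_mono2) (auto simp: J_def)
        also have "\<dots> \<le> 2 / m" by (rule sum0)
        also have "\<dots> \<le> 1/8" using small(1) by simp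
        finally show ?thesis .
      qed
      have "(\<Sum>i\<in>I. 2 * exp (- p * card (A i) / 24)) =
        (\<Sum>v\<in>V. 2 * exp (- p * card (A (Inl v)) / 24)) +
        (\<Sum>S | S \<subseteq> V \<and> a \<le> card S. 2 * exp (- p * card (A (Inr S)) / 24))"
        unfolding I_def using fV by (subst sum.Plus) auto
      then show "(\<Sum>i\<in>I. 2 * exp (- p * card (A i) / 24)) +
        (\<Sum>S\<in>J. (exp 1 * p * card (pairs S) / k S) ^ k S) < 1"
        using s1 s2 s3 by linarith
    qed (use fV p fin in auto)
    then obtain \<Gamma> where G: "\<Gamma> \<subseteq> pairs V" "trifree (graph_of \<Gamma>)"
      "\<And>i. i \<in> I \<Longrightarrow> p * card (A i) / 4 \<le> card (\<Gamma> \<inter> A i)"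
      "\<And>S. S \<in> J \<Longrightarrow> card (\<Gamma> \<inter> pairs S) < k S" by blast
    let ?E = "graph_of \<Gamma>"
    have small_indep: "card S < a" if "S \<subseteq> V" "indep ?E S" for S
    proof (rule ccontr)
      assume *: "\<not> card S < a"
      have fS: "finite S" using that fV finite_subset by auto
      have "Inr S \<in> I" using * that by (auto simp: I_def)
      from G(3)[OF this] have "p * card (pairs S) / 4 \<le> 0"
        using indep_graph_of[OF that(2)] by (simp add: A_def)
      then have "card (pairs S) = 0" using p by (simp add: mult_le_0_iff)
      then have "card S * (real (card S) - 1) / 2 = 0"
        using fS by (simp add: card_pairs flip: real_choose_two)
      then have "real (card S) \<le> 1" by auto
      moreover have "a \<ge> 2" using q m3 L1 elim by (simp add: a_def q_def L_def)
      ultimately show False using * by linarith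
    qed
    have "no_dense_bip V ?E (q / 160) (4000 * L)"
      unfolding no_dense_bip_def
    proof (intro conjI ballI allI impI)
      show "sgraph V ?E" using fV G(1) by (intro sgraph_graph_of) auto
      show "trifree ?E" by (rule G(2))
    next
      fix v assume v: "v \<in> V"
      have "\<Gamma> \<inter> A (Inl v) \<subseteq> (\<lambda>u. {v, u}) ` nbrs ?E V v"
      proof
        fix e assume e: "e \<in> \<Gamma> \<inter> A (Inl v)"
        then obtain u where "e = {v, u}" "u \<in> V"
          by (auto simp: A_def pairs_def card_2_iff insert_commute)
        then show "e \<in> (\<lambda>u. {v, u}) ` nbrs ?E V v" using e by (auto simp: nbrs_def graph_of_def)
      qed
      then have "card (\<Gamma> \<inter> A (Inl v)) \<le> card ((\<lambda>u. {v, u}) ` nbrs ?E V v)"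
        using fV by (intro card_mono) auto
      also have "\<dots> \<le> deg ?E V v" using fV by (intro card_image_le) auto
      finally have 1: "card (\<Gamma> \<inter> A (Inl v)) \<le> deg ?E V v" .
      have "q / 160 \<le> p * (m / 2) / 4" using q by (simp add: p_def field_simps)
      also have "\<dots> \<le> p * card (A (Inl v)) / 4"
        using p m1 m3 star[OF v] by (intro divide_right_mono mult_left_mono) (auto simp: A_def of_nat_diff)
      also have "\<dots> \<le> card (\<Gamma> \<inter> A (Inl v))" using v by (intro G(3)) (auto simp: I_def)
      finally show "q / 160 \<le> deg ?E V v" using 1 by linarith
    next
      fix S assume S: "S \<subseteq> V" "S \<noteq> {}" "bip ?E S"
      have fS: "finite S" using S fV finite_subset by auto
      obtain P Q where PQ: "P \<union> Q = S" "indep ?E P" "indep ?E Q" using S(3) by (auto simp: bip_def)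
      have "card S \<le> card P + card Q" using PQ(1) card_Un_le by auto
      then have "real (card S) \<le> real (card P) + real (card Q)" by linarith
      also have "\<dots> \<le> a + a" using PQ S(1) small_indep[of P] small_indep[of Q] by (intro add_mono) auto
      finally have "S \<in> J" using S by (auto simp: J_def)
      from G(4)[OF this] have "real (card (\<Gamma> \<inter> pairs S)) < 2000 * card S * L"
        unfolding k_def by linarith
      moreover have "real (\<Sum>v\<in>S. deg ?E S v) \<le> real (2 * card (\<Gamma> \<inter> pairs S))"
        using sum_deg_graph_of_le[OF fS G(1)] by (rule of_nat_mono)
      ultimately have "real (\<Sum>v\<in>S. deg ?E S v) < 2 * (2000 * card S * L)" by simp
      then have less: "(\<Sum>v\<in>S. real (deg ?E S v)) < 4000 * L * card S" by (simp add: ac_simps)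
      show "\<exists>v\<in>S. deg ?E S v \<le> 4000 * L"
      proof (rule ccontr)
        assume "\<not> ?thesis"
        then have "(\<Sum>v\<in>S. 4000 * L) \<le> (\<Sum>v\<in>S. real (deg ?E S v))" by (intro sum_mono) auto
        with less show False by (simp add: mult.commute)
      qed
    qed
    then show ?case using fV unfolding q_def L_def by blast
  qed
qed

section \<open>Hub parameters and a relation with controlled edge counts\<close>

section \<open>The random hub graph\<close>


text \<open>\<open>B\<close> is the budget of a union bound: the event says that the observed count
  k satisfies (e p |A| / k)^k <= 1 / B, so that k lies in the tail of probability 1 / B. The least
  such k acts as threshold, hence a single event covers deviations of every size.\<close>

lemma pr_superset_threshold:
  fixes B :: real
  assumes fin: "finite \<Omega>" and p: "0 \<le> p" "p \<le> 1" and F: "F \<subseteq> \<Omega>" and A: "A \<subseteq> \<Omega>" "F \<inter> A = {}"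
    and B: "B > 0"
  shows "pr \<Omega> p (\<lambda>E. F \<subseteq> E \<and> 0 < card (E \<inter> A) \<and>
    B * (exp 1 * p * card A) ^ card (E \<inter> A) \<le> real (card (E \<inter> A)) ^ card (E \<inter> A)) \<le> p ^ card F / B"
    (is "pr \<Omega> p ?P \<le> _")
proof -
  let ?T = "\<lambda>k. 0 < k \<and> B * (exp 1 * p * card A) ^ k \<le> real k ^ k"
  show ?thesis
  proof (cases "\<exists>k. ?T k")
    case True
    define k where "k = (LEAST k. ?T k)"
    have k: "?T k" using True unfolding k_def by (rule LeastI_ex)
    have "pr \<Omega> p ?P \<le> pr \<Omega> p (\<lambda>E. F \<subseteq> E \<and> k \<le> card (E \<inter> A))"
      unfolding k_def using Least_le[of ?T] by (intro pr_mono fin p) auto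
    also have "\<dots> \<le> p ^ card F * (exp 1 * p * card A / k) ^ k"
      using k by (intro pr_superset_upper_tail assms) auto
    also have "(exp 1 * p * card A / k) ^ k \<le> 1 / B"
      using k B by (simp add: power_divide field_simps)
    then have "p ^ card F * (exp 1 * p * card A / k) ^ k \<le> p ^ card F * (1 / B)"
      using p by (intro mult_left_mono) auto
    finally show ?thesis by simp
  next
    case False
    have "pr \<Omega> p ?P \<le> pr \<Omega> p (\<lambda>E. False)" using False by (intro pr_mono fin p) blast
    then have "pr \<Omega> p ?P \<le> 0" by (simp add: pr_def)
    also have "\<dots> \<le> p ^ card F / B" using p B by simp
    finally show ?thesis .
  qed
qed

lemma sum_half_powers_le: "(\<Sum>i\<in>{1..n}. (1/2 :: real) ^ i) \<le> 1"
proof -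
  have "(\<Sum>i\<in>{1..n}. (1/2 :: real) ^ i) = 1 - (1/2) ^ n" by (induction n) auto
  then show ?thesis by simp
qed

text \<open>There are at most (e n / i)^i sets of size i, so the charge (i / (2 e n))^i sums
  geometrically. Unlike N^(-2 i) it does not cost a full logarithm per element when i is close to
  n.\<close>

lemma sum_subsets_card_power_le:
  assumes "finite X"
  shows "(\<Sum>I\<in>Pow X - {{}}. (card I / (2 * exp 1 * card X)) ^ card I) \<le> 1"
proof -
  let ?h = "\<lambda>i. (real i / (2 * exp 1 * card X)) ^ i"
  let ?S = "Pow X - {{}}"
  have card_pos: "card I > 0" if "I \<in> ?S" for I
    using that assms by (auto simp: card_gt_0_iff intro: finite_subset)
  have img: "card ` ?S \<subseteq> {1..card X}"
  proof
    fix i assume "i \<in> card ` ?S"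
    then obtain I where I: "I \<in> ?S" "i = card I" by blast
    then show "i \<in> {1..card X}" using card_pos[OF I(1)] card_mono[OF assms, of I] by simp
  qed
  have "(\<Sum>I\<in>?S. ?h (card I)) = (\<Sum>i\<in>{1..card X}. \<Sum>I\<in>{I \<in> ?S. card I = i}. ?h (card I))"
    using assms img by (intro sum.group[symmetric]) auto
  also have "\<dots> = (\<Sum>i\<in>{1..card X}. (card X choose i) * ?h i)"
  proof (intro sum.cong refl)
    fix i assume "i \<in> {1..card X}"
    then have "{I \<in> ?S. card I = i} = {I. I \<subseteq> X \<and> card I = i}" by auto
    then show "(\<Sum>I\<in>{I \<in> ?S. card I = i}. ?h (card I)) = (card X choose i) * ?h i"
      using n_subsets[OF assms, of i] by simp
  qed
  also have "\<dots> \<le> (\<Sum>i\<in>{1..card X}. (1/2) ^ i)"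
  proof (intro sum_mono)
    fix i assume i: "i \<in> {1..card X}"
    then have "(card X choose i) * ?h i \<le> (exp 1 * card X / i) ^ i * ?h i"
      by (intro mult_right_mono binomial_le_exp) auto
    also have "\<dots> = (exp 1 * card X / i * (i / (2 * exp 1 * card X))) ^ i"
      by (simp only: power_mult_distrib)
    also have "exp 1 * card X / i * (i / (2 * exp 1 * card X)) = 1/2"
      using i by simp
    finally show "(card X choose i) * ?h i \<le> (1/2) ^ i" .
  qed
  also have "\<dots> \<le> 1" by (rule sum_half_powers_le)
  finally show ?thesis .
qed

text \<open>
  The parameters of the dense construction: \<open>X\<close> has \<open>N\<close> vertices, there are \<open>M\<close> hubs, each of
  which is later replaced by \<open>t\<close> twins, and a vertex is joined to a hub with probability \<open>q\<close>, so
  that all degrees are about \<open>D / 16\<close>.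
\<close>

locale dense_params =
  fixes l h :: nat
  assumes l: "2 \<le> l" and h1000: "1000 \<le> h" and big: "1000 * ln (real h ^ (16 * l - 8)) \<le> h"
begin

text \<open>The exponents make \<open>N = t * M\<close> and \<open>D * D = N * t\<close> exact
  identities between integers. The eighth power in \<open>t\<close> leaves room for the intermediate
  scales h, h^2 and h^4, each of which beats \<open>L\<close>.\<close>

definition "N = h ^ (16 * l - 8)"
definition "M = h ^ (16 * l - 16)"
definition "t = h ^ 8"
definition "D = h ^ (8 * l)"
definition "q = real t / (16 * real D)"
definition "X = {..<N}"
definition "Z = {..<M}"
definition "L = ln (real N)"

lemma pos: "h > 0" "N > 0" "M > 0" "t > 0" "D > 0" "q > 0"
  using h1000 by (auto simp: N_def M_def t_def D_def q_def)

lemma finXZ [simp]: "finite X" "finite Z" "card X = N" "card Z = M"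
  by (simp_all add: X_def Z_def)

lemma N_eq: "N = t * M"
  using l by (simp add: N_def t_def M_def flip: power_add)

lemma D_sq: "D * D = N * t"
  using l by (simp add: N_def t_def D_def flip: power_add)

lemma D_ge: "t * t \<le> D"
proof -
  have "h ^ (8 + 8) \<le> h ^ (8 * l)" using l h1000 by (intro power_increasing) auto
  then show ?thesis by (simp add: t_def D_def flip: power_add)
qed

lemma N_q: "real N * q = D / 16"
  using pos D_sq by (simp add: q_def field_simps flip: of_nat_mult)

lemma M_q: "real M * q = D / (16 * t)"
proof -
  have "real M * q = real N * q / t" using pos by (simp add: N_eq)
  then show ?thesis by (simp add: N_q)
qed

lemma M_q_q: "real M * q * q = 1 / 256"
  using pos by (simp add: M_q) (simp add: q_def)

lemma q_le_1: "q \<le> 1"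
proof -
  have "t * 1 \<le> t * t" using pos by (intro mult_left_mono) auto
  then have "t \<le> D" using D_ge by linarith
  then show ?thesis using pos by (simp add: q_def)
qed

lemma L_bounds: "1 \<le> L" "1000 * L \<le> h"
proof -
  have "h ^ 1 \<le> N" unfolding N_def using l h1000 by (intro power_increasing) auto
  then have "3 \<le> real N" using h1000 by simp
  then show "1 \<le> L" unfolding L_def using exp_le by (subst ln_ge_iff) (auto intro: order_trans)
  show "1000 * L \<le> h" using big by (simp add: L_def N_def)
qed

lemma t_ge: "real t \<ge> 1000000000 * real h" "real t \<ge> 1000000 * L"
proof -
  have "real h ^ 7 \<ge> 1000 ^ 7" using h1000 by (intro power_mono) auto
  then have "real h ^ 7 * real h \<ge> 1000 ^ 7 * real h" by (intro mult_right_mono) auto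
  moreover have "real t = real h ^ 7 * real h" by (simp add: t_def flip: power_Suc2)
  ultimately show "real t \<ge> 1000000000 * real h" by simp
  then show "real t \<ge> 1000000 * L" using L_bounds(2) by linarith
qed

lemma N_powr_L: "real N ^ k = exp (k * L)"
  using pos by (simp add: L_def exp_of_nat_mult)

definition e :: "(nat \<times> nat) set \<Rightarrow> nat set \<Rightarrow> nat set \<Rightarrow> nat" where
  "e R I W = card (R \<inter> I \<times> W)"

text \<open>The last two clauses are tail bounds in the implicit form k^k < budget * (e * mean)^k.
  The general budget charges 2 ln N for every vertex and hub. If \<open>I\<close> lies in the
  neighbourhood of \<open>z\<close>, its charge drops to about the logarithm of the number of
  subsets of a neighbourhood; \<open>W\<close> omits \<open>z\<close> to keep the star independent
  of the rectangle.\<close>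

definition typical :: "(nat \<times> nat) set \<Rightarrow> bool" where
  "typical R \<longleftrightarrow> R \<subseteq> X \<times> Z \<and>
    (\<forall>x\<in>X. M * q / 2 \<le> e R {x} Z \<and> e R {x} Z \<le> 9 * (M * q)) \<and>
    (\<forall>z\<in>Z. N * q / 2 \<le> e R X {z} \<and> e R X {z} \<le> 9 * (N * q)) \<and>
    (\<forall>I\<subseteq>X. \<forall>W\<subseteq>Z. I \<noteq> {} \<longrightarrow> W \<noteq> {} \<longrightarrow> 0 < e R I W \<longrightarrow>
      real (e R I W) ^ e R I W < real N ^ (2 * (card I + card W)) * (exp 1 * q * (card I * card W)) ^ e R I W) \<and>
    (\<forall>z\<in>Z. \<forall>I\<subseteq>X. \<forall>W\<subseteq>Z-{z}. I \<noteq> {} \<longrightarrow> W \<noteq> {} \<longrightarrow> I \<times> {z} \<subseteq> R \<longrightarrow> 0 < e R I W \<longrightarrow>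
      real (e R I W) ^ e R I W < (2 * exp 1 * (N * q) / card I) ^ card I * real N ^ (2 * card W + 2) *
        (exp 1 * q * (card I * card W)) ^ e R I W)"

lemma exp_neg_small: "exp (- x) \<le> 1 / (100 * real N)" if "real t / 200 \<le> x" for x :: real
proof -
  have "100 * L \<le> x" using that t_ge(2) L_bounds by linarith
  then have "N * exp (- x) \<le> N * exp (- (100 * L))" by (intro mult_left_mono) auto
  also have "\<dots> = exp (- (99 * L))" using N_powr_L[of 1] by (simp flip: exp_add)
  also have "\<dots> \<le> 1 / (1 + 99 * L)"
    using exp_ge_add_one_self[of "99 * L"] L_bounds by (simp add: exp_minus field_simps)
  also have "\<dots> \<le> 1 / 100" using L_bounds by (intro divide_left_mono) auto
  finally show ?thesis using pos by (simp add: field_simps)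
qed

lemma sum_N_le:
  assumes "finite V" "card V \<le> N"
  shows "(\<Sum>S\<in>Pow V - {{}}. (1 / real N ^ 2) ^ card S) \<le> 2 / N"
proof -
  have "card V * (1 / real N ^ 2) \<le> N * (1 / real N ^ 2)" using assms by (intro mult_right_mono) auto
  also have "\<dots> = 1 / N" using pos by (simp add: power2_eq_square)
  finally have *: "card V * (1 / real N ^ 2) \<le> 1 / N" .
  moreover have "1 / real N \<le> 1" using pos by simp
  ultimately show ?thesis
    using sum_subsets_le[OF assms(1), of "1 / real N ^ 2"] by simp
qed

lemma N_ge: "1000 \<le> real N"
proof -
  have "h ^ 1 \<le> N" unfolding N_def using l h1000 by (intro power_increasing) auto
  then show ?thesis using h1000 by simp
qed

lemma exists_typical: "\<exists>R. typical R"
proof -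
  define \<Omega> where "\<Omega> = X \<times> Z"
  have fin: "finite \<Omega>" by (simp add: \<Omega>_def)
  have q01: "0 \<le> q" "q \<le> 1" using pos q_le_1 by auto
  have MN: "M \<le> N" using pos by (simp add: N_eq)
  have tD: "t \<le> real D / t" using D_ge pos by (simp add: field_simps flip: of_nat_mult)
  have low: "pr \<Omega> q (\<lambda>E. card (E \<inter> A) \<le> q * card A / 2) \<le> 1 / (100 * real N)"
    and high: "pr \<Omega> q (\<lambda>E. nat \<lceil>9 * (card A * q)\<rceil> \<le> card (E \<inter> A)) \<le> 1 / (100 * real N)"
    if A: "A \<subseteq> \<Omega>" "real t / 16 \<le> card A * q" for A
  proof -
    have "pr \<Omega> q (\<lambda>E. card (E \<inter> A) \<le> q * card A / 2) \<le> exp (- (q * card A / 10))"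
      using pr_lower_tail[OF fin q01 A(1)] by simp
    also have "\<dots> \<le> 1 / (100 * real N)"
      using A(2) by (intro exp_neg_small) (simp add: mult.commute)
    finally show "pr \<Omega> q (\<lambda>E. card (E \<inter> A) \<le> q * card A / 2) \<le> 1 / (100 * real N)" .
    \<comment> \<open>Nine times the mean, because e / 9 is at most 1/3 and hence below exp
      (-1).\<close>
    let ?k = "nat \<lceil>9 * (card A * q)\<rceil>"
    have t0: "real t > 0" using pos by simp
    have k: "9 * (card A * q) \<le> ?k" by linarith
    moreover have "0 < 9 * (card A * q)" using A(2) t0 by linarith
    ultimately have k0: "?k > 0" by linarith
    have "pr \<Omega> q (\<lambda>E. ?k \<le> card (E \<inter> A)) \<le> (exp 1 * q * card A / ?k) ^ ?k"
      using k0 by (intro pr_upper_tail fin q01 A(1))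
    also have "\<dots> \<le> exp (-1) ^ ?k"
    proof (intro power_mono)
      have "exp 1 * (q * card A) \<le> 3 * (q * card A)" using exp_le q01 by (intro mult_right_mono) auto
      also have "\<dots> \<le> ?k / 3" using k by (simp add: mult.commute)
      finally have "exp 1 * q * card A / ?k \<le> 1/3" using k0 by (simp add: field_simps)
      also note third_le_exp
      finally show "exp 1 * q * card A / ?k \<le> exp (-1)" .
      show "0 \<le> exp 1 * q * card A / ?k"
        using q01 by (intro divide_nonneg_nonneg mult_nonneg_nonneg of_nat_0_le_iff) simp_all
    qed
    also have "\<dots> = exp (- real ?k)" by (simp add: exp_of_nat_mult[symmetric])
    also have "\<dots> \<le> 1 / (100 * real N)"
      using A(2) k t0 by (intro exp_neg_small) linarith
    finally show "pr \<Omega> q (\<lambda>E. ?k \<le> card (E \<inter> A)) \<le> 1 / (100 * real N)" .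
  qed
  let ?deg = "\<lambda>A E. card (E \<inter> A) \<le> q * card A / 2 \<or> nat \<lceil>9 * (card A * q)\<rceil> \<le> card (E \<inter> A)"
  have deg: "pr \<Omega> q (?deg A) \<le> 1 / (50 * real N)" if A: "A \<subseteq> \<Omega>" "real t / 16 \<le> card A * q" for A
    using pr_Un[OF fin q01, of "\<lambda>E. card (E \<inter> A) \<le> q * card A / 2"
      "\<lambda>E. nat \<lceil>9 * (card A * q)\<rceil> \<le> card (E \<inter> A)"] low[OF A] high[OF A] by simp
  have Mq: "real t / 16 \<le> M * q" "real t / 16 \<le> N * q"
  proof -
    show "real t / 16 \<le> M * q" using tD by (simp add: M_q)
    have "real D / t \<le> D / 1" using pos by (intro divide_left_mono) auto
    then show "real t / 16 \<le> N * q" using tD by (simp add: N_q)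
  qed
  have b1: "pr \<Omega> q (\<lambda>E. \<exists>x\<in>X. ?deg ({x} \<times> Z) E) \<le> 1/50"
  proof -
    have "pr \<Omega> q (\<lambda>E. \<exists>x\<in>X. ?deg ({x} \<times> Z) E) \<le> (\<Sum>x\<in>X. pr \<Omega> q (?deg ({x} \<times> Z)))"
      by (intro pr_UN fin q01) simp
    also have "\<dots> \<le> (\<Sum>x\<in>X. 1 / (50 * real N))"
      using Mq by (intro sum_mono deg) (auto simp: \<Omega>_def)
    also have "\<dots> = 1/50" using pos by simp
    finally show ?thesis .
  qed
  have b2: "pr \<Omega> q (\<lambda>E. \<exists>z\<in>Z. ?deg (X \<times> {z}) E) \<le> 1/50"
  proof -
    have "pr \<Omega> q (\<lambda>E. \<exists>z\<in>Z. ?deg (X \<times> {z}) E) \<le> (\<Sum>z\<in>Z. pr \<Omega> q (?deg (X \<times> {z})))"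
      by (intro pr_UN fin q01) simp
    also have "\<dots> \<le> (\<Sum>z\<in>Z. 1 / (50 * real N))"
      using Mq by (intro sum_mono deg) (auto simp: \<Omega>_def)
    also have "\<dots> = M / (50 * real N)" by simp
    also have "\<dots> \<le> 1/50" using pos MN by (simp add: field_simps)
    finally show ?thesis .
  qed
  let ?over = "\<lambda>B A E. 0 < card (E \<inter> A) \<and>
     B * (exp 1 * q * card A) ^ card (E \<inter> A) \<le> real (card (E \<inter> A)) ^ card (E \<inter> A)"
  let ?PX = "Pow X - {{}}" and ?PZ = "Pow Z - {{}}"
  let ?B1 = "\<lambda>I W. real N ^ (2 * (card I + card W))"
  \<comment> \<open>The budget splits into a factor for \<open>I\<close> and one for
    \<open>W\<close>, so the double sum is a product.\<close>
  have b3: "pr \<Omega> q (\<lambda>E. \<exists>I\<in>?PX. \<exists>W\<in>?PZ. ?over (?B1 I W) (I \<times> W) E) \<le> 1/50"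
  proof -
    have "pr \<Omega> q (\<lambda>E. \<exists>I\<in>?PX. \<exists>W\<in>?PZ. ?over (?B1 I W) (I \<times> W) E) \<le>
        (\<Sum>I\<in>?PX. pr \<Omega> q (\<lambda>E. \<exists>W\<in>?PZ. ?over (?B1 I W) (I \<times> W) E))"
      by (intro pr_UN fin q01) simp
    also have "\<dots> \<le> (\<Sum>I\<in>?PX. \<Sum>W\<in>?PZ. pr \<Omega> q (?over (?B1 I W) (I \<times> W)))"
      by (intro sum_mono pr_UN fin q01) simp
    also have "\<dots> \<le> (\<Sum>I\<in>?PX. \<Sum>W\<in>?PZ. (1 / real N ^ 2) ^ card I * (1 / real N ^ 2) ^ card W)"
    proof (intro sum_mono)
      fix I W assume "I \<in> ?PX" "W \<in> ?PZ"
      then have "pr \<Omega> q (\<lambda>E. {} \<subseteq> E \<and> ?over (?B1 I W) (I \<times> W) E) \<le> q ^ card ({} :: (nat \<times> nat) set) / ?B1 I W"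
        using pos by (intro pr_superset_threshold fin q01) (auto simp: \<Omega>_def)
      also have "\<dots> = (1 / real N ^ 2) ^ card I * (1 / real N ^ 2) ^ card W"
        by (simp add: power_add power_mult power_divide power_mult_distrib)
      finally show "pr \<Omega> q (?over (?B1 I W) (I \<times> W)) \<le> (1 / real N ^ 2) ^ card I * (1 / real N ^ 2) ^ card W"
        by simp
    qed
    also have "\<dots> = (\<Sum>I\<in>?PX. (1 / real N ^ 2) ^ card I) * (\<Sum>W\<in>?PZ. (1 / real N ^ 2) ^ card W)"
      by (simp only: sum_product)
    also have "\<dots> \<le> (2 / N) * (2 / N)"
      using MN by (intro mult_mono sum_N_le sum_nonneg) auto
    also have "\<dots> \<le> (2 / 1000) * (2 / 1000)"
      using N_ge by (intro mult_mono divide_left_mono) auto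
    finally show ?thesis by simp
  qed
  let ?B2 = "\<lambda>I W. (2 * exp 1 * (N * q) / card I) ^ card I * real N ^ (2 * card W + 2)"
  let ?star = "\<lambda>z I W E. I \<times> {z} \<subseteq> E \<and> ?over (?B2 I W) (I \<times> W) E"
  \<comment> \<open>The probability \<open>q ^ card I\<close> of the star cancels the
    \<open>q\<close> in the budget and leaves \<open>(card I / (2 * exp 1 * N)) ^ card I\<close>,
    which is summable over all \<open>I\<close>; the extra \<open>N ^ 2\<close> pays for the choice
    of \<open>z\<close>.\<close>
  have b4: "pr \<Omega> q (\<lambda>E. \<exists>z\<in>Z. \<exists>I\<in>?PX. \<exists>W\<in>Pow (Z - {z}) - {{}}. ?star z I W E) \<le> 1/50"
  proof -
    have "pr \<Omega> q (\<lambda>E. \<exists>z\<in>Z. \<exists>I\<in>?PX. \<exists>W\<in>Pow (Z - {z}) - {{}}. ?star z I W E) \<le>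
        (\<Sum>z\<in>Z. pr \<Omega> q (\<lambda>E. \<exists>I\<in>?PX. \<exists>W\<in>Pow (Z - {z}) - {{}}. ?star z I W E))"
      by (intro pr_UN fin q01) simp
    also have "\<dots> \<le> (\<Sum>z\<in>Z. \<Sum>I\<in>?PX. pr \<Omega> q (\<lambda>E. \<exists>W\<in>Pow (Z - {z}) - {{}}. ?star z I W E))"
      by (intro sum_mono pr_UN fin q01) simp
    also have "\<dots> \<le> (\<Sum>z\<in>Z. \<Sum>I\<in>?PX. \<Sum>W\<in>Pow (Z - {z}) - {{}}. pr \<Omega> q (?star z I W))"
      by (intro sum_mono pr_UN fin q01) simp
    also have "\<dots> \<le> (\<Sum>z\<in>Z. \<Sum>I\<in>?PX. \<Sum>W\<in>Pow (Z - {z}) - {{}}.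
        (card I / (2 * exp 1 * card X)) ^ card I * ((1 / real N ^ 2) * (1 / real N ^ 2) ^ card W))"
    proof (intro sum_mono)
      fix z I W assume z: "z \<in> Z" and I: "I \<in> ?PX" and W: "W \<in> Pow (Z - {z}) - {{}}"
      have i: "card I > 0" using I by (auto simp: card_gt_0_iff intro: finite_subset)
      have "pr \<Omega> q (?star z I W) \<le> q ^ card (I \<times> {z}) / ?B2 I W"
        using pos z I W i by (intro pr_superset_threshold fin q01) (auto simp: \<Omega>_def)
      also have "\<dots> = (q / (2 * exp 1 * (N * q) / card I)) ^ card I * ((1 / real N ^ 2) * (1 / real N ^ 2) ^ card W)"
        by (simp add: card_cartesian_product power_add power_mult power_divide power_mult_distrib)
          (simp add: power2_eq_square)
      also have "q / (2 * exp 1 * (N * q) / card I) = card I / (2 * exp 1 * card X)"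
        using pos by simp
      finally show "pr \<Omega> q (?star z I W) \<le>
         (card I / (2 * exp 1 * card X)) ^ card I * ((1 / real N ^ 2) * (1 / real N ^ 2) ^ card W)" .
    qed
    also have "\<dots> = (\<Sum>z\<in>Z. (\<Sum>I\<in>?PX. (card I / (2 * exp 1 * card X)) ^ card I) *
        ((1 / real N ^ 2) * (\<Sum>W\<in>Pow (Z - {z}) - {{}}. (1 / real N ^ 2) ^ card W)))"
      by (simp only: sum_distrib_left[symmetric] sum_distrib_right[symmetric])
    also have "\<dots> \<le> (\<Sum>z\<in>Z. 1 * ((1 / real N ^ 2) * (2 / N)))"
    proof (intro sum_mono mult_mono)
      fix z assume "z \<in> Z"
      show "(\<Sum>I\<in>?PX. (card I / (2 * exp 1 * card X)) ^ card I) \<le> 1"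
        by (intro sum_subsets_card_power_le) simp
      have "card (Z - {z}) \<le> N" using MN card_Diff1_le[of Z z] by simp
      then show "(\<Sum>W\<in>Pow (Z - {z}) - {{}}. (1 / real N ^ 2) ^ card W) \<le> 2 / N"
        by (intro sum_N_le) auto
    qed (auto intro!: sum_nonneg mult_nonneg_nonneg divide_nonneg_nonneg)
    also have "\<dots> = M * (2 / (real N * real N * real N))" by (simp add: power2_eq_square)
    also have "\<dots> \<le> N * (2 / (real N * real N * real N))" using MN by (intro mult_right_mono) auto
    also have "\<dots> = (2 / N) * (1 / N)" using pos by simp
    also have "\<dots> \<le> (2 / 1000) * (1 / 1000)"
      using N_ge by (intro mult_mono divide_left_mono) auto
    finally show ?thesis by simp
  qed
  define bad1 where "bad1 = (\<lambda>E. \<exists>x\<in>X. ?deg ({x} \<times> Z) E)"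
  define bad2 where "bad2 = (\<lambda>E. \<exists>z\<in>Z. ?deg (X \<times> {z}) E)"
  define bad3 where "bad3 = (\<lambda>E. \<exists>I\<in>?PX. \<exists>W\<in>?PZ. ?over (?B1 I W) (I \<times> W) E)"
  define bad4 where "bad4 = (\<lambda>E. \<exists>z\<in>Z. \<exists>I\<in>?PX. \<exists>W\<in>Pow (Z - {z}) - {{}}. ?star z I W E)"
  note b = b1[folded bad1_def] b2[folded bad2_def] b3[folded bad3_def] b4[folded bad4_def]
  have "pr \<Omega> q (\<lambda>E. (bad1 E \<or> bad2 E) \<or> (bad3 E \<or> bad4 E)) < 1"
    using b pr_Un[OF fin q01, of bad1 bad2] pr_Un[OF fin q01, of bad3 bad4]
      pr_Un[OF fin q01, of "\<lambda>E. bad1 E \<or> bad2 E" "\<lambda>E. bad3 E \<or> bad4 E"] by linarith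
  from pr_less_1_imp_ex[OF fin q01 this]
  obtain R where R: "R \<subseteq> \<Omega>" "\<not> bad1 R" "\<not> bad2 R" "\<not> bad3 R" "\<not> bad4 R" by blast
  have "typical R"
    unfolding typical_def e_def
  proof (intro conjI ballI allI impI)
    show "R \<subseteq> X \<times> Z" using R(1) by (simp add: \<Omega>_def)
    have deg_imp: "K * q / 2 \<le> card (R \<inter> A)" "card (R \<inter> A) \<le> 9 * (K * q)"
      if "\<not> ?deg A R" "card A = K" for A K
    proof -
      have 1: "\<not> card (R \<inter> A) \<le> q * card A / 2" and 2: "\<not> nat \<lceil>9 * (card A * q)\<rceil> \<le> card (R \<inter> A)"
        using that(1) by blast+
      show "K * q / 2 \<le> card (R \<inter> A)" unfolding that(2)[symmetric] using 1 by (simp add: mult.commute[of q])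
      show "card (R \<inter> A) \<le> 9 * (K * q)" unfolding that(2)[symmetric] using 2 by linarith
    qed
    show "M * q / 2 \<le> card (R \<inter> {x} \<times> Z)" "card (R \<inter> {x} \<times> Z) \<le> 9 * (M * q)" if "x \<in> X" for x
    proof -
      have "\<not> ?deg ({x} \<times> Z) R" using R(2) that unfolding bad1_def by blast
      moreover have "card ({x} \<times> Z) = M" by simp
      ultimately show "M * q / 2 \<le> card (R \<inter> {x} \<times> Z)" "card (R \<inter> {x} \<times> Z) \<le> 9 * (M * q)"
        using deg_imp by blast+
    qed
    show "N * q / 2 \<le> card (R \<inter> X \<times> {z})" "card (R \<inter> X \<times> {z}) \<le> 9 * (N * q)" if "z \<in> Z" for z
    proof -
      have "\<not> ?deg (X \<times> {z}) R" using R(3) that unfolding bad2_def by blast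
      moreover have "card (X \<times> {z}) = N" by simp
      ultimately show "N * q / 2 \<le> card (R \<inter> X \<times> {z})" "card (R \<inter> X \<times> {z}) \<le> 9 * (N * q)"
        using deg_imp by blast+
    qed
  next
    fix I W assume *: "I \<subseteq> X" "W \<subseteq> Z" "I \<noteq> {}" "W \<noteq> {}" "0 < card (R \<inter> I \<times> W)"
    have "\<not> ?over (?B1 I W) (I \<times> W) R" using R(4) *(1-4) unfolding bad3_def by blast
    then show "real (card (R \<inter> I \<times> W)) ^ card (R \<inter> I \<times> W) <
      ?B1 I W * (exp 1 * q * (card I * card W)) ^ card (R \<inter> I \<times> W)"
      using *(5) by (simp add: card_cartesian_product not_le)
  next
    fix z I W assume *: "z \<in> Z" "I \<subseteq> X" "W \<subseteq> Z - {z}" "I \<noteq> {}" "W \<noteq> {}" "I \<times> {z} \<subseteq> R" "0 < card (R \<inter> I \<times> W)"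
    have "\<not> ?star z I W R" using R(5) *(1-5) unfolding bad4_def by blast
    then show "real (card (R \<inter> I \<times> W)) ^ card (R \<inter> I \<times> W) <
      ?B2 I W * (exp 1 * q * (card I * card W)) ^ card (R \<inter> I \<times> W)"
      using *(6,7) by (simp add: card_cartesian_product not_le)
  qed
  then show ?thesis by blast
qed

end

section \<open>Rectangle bounds, pairs without a common hub, and the sparse graph on X\<close>

section \<open>Rectangles and open pairs\<close>


locale dense_typical = dense_params +
  fixes R :: "(nat \<times> nat) set"
  assumes typR: "typical R"
begin

abbreviation ee :: "nat set \<Rightarrow> nat set \<Rightarrow> nat" where "ee \<equiv> e R"

lemma t_ge_square: "real t \<ge> 1000000 * real h ^ 2"
proof -
  have "1000000 \<le> (1000 :: real) ^ 6" by simp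
  also have "\<dots> \<le> real h ^ 6" using h1000 by (intro power_mono) auto
  finally have "real h ^ 6 * real h ^ 2 \<ge> 1000000 * real h ^ 2" by (intro mult_right_mono) auto
  moreover have "real t = real h ^ 6 * real h ^ 2" by (simp add: t_def flip: power_add)
  ultimately show ?thesis by simp
qed

lemma D_pos: "real D > 0" "real t > 0" "real h > 0"
  using pos by auto

lemma R_sub: "R \<subseteq> X \<times> Z"
  using typR by (simp add: typical_def)

lemma deg_x:
  assumes "x \<in> X" shows "D / (32 * t) \<le> ee {x} Z" "ee {x} Z \<le> 9 * (M * q)"
  using typR assms pos unfolding typical_def by (auto simp: M_q)

lemma deg_z:
  assumes "z \<in> Z" shows "D / 32 \<le> ee X {z}" "ee X {z} \<le> 9 / 16 * D"
  using typR assms unfolding typical_def by (auto simp: N_q)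

lemma e_sum_right: "finite I \<Longrightarrow> finite W \<Longrightarrow> ee I W = (\<Sum>z\<in>W. ee I {z})"
proof -
  assume fin: "finite I" "finite W"
  have "R \<inter> I \<times> W = (\<Union>z\<in>W. R \<inter> I \<times> {z})" by auto
  moreover have "card (\<Union>z\<in>W. R \<inter> I \<times> {z}) = (\<Sum>z\<in>W. card (R \<inter> I \<times> {z}))"
    using fin by (intro card_UN_disjoint) auto
  ultimately show "ee I W = (\<Sum>z\<in>W. ee I {z})" by (simp add: e_def)
qed

lemma e_sum_left: "finite I \<Longrightarrow> finite W \<Longrightarrow> ee I W = (\<Sum>x\<in>I. ee {x} W)"
proof -
  assume fin: "finite I" "finite W"
  have "R \<inter> I \<times> W = (\<Union>x\<in>I. R \<inter> {x} \<times> W)" by auto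
  moreover have "card (\<Union>x\<in>I. R \<inter> {x} \<times> W) = (\<Sum>x\<in>I. card (R \<inter> {x} \<times> W))"
    using fin by (intro card_UN_disjoint) auto
  ultimately show "ee I W = (\<Sum>x\<in>I. ee {x} W)" by (simp add: e_def)
qed

lemma e_mono: "finite I' \<Longrightarrow> finite W' \<Longrightarrow> I \<subseteq> I' \<Longrightarrow> W \<subseteq> W' \<Longrightarrow> ee I W \<le> ee I' W'"
  unfolding e_def by (intro card_mono) auto

lemma e_empty [simp]: "ee {} W = 0" "ee I {} = 0"
  by (simp_all add: e_def)

text \<open>Dividing the tail bound by a common power: when the count exceeds e times the mean by a
  factor \<open>c\<close>, the count times ln c is below the logarithm of the budget.\<close>

lemma e_ratio:
  assumes "I \<subseteq> X" "W \<subseteq> Z" "I \<noteq> {}" "W \<noteq> {}" "0 < ee I W" "0 \<le> c"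
    and c: "c * (exp 1 * q * (card I * card W)) \<le> ee I W"
  shows "c ^ ee I W < real N ^ (2 * (card I + card W))"
proof -
  have fin: "finite I" "finite W" using assms(1,2) finite_subset[of _ X] finite_subset[of _ Z] by auto
  let ?Y = "exp 1 * q * (card I * card W)"
  have Y: "?Y > 0" using assms(3,4) fin pos by (simp add: card_gt_0_iff)
  have "c ^ ee I W * ?Y ^ ee I W = (c * ?Y) ^ ee I W" by (simp only: power_mult_distrib)
  also have "\<dots> \<le> real (ee I W) ^ ee I W" using c Y assms(6) by (intro power_mono) auto
  also have "\<dots> < real N ^ (2 * (card I + card W)) * ?Y ^ ee I W"
    using typR assms(1-5) unfolding typical_def by blast
  finally show ?thesis using Y by simp
qed

lemma e_ratio_star:
  assumes "z \<in> Z" "I \<subseteq> X" "W \<subseteq> Z - {z}" "I \<noteq> {}" "W \<noteq> {}" "I \<times> {z} \<subseteq> R" "0 < ee I W" "0 \<le> c"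
    and c: "c * (exp 1 * q * (card I * card W)) \<le> ee I W"
  shows "c ^ ee I W < (2 * exp 1 * (N * q) / card I) ^ card I * real N ^ (2 * card W + 2)"
proof -
  have fin: "finite I" "finite W" using assms(2,3) finite_subset[of _ X] finite_subset[of _ "Z - {z}"] by auto
  let ?Y = "exp 1 * q * (card I * card W)"
  have Y: "?Y > 0" using assms(4,5) fin pos by (simp add: card_gt_0_iff)
  have "c ^ ee I W * ?Y ^ ee I W = (c * ?Y) ^ ee I W" by (simp only: power_mult_distrib)
  also have "\<dots> \<le> real (ee I W) ^ ee I W" using c Y assms(8) by (intro power_mono) auto
  also have "\<dots> < (2 * exp 1 * (N * q) / card I) ^ card I * real N ^ (2 * card W + 2) * ?Y ^ ee I W"
    using typR assms(1-7) unfolding typical_def by blast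
  finally show ?thesis using Y by simp
qed

lemma q_bound: "exp 1 * q * (card I * card W) \<le> 3 / 16 * (t * card I * card W) / D"
proof -
  have "exp 1 * (q * (card I * card W)) \<le> 3 * (q * (card I * card W))"
    using exp_le pos by (intro mult_right_mono) auto
  then show ?thesis by (simp add: q_def mult.assoc)
qed

text \<open>For such \<open>I\<close> a count of \<open>t * card W\<close> already exceeds e times
  the mean by a factor \<open>h\<close>. Since \<open>N\<close> is a power of \<open>h\<close>, the
  logarithms cancel and leave the exponent \<open>16 * l - 8\<close>: this is the origin of the
  dependence on \<open>l\<close>.\<close>

lemma small_rectangle:
  assumes I: "I \<subseteq> X" and W: "W \<subseteq> Z" and small: "h * card I \<le> D"
  shows "ee I W \<le> 32 * l * (card I + t * card W)"
proof (rule ccontr)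
  assume "\<not> ?thesis"
  then have less: "32 * l * (card I + t * card W) < ee I W" by simp
  then have ne: "I \<noteq> {}" "W \<noteq> {}" "0 < ee I W" by (auto intro: ccontr)
  have "real h * (exp 1 * q * (card I * card W)) \<le> real h * (3 / 16 * (t * card I * card W) / D)"
    by (intro mult_left_mono q_bound) auto
  also have "\<dots> = 3 / 16 * (t * card W) * (real (h * card I) / D)" by simp
  also have "\<dots> \<le> 3 / 16 * (t * card W) * 1"
    using small D_pos by (intro mult_left_mono) (auto simp flip: of_nat_mult)
  also have "\<dots> \<le> real (t * card W)" by simp
  also have "\<dots> \<le> ee I W"
  proof -
    have "1 * (t * card W) \<le> 32 * l * (card I + t * card W)" using l by (intro mult_mono) auto
    then show ?thesis using less by linarith
  qed
  finally have "real h ^ ee I W < real N ^ (2 * (card I + card W))"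
    using I W ne by (intro e_ratio) auto
  also have "\<dots> = real h ^ ((16 * l - 8) * (2 * (card I + card W)))" by (simp add: N_def power_mult)
  finally have "ee I W < (16 * l - 8) * (2 * (card I + card W))"
    using h1000 by (subst (asm) power_strict_increasing_iff) auto
  also have "\<dots> \<le> 16 * l * (2 * (card I + t * card W))"
    using pos by (intro mult_mono add_mono) auto
  also have "16 * l * (2 * (card I + t * card W)) = 32 * l * (card I + t * card W)"
    by (simp add: algebra_simps)
  finally show False using less by linarith
qed

lemma exp_power_real: "exp 1 ^ n = exp (real n)" for n :: nat
  by (simp add: exp_of_nat_mult[symmetric])

text \<open>With \<theta> = sqrt (|I| / D) the mean is of order \<theta>^2 t |W|, so the claimed
  \<theta> t |W| leaves a deviation factor 10 / \<theta>. Choosing \<open>I\<close> inside a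
  neighbourhood costs at most (1 / \<theta>)^(2 |I|), which is paid by the 1 / \<theta>; the 10 pays
  for \<open>W\<close>. The square root is also what makes the peeling of independent sets
  converge.\<close>

lemma star_rectangle:
  assumes z: "z \<in> Z" and I: "I \<subseteq> X" "I \<times> {z} \<subseteq> R" and W: "W \<subseteq> Z - {z}" and large: "D \<le> t * card I"
  shows "ee I W \<le> 2 * (card I + sqrt (card I / D) * t * card W)"
proof (rule ccontr)
  assume neg: "\<not> ?thesis"
  define i where "i = real (card I)"
  define w where "w = real (card W)"
  define \<theta> where "\<theta> = sqrt (i / D)"
  have fI: "finite I" using I(1) finite_subset[of _ X] by auto
  have neg': "2 * (i + \<theta> * t * w) < ee I W" using neg by (simp add: i_def w_def \<theta>_def)
  have \<theta>0: "\<theta> \<ge> 0" by (simp add: \<theta>_def i_def)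
  have "0 \<le> 2 * (i + \<theta> * t * w)" using \<theta>0 by (simp add: i_def w_def)
  then have "0 < ee I W" using neg' by linarith
  then have ne: "I \<noteq> {}" "W \<noteq> {}" "0 < ee I W" by (auto intro: ccontr)
  have fW: "finite W" using W finite_subset[of _ "Z - {z}"] by auto
  have w1: "w \<ge> 1" using ne fW by (simp add: w_def Suc_le_eq card_gt_0_iff)
  have i0: "i > 0" using ne fI by (simp add: i_def card_gt_0_iff)
  have iD: "i \<le> D"
  proof -
    have "card I = card (I \<times> {z})" by (simp add: card_cartesian_product)
    also have "\<dots> \<le> ee X {z}" unfolding e_def using I by (intro card_mono) auto
    finally have "real (card I) \<le> 9 / 16 * D" using deg_z(2)[OF z] by linarith
    then show ?thesis using D_pos unfolding i_def by linarith
  qed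
  have \<theta>: "0 < \<theta>" "\<theta> \<le> 1" "\<theta> * \<theta> = i / D" using i0 iD D_pos by (simp_all add: \<theta>_def)
  \<comment> \<open>From \<open>large\<close>, \<theta>^2 is at least 1 / t, so \<theta> t is at
    least sqrt t and hence at least \<open>h\<close>; this absorbs the cost \<open>L\<close> of each
    hub in \<open>W\<close>.\<close>
  have \<theta>t: "1000 * L \<le> \<theta> * t"
  proof -
    have "real D \<le> t * i" using large unfolding i_def by (metis of_nat_le_iff of_nat_mult)
    then have "1 / t \<le> i / D" using D_pos by (simp add: field_simps)
    then have "real t * real t * (1 / t) \<le> real t * real t * (i / D)" by (intro mult_left_mono) auto
    moreover have "(\<theta> * t) ^ 2 = real t * real t * (i / D)"
      unfolding \<theta>(3)[symmetric] by (simp add: power2_eq_square ac_simps)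
    ultimately have "t \<le> (\<theta> * t) ^ 2" using D_pos by simp
    moreover have "real h ^ 2 \<le> t" using t_ge_square zero_le_power2[of "real h"] by linarith
    ultimately have "real h ^ 2 \<le> (\<theta> * t) ^ 2" by linarith
    then have "real h \<le> \<theta> * t" by (rule power2_le_imp_le) (simp add: \<theta>0)
    then show ?thesis using L_bounds(2) by linarith
  qed
  have "10 / \<theta> * (exp 1 * q * (card I * card W)) \<le> 10 / \<theta> * (3 / 16 * (t * card I * card W) / D)"
    using \<theta>(1) by (intro mult_left_mono q_bound) auto
  also have "\<dots> = 30 / 16 * (i / D) / \<theta> * t * w" by (simp add: i_def w_def ac_simps)
  also have "\<dots> = 30 / 16 * (\<theta> * t * w)" using \<theta>(1) unfolding \<theta>(3)[symmetric] by simp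
  also have "\<dots> \<le> 2 * (i + \<theta> * t * w)"
  proof -
    have "30 / 16 * s \<le> 2 * (i + s)" if "0 \<le> s" for s using that i0 by simp
    then show ?thesis using \<theta>0 w1 by simp
  qed
  also have "\<dots> \<le> ee I W" using neg' by simp
  finally have "(10 / \<theta>) ^ ee I W < (2 * exp 1 * (N * q) / card I) ^ card I * real N ^ (2 * card W + 2)"
    using z I W ne \<theta>(1) by (intro e_ratio_star) auto
  also have "\<dots> \<le> (1 / (\<theta> * \<theta>)) ^ card I * real N ^ (2 * card W + 2)"
  proof (intro mult_right_mono power_mono)
    have "2 * exp 1 * (N * q) / card I = (exp 1 / 8) * (1 / (\<theta> * \<theta>))"
      unfolding \<theta>(3) N_q by (simp add: i_def)
    also have "\<dots> \<le> 1 * (1 / (\<theta> * \<theta>))" using exp_le by (intro mult_right_mono) auto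
    finally show "2 * exp 1 * (N * q) / card I \<le> 1 / (\<theta> * \<theta>)" by simp
    show "0 \<le> 2 * exp 1 * (N * q) / card I"
      using pos by (intro divide_nonneg_nonneg mult_nonneg_nonneg) simp_all
  qed auto
  also have "(1 / (\<theta> * \<theta>)) ^ card I = (1 / \<theta>) ^ (2 * card I)"
    by (simp add: power_mult power2_eq_square)
  also have "(1 / \<theta>) ^ (2 * card I) * real N ^ (2 * card W + 2) \<le> (1 / \<theta>) ^ ee I W * real N ^ (2 * card W + 2)"
  proof (intro mult_right_mono power_increasing)
    have "2 * i \<le> 2 * (i + \<theta> * t * w)" using \<theta>0 w1 by simp
    then have "2 * i < ee I W" using neg' by (rule le_less_trans)
    then show "2 * card I \<le> ee I W" unfolding i_def by linarith
  qed (use \<theta> in auto)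
  finally have "10 ^ ee I W * (1 / \<theta>) ^ ee I W < real N ^ (2 * card W + 2) * (1 / \<theta>) ^ ee I W"
    by (simp add: power_divide mult.commute)
  then have "10 ^ ee I W < real N ^ (2 * card W + 2)" using \<theta>(1) by simp
  moreover have "exp 1 ^ ee I W \<le> (10::real) ^ ee I W" using exp_le by (intro power_mono) auto
  ultimately have "exp (real (ee I W)) < exp (real (2 * card W + 2) * L)"
    unfolding N_powr_L exp_power_real by linarith
  then have "ee I W < (2 * w + 2) * L" by (simp add: w_def add.commute)
  also have "\<dots> \<le> (4 * w) * L" using w1 L_bounds by (intro mult_right_mono) auto
  also have "\<dots> \<le> 2 * (1000 * L * w)" using w1 L_bounds by simp
  also have "\<dots> \<le> 2 * (\<theta> * t * w)" using \<theta>t w1 by simp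
  also have "\<dots> \<le> 2 * (i + \<theta> * t * w)" using i0 by simp
  finally show False using neg' by linarith
qed

definition open_pairs :: "nat set \<Rightarrow> nat set set" where
  "open_pairs I = {p \<in> pairs I. \<not> (\<exists>z\<in>Z. p \<times> {z} \<subseteq> R)}"

text \<open>
  A pair is closed if its vertices share a hub. A large set that no hub captures a positive fraction
  of has few closed pairs: the sum of the squared hub degrees is split according to their size.
\<close>

lemma many_open_pairs:
  assumes I: "I \<subseteq> X" and large: "D \<le> h * card I" and spread: "\<And>z. z \<in> Z \<Longrightarrow> 400 * ee I {z} < card I"
  shows "(real (card I))^2 / 8 \<le> card (open_pairs I)"
proof -
  define i where "i = real (card I)"
  have fI: "finite I" using I finite_subset[of _ X] by auto
  have large': "real D \<le> h * i" using large unfolding i_def by (metis of_nat_le_iff of_nat_mult)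
  have i_ge: "1000 * t \<le> i"
  proof -
    have "real t * real t \<le> real D" using D_ge by (metis of_nat_le_iff of_nat_mult)
    also note large'
    finally have "real t * real t \<le> h * i" .
    moreover have "1000 * real h * t \<le> real t * real t" using t_ge(1) by (intro mult_right_mono) auto
    ultimately have "h * (1000 * t) \<le> h * i" by (simp add: ac_simps)
    then show ?thesis using D_pos by simp
  qed
  have h4: "real h ^ 4 \<le> t" unfolding t_def of_nat_power using h1000 by (intro power_increasing) auto
  have i0: "i > 0" using i_ge D_pos by linarith
  have ne: "I \<noteq> {}" using i0 by (auto simp: i_def)
  define sq where "sq A = (\<Sum>z\<in>A. (real (ee I {z}))^2)" for A
  \<comment> \<open>Up to ten times the mean \<open>i * q\<close>, the hub degrees of the vertices
    and \<open>M_q_q\<close> give 90/256 of i^2. Between that and i / h^4 there are only O(i L)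
    edges, and h^4 beats \<open>L\<close>. Above, there are at most \<open>24 * i\<close> edges and
    \<open>spread\<close> gives 24/400. The total, about 0.42 i^2, leaves room for open
    pairs.\<close>
  define low where "low = {z \<in> Z. ee I {z} < 10 * (i * q)}"
  define mid where "mid = {z \<in> Z. 10 * (i * q) \<le> ee I {z} \<and> real h ^ 4 * ee I {z} < i}"
  define high where "high = {z \<in> Z. i \<le> real h ^ 4 * ee I {z}}"
  have fin: "finite low" "finite mid" "finite high" by (simp_all add: low_def mid_def high_def)
  have sq: "sq A \<le> b * ee I A" if "finite A" "\<And>z. z \<in> A \<Longrightarrow> ee I {z} \<le> b" for A and b :: real
  proof -
    have "sq A \<le> (\<Sum>z\<in>A. b * ee I {z})"
      unfolding sq_def power2_eq_square using that(2) by (intro sum_mono mult_right_mono) auto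
    also have "\<dots> = b * ee I A" using fI that(1) by (simp add: e_sum_right[of I A] sum_distrib_left)
    finally show ?thesis .
  qed
  have "sq low \<le> 10 * (i * q) * ee I low"
    using fin(1) by (rule sq) (simp add: low_def)
  also have "\<dots> \<le> 10 * (i * q) * (i * (9 * (M * q)))"
  proof (intro mult_left_mono)
    have "real (ee I low) \<le> ee I Z" using fI e_mono[of I Z I low] by (auto simp: low_def)
    also have "\<dots> = (\<Sum>x\<in>I. real (ee {x} Z))" using fI by (simp add: e_sum_left[of I Z])
    also have "\<dots> \<le> (\<Sum>x\<in>I. 9 * (M * q))" using I deg_x(2) by (intro sum_mono) auto
    finally show "real (ee I low) \<le> i * (9 * (M * q))" by (simp add: i_def)
  qed (use i0 pos in auto)
  also have "\<dots> = 90 * i^2 * (M * q * q)" by (simp add: power2_eq_square)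
  finally have s_low: "sq low \<le> 90 / 256 * i^2" by (simp add: M_q_q)
  have s_mid: "sq mid \<le> 1 / 100 * i^2"
  proof -
    have e_mid: "ee I mid \<le> 4 * i * L"
    proof (cases "ee I mid > 0")
      case True
      then have ne': "mid \<noteq> {}" by (auto intro: ccontr)
      define w where "w = real (card mid)"
      have sum_ge: "w * (10 * (i * q)) \<le> ee I mid"
      proof -
        have "w * (10 * (i * q)) = (\<Sum>z\<in>mid. 10 * (i * q))" by (simp add: w_def)
        also have "\<dots> \<le> (\<Sum>z\<in>mid. real (ee I {z}))" by (intro sum_mono) (simp add: mid_def)
        also have "\<dots> = ee I mid" using fI fin by (simp add: e_sum_right[of I mid])
        finally show ?thesis .
      qed
      \<comment> \<open>Deviation factor e: the 10 in the definition of \<open>mid\<close> exceeds 9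
        and hence e^2.\<close>
      have "exp 1 * (exp 1 * q * (card I * card mid)) = (exp 1 * exp 1) * (q * i * w)"
        by (simp add: i_def w_def)
      also have "\<dots> \<le> (3 * 3) * (q * i * w)"
        using exp_le pos i0 by (intro mult_right_mono mult_mono) (auto simp: w_def)
      also have "\<dots> \<le> w * (10 * (i * q))" using i0 pos by (simp add: w_def)
      also note sum_ge
      finally have "exp 1 ^ ee I mid < real N ^ (2 * (card I + card mid))"
        using I ne ne' True by (intro e_ratio) (auto simp: mid_def)
      then have "exp (real (ee I mid)) < exp (real (2 * (card I + card mid)) * L)"
        unfolding N_powr_L exp_power_real .
      then have "ee I mid < 2 * (i + w) * L" by (simp add: i_def w_def)
      \<comment> \<open>Every hub in \<open>mid\<close> carries at least \<open>4 * L\<close> edges,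
        so its own share \<open>2 * L\<close> of the budget is absorbed by half of the left
        side.\<close>
      moreover have "4 * L * w \<le> ee I mid"
      proof -
        have "4 * L \<le> real t / (2 * real h)"
        proof -
          have "8 * L * h \<le> real h * real h" using L_bounds by (intro mult_right_mono) auto
          also have "\<dots> \<le> 1000000 * real h ^ 2" by (simp add: power2_eq_square)
          also note t_ge_square
          finally show ?thesis using D_pos by (simp add: field_simps)
        qed
        also have "\<dots> \<le> 10 * (i * q)"
        proof -
          have "real t / (2 * real h) = real t / (2 * real h * D) * D" using D_pos by simp
          also have "\<dots> \<le> real t / (2 * real h * D) * (h * i)" using large' by (intro mult_left_mono) auto
          also have "\<dots> = 8 * (i * q)" using D_pos by (simp add: q_def)
          also have "\<dots> \<le> 10 * (i * q)" using i0 pos by simp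
          finally show ?thesis .
        qed
        finally have "4 * L * w \<le> 10 * (i * q) * w" by (intro mult_right_mono) (auto simp: w_def)
        then show ?thesis using sum_ge by (simp add: ac_simps)
      qed
      ultimately show ?thesis by (simp add: algebra_simps)
    next
      case False
      then show ?thesis using i0 L_bounds by simp
    qed
    have "sq mid \<le> i / real h ^ 4 * ee I mid"
      using fin(2)
    proof (rule sq)
      fix z assume "z \<in> mid"
      then have "real h ^ 4 * ee I {z} \<le> i" by (simp add: mid_def)
      then show "ee I {z} \<le> i / real h ^ 4" using D_pos by (simp add: field_simps)
    qed
    also have "\<dots> \<le> i / real h ^ 4 * (4 * i * L)" using e_mid i0 by (intro mult_left_mono) auto
    also have "\<dots> = 4 * L / real h ^ 4 * i^2" by (simp add: power2_eq_square)
    also have "\<dots> \<le> 1 / 100 * i^2"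
    proof (intro mult_right_mono)
      have "real h ^ 1 \<le> real h ^ 4" using h1000 by (intro power_increasing) auto
      then have "400 * L \<le> real h ^ 4" using L_bounds unfolding power_one_right by linarith
      then show "4 * L / real h ^ 4 \<le> 1 / 100" using D_pos by (simp add: field_simps)
    qed simp
    finally show ?thesis .
  qed
  have s_high: "sq high \<le> 6 / 100 * i^2"
  proof -
    have e_high: "ee I high \<le> 24 * i"
    proof (cases "ee I high > 0")
      case True
      then have ne': "high \<noteq> {}" by (auto intro: ccontr)
      define w where "w = real (card high)"
      have sum_ge: "w * (i / real h ^ 4) \<le> ee I high"
      proof -
        have "w * (i / real h ^ 4) = (\<Sum>z\<in>high. i / real h ^ 4)" by (simp add: w_def)
        also have "\<dots> \<le> (\<Sum>z\<in>high. real (ee I {z}))"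
          using D_pos by (intro sum_mono) (auto simp: high_def field_simps)
        also have "\<dots> = ee I high" using fI fin by (simp add: e_sum_right[of I high])
        finally show ?thesis .
      qed
      \<comment> \<open>Hubs in \<open>high\<close> have at least i / h^4 neighbours, which exceeds
        the mean \<open>i * q\<close> by the polynomial factor 16 h^(8 l - 12). The count is
        therefore linear in \<open>i\<close>, with no logarithm.\<close>
      have D_eq: "real D = real h ^ (8 * l - 12) * (real h ^ 4 * t)"
        using l by (simp add: D_def t_def flip: power_add)
      have "real h ^ (8 * l - 12) * (exp 1 * q * (card I * card high)) \<le>
          real h ^ (8 * l - 12) * (3 / 16 * (t * card I * card high) / D)"
        by (intro mult_left_mono q_bound) auto
      also have "\<dots> = 3 / 16 * (w * (i / real h ^ 4))"
        unfolding D_eq using D_pos by (simp add: w_def i_def)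
      also have "\<dots> \<le> w * (i / real h ^ 4)"
      proof -
        have "3 / 16 * s \<le> s" if "0 \<le> s" for s :: real using that by simp
        moreover have "0 \<le> w * (i / real h ^ 4)" using i0 by (simp add: w_def)
        ultimately show ?thesis .
      qed
      also note sum_ge
      finally have "(real h ^ (8 * l - 12)) ^ ee I high < real N ^ (2 * (card I + card high))"
        using I ne ne' True by (intro e_ratio) (auto simp: high_def)
      then have "real h ^ ((8 * l - 12) * ee I high) < real h ^ ((16 * l - 8) * (2 * (card I + card high)))"
        by (simp add: N_def power_mult)
      then have "(8 * l - 12) * ee I high < (16 * l - 8) * (2 * (card I + card high))"
        using h1000 by (subst (asm) power_strict_increasing_iff) auto
      then have "6 * ((8 * l - 12) * ee I high) < 6 * ((16 * l - 8) * (2 * (card I + card high)))"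
        by (rule mult_strict_left_mono) simp
      \<comment> \<open>The comparison of exponents amounts to l >= 2: then \<open>N\<close> is at
        most the sixth power of the deviation factor.\<close>
      moreover have "(16 * l - 8) * ee I high \<le> (6 * (8 * l - 12)) * ee I high"
        using l by (intro mult_right_mono) auto
      moreover have "(6 * (8 * l - 12)) * ee I high = 6 * ((8 * l - 12) * ee I high)"
        by (rule mult.assoc)
      moreover have "6 * ((16 * l - 8) * (2 * (card I + card high))) = (16 * l - 8) * (12 * (card I + card high))"
        by simp
      ultimately have "(16 * l - 8) * ee I high < (16 * l - 8) * (12 * (card I + card high))" by linarith
      then have "ee I high < 12 * (card I + card high)" by (rule mult_less_cancel1[THEN iffD1, THEN conjunct2])
      then have "real (ee I high) < real (12 * (card I + card high))" by (rule of_nat_less_iff[THEN iffD2])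
      then have "ee I high < 12 * (i + w)" by (simp add: i_def w_def)
      moreover have "24 * w \<le> ee I high"
      proof -
        have "24 * real h ^ 4 \<le> 1000 * t" using h4 D_pos by linarith
        then have "24 * real h ^ 4 \<le> i" using i_ge by linarith
        then have "24 \<le> i / real h ^ 4" using D_pos by (simp add: field_simps)
        then have "w * 24 \<le> w * (i / real h ^ 4)" by (intro mult_left_mono) (auto simp: w_def)
        then show ?thesis using sum_ge by (simp add: mult.commute)
      qed
      ultimately show ?thesis unfolding distrib_left by argo
    next
      case False
      then show ?thesis using i0 by simp
    qed
    have "sq high \<le> i / 400 * ee I high"
      using fin(3)
    proof (rule sq)
      fix z assume "z \<in> high"
      then have "400 * ee I {z} < card I" using spread by (simp add: high_def)
      then show "ee I {z} \<le> i / 400" unfolding i_def by linarith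
    qed
    also have "\<dots> \<le> i / 400 * (24 * i)" using e_high i0 by (intro mult_left_mono) auto
    finally show ?thesis by (simp add: power2_eq_square)
  qed
  have union: "sq (A \<union> B) \<le> sq A + sq B"
    if "finite A" "finite B" for A B
    unfolding sq_def using that by (subst sum.union_inter[symmetric]) (auto intro: sum_nonneg)
  have "sq Z \<le> sq (low \<union> mid \<union> high)"
    unfolding sq_def by (intro sum_mono2) (auto simp: low_def mid_def high_def)
  then have sum_sq: "sq Z \<le> 43 / 100 * i^2"
    using union[OF finite_UnI[OF fin(1,2)] fin(3)] union[OF fin(1,2)] s_low s_mid s_high zero_le_power2[of i]
    by linarith
  have "pairs I \<subseteq> open_pairs I \<union> (\<Union>z\<in>Z. pairs {x \<in> I. (x, z) \<in> R})"
    by (auto simp: open_pairs_def pairs_def)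
  then have "card (pairs I) \<le> card (open_pairs I \<union> (\<Union>z\<in>Z. pairs {x \<in> I. (x, z) \<in> R}))"
    using fI by (intro card_mono) (auto simp: open_pairs_def)
  also have "\<dots> \<le> card (open_pairs I) + card (\<Union>z\<in>Z. pairs {x \<in> I. (x, z) \<in> R})" by (rule card_Un_le)
  also have "card (\<Union>z\<in>Z. pairs {x \<in> I. (x, z) \<in> R}) \<le> (\<Sum>z\<in>Z. card (pairs {x \<in> I. (x, z) \<in> R}))"
    by (intro card_UN_le) simp
  finally have "real (card (pairs I)) \<le> card (open_pairs I) + (\<Sum>z\<in>Z. real (card (pairs {x \<in> I. (x, z) \<in> R})))"
    by (simp flip: of_nat_sum of_nat_add)
  also have "(\<Sum>z\<in>Z. real (card (pairs {x \<in> I. (x, z) \<in> R}))) \<le> (\<Sum>z\<in>Z. (real (ee I {z}))^2 / 2)"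
  proof (intro sum_mono)
    fix z assume "z \<in> Z"
    have "R \<inter> I \<times> {z} = (\<lambda>x. (x, z)) ` {x \<in> I. (x, z) \<in> R}" by auto
    then have "ee I {z} = card {x \<in> I. (x, z) \<in> R}" by (simp add: e_def card_image inj_on_def)
    then show "real (card (pairs {x \<in> I. (x, z) \<in> R})) \<le> (real (ee I {z}))^2 / 2"
      using fI by (simp add: card_pairs real_choose_two power2_eq_square mult_left_mono)
  qed
  also have "\<dots> \<le> 43 / 100 * i^2 / 2" using sum_sq by (simp add: sq_def flip: sum_divide_distrib)
  finally have "i * (i - 1) / 2 \<le> card (open_pairs I) + 43 / 100 * i^2 / 2"
    using fI by (simp add: card_pairs real_choose_two i_def)
  moreover have "i \<le> 1 / 10 * i^2"
  proof -
    have "real t * 1000 \<ge> 1000" using D_pos by simp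
    then have "10 * i \<le> i * i" using i_ge i0 by (intro mult_right_mono) auto
    then show ?thesis by (simp add: power2_eq_square)
  qed
  ultimately have "i^2 / 8 \<le> card (open_pairs I)" by (simp add: power2_eq_square algebra_simps)
  then show ?thesis by (simp add: i_def)
qed

text \<open>The bound \<open>450 * D\<close> is twice the maximal size \<open>225 * D\<close> of an
  independent set, so it covers bipartite sets.\<close>

lemma exists_sparse_graph:
  "\<exists>\<Gamma>\<subseteq>pairs X. trifree (graph_of \<Gamma>) \<and>
    (\<forall>I\<subseteq>X. D \<le> h * card I \<longrightarrow> (\<forall>z\<in>Z. 400 * ee I {z} < card I) \<longrightarrow> \<Gamma> \<inter> open_pairs I \<noteq> {}) \<and>
    (\<forall>I\<subseteq>X. I \<noteq> {} \<longrightarrow> card I \<le> 450 * D \<longrightarrow> card (\<Gamma> \<inter> pairs I) < card I * t)"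
proof -
  \<comment> \<open>Three demands meet here. Triangles: 250 N p^2 = 250 / h^4. Spread sets with at
    least D / h vertices: the lower-tail exponent is at least h / 192 per vertex, beating
    \<open>2 * L\<close>. Sets with at most \<open>450 * D\<close> vertices: the mean is at most 225
    h^2 pairs per vertex, far below \<open>t\<close>.\<close>
  define p where "p = real h ^ 2 / D"
  define A where "A = {I. I \<subseteq> X \<and> D \<le> h * card I \<and> (\<forall>z\<in>Z. 400 * ee I {z} < card I)}"
  define B where "B = {I. I \<subseteq> X \<and> I \<noteq> {} \<and> card I \<le> 450 * D}"
  have fin: "finite A" "finite B" by (simp_all add: A_def B_def)
  have h2t: "real h ^ 2 \<le> t" unfolding t_def of_nat_power using h1000 by (intro power_increasing) auto
  have tD: "real t \<le> D"
  proof -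
    have "t * 1 \<le> t * t" using pos by (intro mult_left_mono) auto
    then show ?thesis using D_ge by (metis le_trans mult.right_neutral of_nat_le_iff)
  qed
  have p: "0 < p" "p \<le> 1" using D_pos h2t tD by (simp_all add: p_def)
  have "\<exists>\<Gamma>\<subseteq>pairs X. trifree (graph_of \<Gamma>) \<and> (\<forall>I\<in>A. p * card (open_pairs I) / 4 \<le> card (\<Gamma> \<inter> open_pairs I)) \<and>
     (\<forall>I\<in>B. card (\<Gamma> \<inter> pairs I) < card I * t)"
  proof (rule triangle_free_alteration)
    have "250 * real N * p^2 = 250 * real h ^ 4 * (real N / (real D * real D))"
      by (simp add: p_def power2_eq_square power4_eq_xxxx)
    also have "real D * real D = real N * t" using D_sq by (metis of_nat_mult)
    also have "250 * real h ^ 4 * (real N / (real N * t)) = 250 / real h ^ 4"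
      using pos by (simp add: t_def flip: power_add) (simp add: field_simps flip: power_add)
    also have "\<dots> \<le> 1"
    proof -
      have "(1000 :: real) ^ 4 \<le> real h ^ 4" using h1000 by (intro power_mono) auto
      then have "250 \<le> real h ^ 4" by (rule order_trans[rotated]) simp
      then show ?thesis using D_pos by (simp add: field_simps)
    qed
    finally show "250 * real (card X) * p\<^sup>2 \<le> 1" by simp
    show "open_pairs I \<subseteq> pairs X" if "I \<in> A" for I
      using that pairs_mono[of I X] by (auto simp: A_def open_pairs_def)
    show "pairs I \<subseteq> pairs X \<and> 0 < card I * t" if "I \<in> B" for I
      using that pairs_mono[of I X] pos by (auto simp: B_def card_gt_0_iff intro: finite_subset[of _ X])
    have sum0: "(\<Sum>S\<in>Pow X - {{}}. (1 / real N ^ 2) ^ card S) \<le> 2 / N" by (intro sum_N_le) simp_all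
    have pw: "exp (- (2 * real (card I) * L)) = (1 / real N ^ 2) ^ card I" for I :: "nat set"
      unfolding L_def using pos by (intro exp_neg_ln_power) auto
    have "(\<Sum>I\<in>A. 2 * exp (- p * card (open_pairs I) / 24)) \<le> (\<Sum>I\<in>A. 2 * (1 / real N ^ 2) ^ card I)"
    proof (intro sum_mono)
      fix I assume "I \<in> A"
      then have I: "I \<subseteq> X" "D \<le> h * card I" "\<And>z. z \<in> Z \<Longrightarrow> 400 * ee I {z} < card I" by (auto simp: A_def)
      define i where "i = real (card I)"
      have large': "real D \<le> h * i" using I(2) unfolding i_def by (metis of_nat_le_iff of_nat_mult)
      have "i * (2 * L) \<le> i * (h / 192)" using L_bounds by (intro mult_left_mono) (auto simp: i_def)
      also have "\<dots> = i * (real h / (192 * D)) * D" using D_pos by simp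
      also have "\<dots> \<le> i * (real h / (192 * D)) * (h * i)"
        using large' by (intro mult_left_mono) (auto simp: i_def)
      also have "\<dots> = p * (i^2 / 8) / 24" by (simp add: p_def power2_eq_square)
      also have "\<dots> \<le> p * card (open_pairs I) / 24"
        using many_open_pairs[OF I] p by (intro divide_right_mono mult_left_mono) (auto simp: i_def)
      finally have "exp (- p * card (open_pairs I) / 24) \<le> exp (- (2 * i * L))" by simp
      then show "2 * exp (- p * card (open_pairs I) / 24) \<le> 2 * (1 / real N ^ 2) ^ card I"
        unfolding i_def pw by simp
    qed
    also have "\<dots> \<le> (\<Sum>I\<in>Pow X - {{}}. 2 * (1 / real N ^ 2) ^ card I)"
      using pos by (intro sum_mono2) (auto simp: A_def)
    also have "\<dots> \<le> 2 * (2 / N)" unfolding sum_distrib_left[symmetric] using sum0 by simp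
    also have "\<dots> \<le> 1 / 4" using N_ge by simp
    finally have s1: "(\<Sum>I\<in>A. 2 * exp (- p * card (open_pairs I) / 24)) \<le> 1 / 4" .
    have "(\<Sum>I\<in>B. (exp 1 * p * card (pairs I) / (card I * t)) ^ (card I * t)) \<le> (\<Sum>I\<in>B. (1 / real N ^ 2) ^ card I)"
    proof (intro sum_mono)
      fix I assume "I \<in> B"
      then have I: "I \<subseteq> X" "I \<noteq> {}" "card I \<le> 450 * D" by (auto simp: B_def)
      define i where "i = real (card I)"
      have fI: "finite I" using I(1) finite_subset[of _ X] by auto
      have i0: "i > 0" using I fI by (simp add: i_def card_gt_0_iff)
      have iD: "i \<le> 450 * D" using I(3) unfolding i_def by (metis of_nat_le_iff of_nat_mult of_nat_numeral)
      have "card (pairs I) \<le> i * i / 2"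
        using fI by (simp add: card_pairs real_choose_two i_def mult_left_mono)
      then have "exp 1 * (p * card (pairs I)) \<le> 3 * (p * (i * i / 2))"
        using exp_le p by (intro mult_mono mult_left_mono) auto
      also have "\<dots> \<le> 3 * (p * (i * (450 * D) / 2))"
        using iD i0 p by (intro mult_left_mono divide_right_mono) auto
      also have "\<dots> = 675 * real h ^ 2 * i" using D_pos by (simp add: p_def)
      also have "\<dots> \<le> 1 / 3 * t * i" using t_ge_square i0 by (intro mult_right_mono) auto
      finally have "exp 1 * p * card (pairs I) / (card I * t) \<le> 1/3"
        using i0 D_pos by (simp add: i_def field_simps)
      also note third_le_exp
      finally have "(exp 1 * p * card (pairs I) / (card I * t)) ^ (card I * t) \<le> exp (-1) ^ (card I * t)"
        using p by (intro power_mono) auto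
      also have "\<dots> = exp (- (i * t))" by (simp add: exp_of_nat_mult[symmetric] i_def)
      also have "\<dots> \<le> exp (- (2 * i * L))"
      proof -
        have "i * (2 * L) \<le> i * t" using t_ge(2) L_bounds i0 by (intro mult_left_mono) auto
        then show ?thesis by simp
      qed
      finally show "(exp 1 * p * card (pairs I) / (card I * t)) ^ (card I * t) \<le> (1 / real N ^ 2) ^ card I"
        unfolding i_def pw .
    qed
    also have "\<dots> \<le> (\<Sum>I\<in>Pow X - {{}}. (1 / real N ^ 2) ^ card I)"
      by (intro sum_mono2) (auto simp: B_def)
    also have "\<dots> \<le> 2 / N" by (rule sum0)
    also have "\<dots> \<le> 1 / 4" using N_ge by simp
    finally show "(\<Sum>I\<in>A. 2 * exp (- p * card (open_pairs I) / 24)) +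
        (\<Sum>I\<in>B. (exp 1 * p * card (pairs I) / (card I * t)) ^ (card I * t)) < 1"
      using s1 by linarith
  qed (use fin p in auto)
  then obtain \<Gamma> where G: "\<Gamma> \<subseteq> pairs X" "trifree (graph_of \<Gamma>)"
    "\<And>I. I \<in> A \<Longrightarrow> p * card (open_pairs I) / 4 \<le> card (\<Gamma> \<inter> open_pairs I)"
    "\<And>I. I \<in> B \<Longrightarrow> card (\<Gamma> \<inter> pairs I) < card I * t" by blast
  have "\<Gamma> \<inter> open_pairs I \<noteq> {}" if I: "I \<subseteq> X" "D \<le> h * card I" "\<forall>z\<in>Z. 400 * ee I {z} < card I" for I
  proof
    assume "\<Gamma> \<inter> open_pairs I = {}"
    moreover have "I \<in> A" using I by (simp add: A_def)
    ultimately have "p * card (open_pairs I) / 4 \<le> 0" using G(3)[of I] by simp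
    moreover have "card I > 0" using I(2) pos by (auto intro: ccontr)
    then have "0 < (real (card I))^2 / 8" by simp
    then have "0 < real (card (open_pairs I))" using many_open_pairs[OF I(1,2)] I(3) by (meson less_le_trans)
    then have "0 < p * card (open_pairs I) / 4" using p by simp
    ultimately show False by linarith
  qed
  moreover have "card (\<Gamma> \<inter> pairs I) < card I * t" if "I \<subseteq> X" "I \<noteq> {}" "card I \<le> 450 * D" for I
    using that by (intro G(4)) (simp add: B_def)
  ultimately show ?thesis using G(1,2) by blast
qed

end

section \<open>Peeling independent sets, and the twin hub graph\<close>

section \<open>The dense case\<close>


context dense_typical
begin

lemma open_pairs_mono: "I \<subseteq> J \<Longrightarrow> open_pairs I \<subseteq> open_pairs J"
  using pairs_mono[of I J] by (auto simp: open_pairs_def)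

definition hits_spread_sets :: "nat set set \<Rightarrow> bool" where
  "hits_spread_sets \<Gamma> \<longleftrightarrow>
    (\<forall>I\<subseteq>X. D \<le> h * card I \<longrightarrow> (\<forall>z\<in>Z. 400 * ee I {z} < card I) \<longrightarrow> \<Gamma> \<inter> open_pairs I \<noteq> {})"

lemma popular_hub:
  assumes "hits_spread_sets \<Gamma>" "I \<subseteq> X" "\<Gamma> \<inter> open_pairs I = {}" "D < h * card I"
  obtains z where "z \<in> Z" "card I \<le> 400 * ee I {z}"
  using assms unfolding hits_spread_sets_def by (meson less_imp_le not_less)

text \<open>A hub sees 1/400 of a large set avoiding the graph, but has at most 9/16 D neighbours,
  and 400 * 9/16 = 225.\<close>

lemma independent_card_le:
  assumes "hits_spread_sets \<Gamma>" "I \<subseteq> X" "\<Gamma> \<inter> open_pairs I = {}"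
  shows "card I \<le> 225 * D"
proof (cases "D < h * card I")
  case True
  then obtain z where z: "z \<in> Z" "card I \<le> 400 * ee I {z}" using popular_hub assms by blast
  have "ee I {z} \<le> ee X {z}" using assms(2) by (intro e_mono) auto
  then have "real (ee I {z}) \<le> 9 / 16 * D" using deg_z(2)[OF z(1)] by linarith
  then show ?thesis using z(2) by linarith
next
  case False
  have "1 * card I \<le> h * card I" using pos by (intro mult_right_mono) auto
  then show ?thesis using False by linarith
qed

text \<open>
  Peeling off neighbourhoods of popular hubs shrinks an independent set geometrically, so the
  contributions of the pieces form a convergent series.
\<close>

lemma independent_rectangle:
  assumes \<Gamma>: "hits_spread_sets \<Gamma>" and W: "W \<subseteq> Z"
  shows "I \<subseteq> X \<Longrightarrow> \<Gamma> \<inter> open_pairs I = {} \<Longrightarrow>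
    ee I W \<le> 32 * l * card I + (1600 * sqrt (card I / D) + 32 * l) * (t * card W)"
proof (induction "card I" arbitrary: I rule: less_induct)
  case less
  define i where "i = real (card I)"
  define w where "w = real (t * card W)"
  have fin: "finite I" "finite W" using less.prems(1) W finite_subset[of _ X] finite_subset[of _ Z] by auto
  have w0: "w \<ge> 0" by (simp add: w_def)
  show ?case
  proof (cases "D < h * card I")
    case False
    then have "real (ee I W) \<le> real (32 * l * (card I + t * card W))"
      using small_rectangle[OF less.prems(1) W] by (intro of_nat_mono) simp
    also have "\<dots> = 32 * l * i + 32 * l * w" by (simp add: i_def w_def algebra_simps)
    also have "\<dots> \<le> 32 * l * i + (1600 * sqrt (i / D) + 32 * l) * w"
      using w0 by (intro add_left_mono mult_right_mono) (auto simp: i_def)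
    finally show ?thesis by (simp add: i_def w_def)
  next
    case True
    obtain z where z: "z \<in> Z" "card I \<le> 400 * ee I {z}" using popular_hub[OF \<Gamma> less.prems True] by blast
    define I1 where "I1 = {x \<in> I. (x, z) \<in> R}"
    define I2 where "I2 = I - I1"
    have sub: "I1 \<subseteq> I" "I2 \<subseteq> I" "I1 \<union> I2 = I" "I1 \<inter> I2 = {}" by (auto simp: I1_def I2_def)
    have fin': "finite I1" "finite I2" using sub fin finite_subset by blast+
    have "R \<inter> I \<times> {z} = (\<lambda>x. (x, z)) ` I1" by (auto simp: I1_def)
    then have c1: "ee I {z} = card I1" by (simp add: e_def card_image inj_on_def)
    have card_I: "card I = card I1 + card I2" using card_Un_disjoint[OF fin' sub(4)] sub(3) by simp
    have "0 < h * card I" using le_less_trans[OF le0 True] .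
    then have Ipos: "card I > 0" by simp
    then have I1pos: "card I1 > 0" using z c1 by linarith
    define i1 where "i1 = real (card I1)"
    define i2 where "i2 = real (card I2)"
    have i: "i = i1 + i2" "i \<le> 400 * i1" "i1 \<ge> 0" "i2 \<ge> 0"
      using card_I z(2) c1 by (simp_all add: i_def i1_def i2_def)
    \<comment> \<open>The peeled piece has at least |I| / 400 vertices, more than D / (400 h), and
      \<open>t\<close> exceeds \<open>400 * h\<close>.\<close>
    have large: "D \<le> t * card I1"
    proof -
      have "real D \<le> h * i" using True unfolding i_def by (metis less_imp_le of_nat_le_iff of_nat_mult)
      also have "\<dots> \<le> h * (400 * i1)" using i by (intro mult_left_mono) auto
      also have "\<dots> = (400 * real h) * i1" by simp
      also have "\<dots> \<le> t * i1" using t_ge(1) i by (intro mult_right_mono) auto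
      finally show ?thesis unfolding i1_def by (metis of_nat_le_iff of_nat_mult)
    qed
    \<comment> \<open>The popular hub must be taken out of \<open>W\<close> before
      \<open>star_rectangle\<close> applies; this costs at most \<open>i1\<close> edges.\<close>
    have star: "ee I1 W \<le> i1 + 2 * (i1 + sqrt (i / D) * w)"
    proof -
      have "ee I1 W \<le> ee I1 (insert z (W - {z}))" using fin fin' by (intro e_mono) auto
      also have "\<dots> = ee I1 {z} + ee I1 (W - {z})"
        using fin fin' e_sum_right[of I1 "insert z (W - {z})"] e_sum_right[of I1 "W - {z}"]
        by (simp add: sum.insert_remove)
      also have "ee I1 {z} \<le> card I1"
      proof -
        have "ee I1 {z} \<le> card (I1 \<times> {z})" unfolding e_def using fin' by (intro card_mono) auto
        then show ?thesis by (simp add: card_cartesian_product)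
      qed
      finally have "real (ee I1 W) \<le> i1 + ee I1 (W - {z})" unfolding i1_def by linarith
      also have "real (ee I1 (W - {z})) \<le> 2 * (card I1 + sqrt (card I1 / D) * t * card (W - {z}))"
        using z less.prems(1) sub W large by (intro star_rectangle) (auto simp: I1_def)
      also have "\<dots> \<le> 2 * (i1 + sqrt (i / D) * w)"
      proof -
        have "sqrt (i1 / D) * (t * card (W - {z})) \<le> sqrt (i / D) * w"
          unfolding w_def using i fin
          by (intro mult_mono real_sqrt_le_mono divide_right_mono of_nat_mono mult_left_mono card_mono)
            (auto intro: divide_nonneg_nonneg)
        then show ?thesis by (simp add: i1_def mult.assoc)
      qed
      finally show ?thesis by simp
    qed
    have rest: "ee I2 W \<le> 32 * l * i2 + (1600 * (799 / 800 * sqrt (i / D)) + 32 * l) * w"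
    proof -
      have "ee I2 W \<le> 32 * l * card I2 + (1600 * sqrt (card I2 / D) + 32 * l) * (t * card W)"
      proof (rule less.hyps)
        show "card I2 < card I" using card_I I1pos by simp
        show "I2 \<subseteq> X" using sub less.prems by blast
        show "\<Gamma> \<inter> open_pairs I2 = {}" using open_pairs_mono[OF sub(2)] less.prems(2) by blast
      qed
      \<comment> \<open>At most 399/400 of the set remains, and its square root is at most 799/800.
        The deficit 1600 / 800 = 2 matches the coefficient of the square root in
        \<open>star\<close>, so the constant 1600 reproduces itself.\<close>
      also have "sqrt (card I2 / D) \<le> 799 / 800 * sqrt (i / D)"
      proof (rule real_le_lsqrt)
        have "i2 \<le> (799 / 800)^2 * i" using i by (simp add: power2_eq_square)
        then have "i2 / D \<le> (799 / 800)^2 * i / D" by (intro divide_right_mono) auto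
        also have "\<dots> = (799 / 800 * sqrt (i / D))^2"
          unfolding power_mult_distrib using i by simp
        finally show "card I2 / D \<le> (799 / 800 * sqrt (i / D))^2" by (simp add: i2_def)
      qed (use i in \<open>auto intro: divide_nonneg_nonneg\<close>)
      then have "32 * l * card I2 + (1600 * sqrt (card I2 / D) + 32 * l) * (t * card W) \<le>
          32 * l * i2 + (1600 * (799 / 800 * sqrt (i / D)) + 32 * l) * w"
        unfolding i2_def w_def by (intro add_mono mult_right_mono) auto
      finally show ?thesis by simp
    qed
    have "ee I W = ee I1 W + ee I2 W"
      using fin fin' sub e_sum_left[of I W] e_sum_left[of I1 W] e_sum_left[of I2 W]
        sum.union_disjoint[OF fin' sub(4), of "\<lambda>x. ee {x} W"] by simp
    then have "real (ee I W) \<le> (i1 + 2 * (i1 + sqrt (i / D) * w)) +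
        (32 * l * i2 + (1600 * (799 / 800 * sqrt (i / D)) + 32 * l) * w)"
      using star rest by linarith
    also have "\<dots> = 3 * i1 + 32 * l * i2 + (1600 * sqrt (i / D) + 32 * l) * w" by (simp add: algebra_simps)
    also have "3 * i1 \<le> 32 * l * i1" using l i by (intro mult_right_mono) auto
    also have "32 * l * i1 + 32 * l * i2 = 32 * l * i" by (simp add: i algebra_simps)
    finally show ?thesis by (simp add: i_def w_def)
  qed
qed

text \<open>\<open>Inr (z, j)\<close> is twin \<open>j\<close> of hub \<open>z\<close>. The graph
  inside \<open>X\<close> is restricted to open pairs only here, which forbids triangles through a
  hub.\<close>

definition edge :: "nat set set \<Rightarrow> nat + nat \<times> nat \<Rightarrow> nat + nat \<times> nat \<Rightarrow> bool" where
  "edge \<Gamma> u v = (case u of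
      Inl x \<Rightarrow> (case v of Inl y \<Rightarrow> {x, y} \<in> \<Gamma> \<inter> open_pairs X | Inr y \<Rightarrow> (x, fst y) \<in> R \<and> snd y < t)
    | Inr y \<Rightarrow> (case v of Inl x \<Rightarrow> (x, fst y) \<in> R \<and> snd y < t | Inr _ \<Rightarrow> False))"

lemma edge_simps [simp]:
  "edge \<Gamma> (Inl x) (Inl y) \<longleftrightarrow> {x, y} \<in> \<Gamma> \<and> {x, y} \<in> open_pairs X"
  "edge \<Gamma> (Inl x) (Inr (z, j)) \<longleftrightarrow> (x, z) \<in> R \<and> j < t"
  "edge \<Gamma> (Inr (z, j)) (Inl x) \<longleftrightarrow> (x, z) \<in> R \<and> j < t"
  "\<not> edge \<Gamma> (Inr a) (Inr b)"
  by (simp_all add: edge_def)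

lemma edge_sym: "edge \<Gamma> u v \<Longrightarrow> edge \<Gamma> v u"
  by (cases u; cases v) (auto simp: edge_def insert_commute)

lemma open_pairs_doubleton:
  assumes "{x, y} \<in> open_pairs X"
  shows "x \<in> X" "y \<in> X" "x \<noteq> y" "(x, z) \<in> R \<Longrightarrow> (y, z) \<notin> R"
  using assms R_sub by (auto simp: open_pairs_def)

text \<open>No two hub twins are adjacent, so a triangle has at most one of them: with one, its
  other two vertices would form a closed pair; with none, it lies in the random graph.\<close>

lemma edge_trifree:
  assumes "trifree (graph_of \<Gamma>)"
  shows "edge \<Gamma> u v \<Longrightarrow> edge \<Gamma> v w \<Longrightarrow> \<not> edge \<Gamma> w u"
proof (cases u; cases v; cases w)
  fix x y z assume "u = Inl x" "v = Inl y" "w = Inl z" "edge \<Gamma> u v" "edge \<Gamma> v w"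
  then show "\<not> edge \<Gamma> w u" using assms unfolding trifree_def graph_of_def by simp blast
qed (use open_pairs_doubleton in \<open>auto simp: edge_def\<close>)

text \<open>Write F for the degree bound. If all degrees in a bipartite \<open>S\<close> exceeded F,
  then the edges between its part \<open>I\<close> in \<open>X\<close> and its hubs \<open>W\<close>
  would number at least (F / t) t |W| seen from the hubs and (F / t - 2) |I| seen from
  \<open>I\<close>, the 2 accounting for edges inside \<open>X\<close>. Peeling the two colour
  classes allows at most (F / t - 4) / 2 times |I| + t |W|; adding the lower bounds gives a
  contradiction.\<close>

lemma exists_dense_graph:
  "\<exists>(V :: (nat + nat \<times> nat) set) E. card V = 2 * N \<and> no_dense_bip V E (D / 32) ((96004 + 128 * l) * t)"
proof -
  obtain \<Gamma> where G: "\<Gamma> \<subseteq> pairs X" "trifree (graph_of \<Gamma>)" "hits_spread_sets \<Gamma>"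
    "\<And>I. I \<subseteq> X \<Longrightarrow> I \<noteq> {} \<Longrightarrow> card I \<le> 450 * D \<Longrightarrow> card (\<Gamma> \<inter> pairs I) < card I * t"
    using exists_sparse_graph unfolding hits_spread_sets_def by blast
  define V :: "(nat + nat \<times> nat) set" where "V = X <+> (Z \<times> {..<t})"
  define E where "E = {(u, v). edge \<Gamma> u v}"
  let ?F = "(96004 + 128 * real l) * t"
  have fV: "finite V" by (simp add: V_def)
  have cV: "card V = 2 * N" by (simp add: V_def card_Plus N_eq mult.commute)
  have E_sub: "E \<subseteq> V \<times> V"
  proof clarify
    fix u v assume "(u, v) \<in> E"
    then show "u \<in> V \<and> v \<in> V"
      using R_sub open_pairs_doubleton(1,2) unfolding E_def V_def
      by (cases u; cases v) (auto simp: edge_def Plus_def)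
  qed
  have "sgraph V E"
    unfolding sgraph_def
  proof (intro conjI fV E_sub)
    show "sym E" using edge_sym by (auto simp: sym_def E_def)
    have "{x, x} \<notin> open_pairs X" for x using open_pairs_doubleton(3)[of x x] by blast
    then have "\<not> edge \<Gamma> u u" for u by (cases u) (auto simp: edge_def)
    then show "irrefl E" by (auto simp: irrefl_def E_def)
  qed
  moreover have "trifree E"
    unfolding trifree_def E_def mem_Collect_eq prod.case using edge_trifree[OF G(2)] by blast
  moreover have "D / 32 \<le> deg E V v" if v: "v \<in> V" for v
  proof (cases v)
    case (Inl x)
    then have x: "x \<in> X" using v by (auto simp: V_def)
    let ?A = "(R \<inter> {x} \<times> Z) \<times> {..<t}"
    have "(\<lambda>((x, z), j). Inr (z, j)) ` ?A \<subseteq> nbrs E V v"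
      using Inl by (auto simp: nbrs_def V_def E_def)
    then have "card ((\<lambda>((x, z), j). Inr (z, j) :: nat + nat \<times> nat) ` ?A) \<le> deg E V v"
      using fV by (intro card_mono) auto
    moreover have "inj_on (\<lambda>((x, z), j). Inr (z, j) :: nat + nat \<times> nat) ?A" by (auto simp: inj_on_def)
    ultimately have "ee {x} Z * t \<le> deg E V v" by (simp add: card_image card_cartesian_product e_def)
    then have "real (ee {x} Z) * t \<le> deg E V v" by (metis of_nat_le_iff of_nat_mult)
    moreover have "D / (32 * t) * real t \<le> real (ee {x} Z) * real t"
      using deg_x(1)[OF x] by (intro mult_right_mono) auto
    ultimately show ?thesis using D_pos by simp
  next
    case (Inr y)
    then obtain z j where zj: "v = Inr (z, j)" "z \<in> Z" "j < t" using v by (cases y) (auto simp: V_def)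
    have "(\<lambda>(x, z). Inl x) ` (R \<inter> X \<times> {z}) \<subseteq> nbrs E V v"
      using zj by (auto simp: nbrs_def V_def E_def)
    then have "card ((\<lambda>(x, z). Inl x :: nat + nat \<times> nat) ` (R \<inter> X \<times> {z})) \<le> deg E V v"
      using fV by (intro card_mono) auto
    moreover have "inj_on (\<lambda>(x, z). Inl x :: nat + nat \<times> nat) (R \<inter> X \<times> {z})" by (auto simp: inj_on_def)
    ultimately have "ee X {z} \<le> deg E V v" by (simp add: card_image e_def)
    then show ?thesis using deg_z(1)[OF zj(2)] by linarith
  qed
  moreover have "\<exists>v\<in>S. deg E S v \<le> ?F" if S: "S \<subseteq> V" "S \<noteq> {}" "bip E S" for S
  proof (rule ccontr)
    assume "\<not> ?thesis"
    then have big_deg: "?F < deg E S v" if "v \<in> S" for v using that by (auto simp: not_le)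
    obtain P Q where PQ: "P \<union> Q = S" "P \<inter> Q = {}" "indep E P" "indep E Q" using S(3) by (auto simp: bip_def)
    define part where "part T = {x. Inl x \<in> T}" for T :: "(nat + nat \<times> nat) set"
    define I where "I = part S"
    \<comment> \<open>One twin in \<open>S\<close> puts its hub into \<open>W\<close>, so
      \<open>t * card W\<close> may exceed the number of twins in \<open>S\<close>. This is
      harmless: a single twin of large degree already bounds \<open>ee I {z}\<close> from
      below.\<close>
    define W where "W = {z. \<exists>j. Inr (z, j) \<in> S}"
    have I: "I \<subseteq> X" and W: "W \<subseteq> Z" using S(1) by (auto simp: I_def part_def W_def V_def)
    have fin: "finite I" "finite W" using I W finite_subset[of _ X] finite_subset[of _ Z] by auto
    have fS: "finite S" using S(1) fV finite_subset by blast
    have fnb: "finite (nbrs (graph_of \<Gamma>) I x)" for x using fin(1) by simp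
    define i where "i = real (card I)"
    define w where "w = real (t * card W)"
    have ind: "\<Gamma> \<inter> open_pairs (part T) = {}" if "indep E T" "part T \<subseteq> X" for T
    proof (rule ccontr)
      assume "\<Gamma> \<inter> open_pairs (part T) \<noteq> {}"
      then obtain p where p: "p \<in> \<Gamma>" "p \<in> open_pairs (part T)" by blast
      then obtain x y where xy: "p = {x, y}" "x \<in> part T" "y \<in> part T"
        by (auto simp: open_pairs_def pairs_def card_2_iff)
      have "{x, y} \<in> open_pairs X" using p(2) open_pairs_mono[OF that(2)] xy(1) by blast
      then have "(Inl x, Inl y) \<in> E \<inter> T \<times> T" using p(1) xy by (simp add: E_def part_def)
      then show False using that(1) unfolding indep_def by blast
    qed
    \<comment> \<open>24000 = 1600 * 15, where 15 is the square root of 225.\<close>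
    have rect: "ee (part T) W \<le> 32 * l * card (part T) + (24000 + 32 * l) * w \<and> card (part T) \<le> 225 * D"
      if T: "indep E T" "part T \<subseteq> I" for T
    proof -
      have TX: "part T \<subseteq> X" using T(2) I by blast
      have small: "card (part T) \<le> 225 * D" by (rule independent_card_le[OF G(3) TX ind[OF T(1) TX]])
      then have "real (card (part T)) / D \<le> 15^2"
        using D_pos by (simp add: divide_le_eq)
      then have "sqrt (card (part T) / D) \<le> 15" by (intro real_le_lsqrt) auto
      then have "(1600 * sqrt (card (part T) / D) + 32 * l) * w \<le> (24000 + 32 * l) * w"
        by (intro mult_right_mono) (auto simp: w_def)
      then show ?thesis
        using independent_rectangle[OF G(3) W TX ind[OF T(1) TX]] small unfolding w_def by linarith
    qed
    have parts: "part P \<union> part Q = I" "part P \<inter> part Q = {}" using PQ(1,2) by (auto simp: part_def I_def)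
    then have subs: "part P \<subseteq> I" "part Q \<subseteq> I" by blast+
    then have fins: "finite (part P)" "finite (part Q)" using fin finite_subset by blast+
    have "ee I W = ee (part P) W + ee (part Q) W"
      using fins fin parts e_sum_left[of I W] e_sum_left[of "part P" W] e_sum_left[of "part Q" W]
        sum.union_disjoint[OF fins parts(2), of "\<lambda>x. ee {x} W"] by simp
    moreover have cI: "card I = card (part P) + card (part Q)"
      using card_Un_disjoint[OF fins parts(2)] parts(1) by simp
    ultimately have "real (ee I W) \<le> 32 * l * card (part P) + (24000 + 32 * l) * w +
        (32 * l * card (part Q) + (24000 + 32 * l) * w)"
      using rect[OF PQ(3) subs(1)] rect[OF PQ(4) subs(2)] by linarith
    also have "\<dots> = 32 * l * i + (48000 + 64 * l) * w" by (simp add: i_def cI algebra_simps)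
    also have "\<dots> \<le> (48000 + 64 * l) * i + (48000 + 64 * l) * w"
      by (intro add_right_mono mult_right_mono) (auto simp: i_def)
    finally have upper: "real (ee I W) \<le> (48000 + 64 * l) * (i + w)" by (simp add: algebra_simps)
    have low_w: "(96004 + 128 * l) * w \<le> ee I W"
    proof -
      have "?F \<le> ee I {z}" if zW: "z \<in> W" for z
      proof -
        obtain j where j: "Inr (z, j) \<in> S" using zW by (auto simp: W_def)
        have "nbrs E S (Inr (z, j)) \<subseteq> (\<lambda>(x, z). Inl x) ` (R \<inter> I \<times> {z})"
        proof
          fix u assume u: "u \<in> nbrs E S (Inr (z, j))"
          then obtain x where x: "u = Inl x" by (cases u) (auto simp: nbrs_def E_def)
          then show "u \<in> (\<lambda>(x, z). Inl x) ` (R \<inter> I \<times> {z})"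
            using u by (intro image_eqI[of _ _ "(x, z)"]) (auto simp: nbrs_def E_def I_def part_def)
        qed
        then have "deg E S (Inr (z, j)) \<le> card ((\<lambda>(x, z). Inl x :: nat + nat \<times> nat) ` (R \<inter> I \<times> {z}))"
          using fin by (intro card_mono) auto
        also have "\<dots> \<le> ee I {z}" unfolding e_def using fin by (intro card_image_le) auto
        finally show ?thesis using big_deg[OF j] by linarith
      qed
      then have "(\<Sum>z\<in>W. ?F) \<le> (\<Sum>z\<in>W. real (ee I {z}))" by (intro sum_mono)
      also have "\<dots> = ee I W" using fin by (simp add: e_sum_right[of I W])
      finally show ?thesis by (simp add: w_def ac_simps)
    qed
    have low_i: "(96002 + 128 * l) * i \<le> ee I W"
    proof (cases "I = {}")
      case True
      then show ?thesis by (simp add: i_def)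
    next
      case False
      have "?F \<le> deg (graph_of \<Gamma>) I x + real t * ee {x} W" if "x \<in> I" for x
      proof -
        have xS: "Inl x \<in> S" using that by (simp add: I_def part_def)
        let ?A = "Inl ` nbrs (graph_of \<Gamma>) I x :: (nat + nat \<times> nat) set"
        let ?B = "(\<lambda>((x, z), j). Inr (z, j)) ` ((R \<inter> {x} \<times> W) \<times> {..<t}) :: (nat + nat \<times> nat) set"
        have fAB: "finite ?A" "finite ?B" using fin by auto
        have "nbrs E S (Inl x) \<subseteq> ?A \<union> ?B"
        proof
          fix u assume u: "u \<in> nbrs E S (Inl x)"
          show "u \<in> ?A \<union> ?B"
          proof (cases u)
            case (Inl y)
            then show ?thesis using u by (auto simp: nbrs_def E_def I_def part_def graph_of_def)
          next
            case (Inr y)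
            then obtain z j where "u = Inr (z, j)" by (cases y) auto
            then have "u \<in> ?B"
              using u by (intro image_eqI[of _ _ "((x, z), j)"]) (auto simp: nbrs_def E_def W_def)
            then show ?thesis by blast
          qed
        qed
        then have "deg E S (Inl x) \<le> card (?A \<union> ?B)" using fAB by (intro card_mono) auto
        also have "\<dots> \<le> card ?A + card ?B" by (rule card_Un_le)
        also have "card ?A \<le> deg (graph_of \<Gamma>) I x" using fnb by (rule card_image_le)
        also have "card ?B \<le> card ((R \<inter> {x} \<times> W) \<times> {..<t})" using fin by (intro card_image_le) auto
        also have "\<dots> = t * ee {x} W" by (simp add: card_cartesian_product e_def)
        finally have "real (deg E S (Inl x)) \<le> real (deg (graph_of \<Gamma>) I x + t * ee {x} W)"
          by (intro of_nat_mono) simp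
        then show ?thesis using big_deg[OF xS] by simp
      qed
      \<comment> \<open>Dividing by \<open>t\<close> at the end loses only 2 per vertex, because the
        sparse graph has at most \<open>t\<close> edges per vertex of \<open>I\<close>, each counted
        twice.\<close>
      then have "(\<Sum>x\<in>I. ?F) \<le> (\<Sum>x\<in>I. deg (graph_of \<Gamma>) I x + real t * ee {x} W)" by (intro sum_mono)
      also have "\<dots> = real (\<Sum>x\<in>I. deg (graph_of \<Gamma>) I x) + t * real (ee I W)"
        using fin by (simp add: e_sum_left[of I W] sum.distrib sum_distrib_left)
      also have "real (\<Sum>x\<in>I. deg (graph_of \<Gamma>) I x) \<le> real (2 * card (\<Gamma> \<inter> pairs I))"
        using sum_deg_graph_of_le[OF fin(1) G(1)] by (rule of_nat_mono)
      also have "real (2 * card (\<Gamma> \<inter> pairs I)) \<le> 2 * (i * t)"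
      proof -
        have "card I \<le> 450 * D" using rect[OF PQ(3) subs(1)] rect[OF PQ(4) subs(2)] cI by linarith
        then have "card (\<Gamma> \<inter> pairs I) \<le> card I * t" using G(4)[OF I False] by simp
        then have "real (card (\<Gamma> \<inter> pairs I)) \<le> i * t" unfolding i_def by (metis of_nat_le_iff of_nat_mult)
        then show ?thesis by simp
      qed
      finally have "i * ?F \<le> 2 * (i * t) + t * real (ee I W)" by (simp add: i_def)
      then have "t * ((96002 + 128 * l) * i) \<le> t * real (ee I W)" by (simp add: algebra_simps)
      then show ?thesis using D_pos by simp
    qed
    have "(96002 + 128 * l) * w \<le> (96004 + 128 * l) * w" by (intro mult_right_mono) (auto simp: w_def)
    then have "(96002 + 128 * l) * w \<le> ee I W" using low_w by linarith
    then have "(96002 + 128 * real l) * i + (96002 + 128 * real l) * w \<le> 2 * ((48000 + 64 * real l) * (i + w))"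
      using low_i upper by simp
    then have iw: "i + w \<le> 0" by (simp add: algebra_simps)
    have iw0: "0 \<le> i" "0 \<le> w" by (simp_all add: i_def w_def)
    have "i = 0" using iw iw0 by simp
    moreover have "w = 0" using iw iw0 by simp
    ultimately have "I = {}" "W = {}" using fin pos by (auto simp: i_def w_def)
    moreover obtain v where "v \<in> S" using S(2) by blast
    ultimately show False by (cases v) (auto simp: I_def W_def part_def)
  qed
  ultimately have "no_dense_bip V E (D / 32) ?F" unfolding no_dense_bip_def by blast
  then show ?thesis using cV by (intro exI[of _ V] exI[of _ E]) simp
qed

end

lemma dense_no_dense_bip:
  fixes l :: nat
  assumes "2 \<le> l"
  shows "\<forall>\<^sub>F h in sequentially. \<exists>(V :: (nat + nat \<times> nat) set) E.
    card V = 2 * h ^ (16 * l - 8) \<and> no_dense_bip V E (real h ^ (8 * l) / 32) ((96004 + 128 * real l) * real h ^ 8)"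
proof -
  have "((\<lambda>h :: nat. ln (real h) / real h) \<longlongrightarrow> 0) sequentially" by real_asymp
  moreover have "0 < 1 / (1000 * real (16 * l - 8))" using assms by simp
  ultimately have "\<forall>\<^sub>F h in sequentially. ln (real h) / real h < 1 / (1000 * real (16 * l - 8))"
    by (rule order_tendstoD(2))
  with eventually_ge_at_top[of 1000] show ?thesis
  proof eventually_elim
    case (elim h)
    let ?k = "real (16 * l - 8)"
    have k: "?k > 0" using assms by simp
    have "1000 * (?k * ln (real h)) \<le> h" using elim k by (simp add: field_simps)
    then interpret dense_params l h
      using assms elim by unfold_locales (auto simp: ln_realpow)
    obtain R where "typical R" using exists_typical by blast
    then interpret dense_typical l h R by unfold_locales
    show ?case using exists_dense_graph by (simp add: N_def D_def t_def)
  qed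
qed

section \<open>Matching the parameters to n, and the final estimate\<close>

section \<open>Asymptotics\<close>


lemma eventually_powr_ge:
  fixes a c :: real
  assumes "0 < a" shows "\<forall>\<^sub>F n in sequentially. c \<le> real n powr a"
proof -
  have "filterlim (\<lambda>n :: nat. real n powr a) at_top sequentially"
    using assms by real_asymp
  then show ?thesis by (simp add: filterlim_at_top)
qed

text \<open>Degrees are integers, so the real lower bounds may be rounded up and are then admissible
  values for the maximum.\<close>

lemma forces_lower:
  assumes "0 < \<eta>"
  shows "\<forall>\<^sub>F n in sequentially.
    forces_induced_bipartite \<eta> n (nat \<lceil>\<eta> / 128 * ln (real n)\<rceil>) \<and>
    forces_induced_bipartite \<eta> n (nat \<lceil>real n powr (2 * \<eta> - 1) / 4\<rceil>)"
  using eventually_powr_ge[OF assms, of 2] eventually_gt_at_top[of 0]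
proof eventually_elim
  case (elim n)
  define d where "d = nat \<lceil>real n powr \<eta>\<rceil>"
  have d: "2 \<le> d" "real n powr \<eta> \<le> d" using elim unfolding d_def by linarith+
  have "\<exists>S\<subseteq>V. S \<noteq> {} \<and> bip E S \<and> (\<forall>v\<in>S. nat \<lceil>\<eta> / 128 * ln (real n)\<rceil> \<le> deg E S v)"
    if *: "sgraph V E \<and> card V = n \<and> trifree E \<and> (\<forall>v\<in>V. real n powr \<eta> \<le> deg E V v)" for V and E :: "nat rel"
  proof -
    have "V \<noteq> {}" using * elim by auto
    moreover have "d \<le> deg E V v" if "v \<in> V" for v using * that unfolding d_def by (simp add: nat_le_iff ceiling_le_iff)
    ultimately obtain S where S: "S \<subseteq> V" "S \<noteq> {}" "bip E S" "\<forall>v\<in>S. ln (real d) / 128 \<le> deg E S v"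
      using min_degree_log[of V E d] * d by blast
    have "\<eta> * ln (real n) = ln (real n powr \<eta>)" using elim by (simp add: ln_powr)
    also have "\<dots> \<le> ln (real d)" using d elim by (intro ln_mono) auto
    finally have "\<eta> / 128 * ln (real n) \<le> ln (real d) / 128" by simp
    then have "\<forall>v\<in>S. nat \<lceil>\<eta> / 128 * ln (real n)\<rceil> \<le> deg E S v"
      using S(4) by (auto simp: nat_le_iff ceiling_le_iff intro: order_trans)
    then show ?thesis using S by blast
  qed
  moreover have "\<exists>S\<subseteq>V. S \<noteq> {} \<and> bip E S \<and> (\<forall>v\<in>S. nat \<lceil>real n powr (2 * \<eta> - 1) / 4\<rceil> \<le> deg E S v)"
    if *: "sgraph V E \<and> card V = n \<and> trifree E \<and> (\<forall>v\<in>V. real n powr \<eta> \<le> deg E V v)" for V and E :: "nat rel"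
  proof -
    have "V \<noteq> {}" using * elim by auto
    then obtain S where S: "S \<subseteq> V" "S \<noteq> {}" "bip E S" "\<forall>v\<in>S. (real n powr \<eta>)^2 / (4 * card V) \<le> deg E S v"
      using min_degree_square[of V E "real n powr \<eta>"] * elim by auto
    have "(real n powr \<eta>)^2 / (4 * card V) = real n powr (2 * \<eta> - 1) / 4"
      using elim * by (simp add: powr_diff powr_mult_base power2_eq_square flip: powr_add)
    then have "\<forall>v\<in>S. nat \<lceil>real n powr (2 * \<eta> - 1) / 4\<rceil> \<le> deg E S v"
      using S(4) by (auto simp: nat_le_iff ceiling_le_iff)
    then show ?thesis using S by blast
  qed
  ultimately show ?case using elim by (simp only: forces_iff) blast
qed

lemma forces_upper:
  fixes E :: "nat rel"
  assumes "no_dense_bip {..<n} E d f" "real n powr \<eta> \<le> d" "n > 0" "forces_induced_bipartite \<eta> n k"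
  shows "k \<le> f"
proof -
  have "sgraph {..<n} E \<and> card {..<n} = n \<and> trifree E \<and> (\<forall>v\<in>{..<n}. real n powr \<eta> \<le> deg E {..<n} v)"
    using assms(1,2) by (auto simp: no_dense_bip_def intro: order_trans)
  from assms(4)[unfolded forces_iff[OF assms(3)], THEN spec, THEN spec, THEN mp, OF this]
  obtain S where S: "S \<subseteq> {..<n}" "S \<noteq> {}" "bip E S" "\<forall>v\<in>S. k \<le> deg E S v" by blast
  then obtain v where "v \<in> S" "real (deg E S v) \<le> f" using assms(1) unfolding no_dense_bip_def by blast
  then show ?thesis using S(4) by (meson of_nat_le_iff order_trans)
qed

lemma blow_up_forces_upper:
  assumes base: "no_dense_bip V E d f" and m: "0 < card V" "card V \<le> n" and nn: "d \<ge> 0" "f \<ge> 0"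
    and d: "real n powr \<eta> \<le> real (n div card V) * d" and k: "forces_induced_bipartite \<eta> n k"
  shows "k \<le> 2 * real (n div card V) * f"
proof -
  obtain E' :: "nat rel" where "no_dense_bip {..<n} E' (real (n div card V) * d) (2 * real (n div card V) * f)"
    using blow_up[OF base m nn] by blast
  then show ?thesis using d k m by (intro forces_upper) auto
qed

lemma upper_sparse:
  assumes "\<eta> \<le> 1 / 2"
  shows "\<forall>\<^sub>F n in sequentially. \<forall>k. forces_induced_bipartite \<eta> n k \<longrightarrow> k \<le> 500000000 * ln (real n)"
proof -
  \<comment> \<open>B = 2 * 160^2: then n, being at most 2 B m, satisfies sqrt n <= 320 sqrt m = B
    sqrt m / 160, the degree after the blow-up.\<close>
  define B :: nat where "B = 51200"
  have "filterlim (\<lambda>n. n div B) sequentially sequentially"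
    unfolding filterlim_at_top
  proof
    fix c
    show "\<forall>\<^sub>F n in sequentially. c \<le> n div B"
      using eventually_ge_at_top[of "c * B"]
      by eventually_elim (simp add: B_def less_eq_div_iff_mult_less_eq)
  qed
  from eventually_compose_filterlim[OF sparse_no_dense_bip this]
    eventually_ge_at_top[of "B * B"]
  show ?thesis
  proof eventually_elim
    case (elim n)
    define m where "m = n div B"
    obtain V :: "nat set" and E where V: "card V = m" "no_dense_bip V E (sqrt m / 160) (4000 * ln m)"
      using elim unfolding m_def by blast
    have mB: "B \<le> m" using elim(2) div_le_mono[of "B * B" n B] by (simp add: m_def B_def)
    have n: "m * B \<le> n" "n < m * B + B"
      unfolding m_def using mod_less_divisor[of B n] div_mult_mod_eq[of n B] by (simp_all add: B_def)
    have mn: "0 < m" "m \<le> n"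
    proof -
      show "0 < m" using mB by (simp add: B_def)
      have "m * 1 \<le> m * B" by (simp add: B_def)
      then show "m \<le> n" using n(1) by linarith
    qed
    have dv: "B \<le> n div m" "n div m \<le> B + 1"
    proof -
      show "B \<le> n div m" using n(1) mn(1) by (simp add: less_eq_div_iff_mult_less_eq mult.commute)
      have "n < (B + 2) * m" using n(2) mB by (simp add: algebra_simps)
      then have "n div m < B + 2" using mn(1) by (simp add: div_less_iff_less_mult)
      then show "n div m \<le> B + 1" by simp
    qed
    show ?case
    proof (intro allI impI)
      fix k assume k: "forces_induced_bipartite \<eta> n k"
      have "k \<le> 2 * real (n div card V) * (4000 * ln m)"
      proof (rule blow_up_forces_upper[OF V(2), where \<eta> = \<eta>])
        have "real n powr \<eta> \<le> real n powr (1/2)" using assms mn by (intro powr_mono) auto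
        also have "\<dots> = sqrt n" by (simp add: powr_half_sqrt)
        also have "\<dots> \<le> sqrt (320 ^ 2 * real m)"
        proof (rule real_sqrt_le_mono)
          have "n \<le> 2 * (m * B)" using n(2) mB by (simp add: B_def)
          then show "real n \<le> 320 ^ 2 * real m" by (simp add: B_def)
        qed
        also have "\<dots> = 320 * sqrt m" by (simp add: real_sqrt_mult)
        also have "\<dots> = B * (sqrt m / 160)" by (simp add: B_def)
        also have "\<dots> \<le> real (n div card V) * (sqrt m / 160)"
          using dv V(1) by (intro mult_right_mono) auto
        finally show "real n powr \<eta> \<le> real (n div card V) * (sqrt m / 160)" .
      qed (use V mn k in auto)
      also have "\<dots> \<le> 2 * real (B + 1) * (4000 * ln n)"
        using dv V(1) mn by (intro mult_mono) auto
      also have "\<dots> \<le> 500000000 * ln n" using mn by (simp add: B_def)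
      finally show "k \<le> 500000000 * ln (real n)" .
    qed
  qed
qed

lemma upper_dense:
  assumes \<eta>: "1 / 2 < \<eta>" "\<eta> < 1"
  shows "\<exists>C > 0. \<forall>\<^sub>F n in sequentially. \<forall>k. forces_induced_bipartite \<eta> n k \<longrightarrow> k \<le> C * real n powr (2 * \<eta> - 1)"
proof -
  obtain l0 :: nat where l0: "\<eta> < l0 * (2 * \<eta> - 1)"
    using ex_less_of_nat_mult[of "2 * \<eta> - 1" \<eta>] \<eta> by auto
  define l where "l = max 2 l0"
  have l: "2 \<le> l" "\<eta> < l * (2 * \<eta> - 1)"
  proof -
    have "l0 * (2 * \<eta> - 1) \<le> l * (2 * \<eta> - 1)" using \<eta> by (intro mult_right_mono) (auto simp: l_def)
    then show "\<eta> < l * (2 * \<eta> - 1)" using l0 by linarith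
  qed (simp add: l_def)
  \<comment> \<open>The base graph has order over degree about N / D = h^k, and blow-ups preserve
    this ratio. It has to be about n^(1 - \<eta>), which forces h to be about n^b with the
    \<open>b\<close> below.\<close>
  define k where "k = 8 * l - 8"
  have k: "k \<ge> 8" "16 * l - 8 = 2 * k + 8" "8 * l = k + 8" using l(1) by (auto simp: k_def)
  have kl: "real k = 8 * real l - 8" using l(1) by (simp add: k_def of_nat_diff)
  define b where "b = (1 - \<eta>) / k"
  have b: "b > 0" "k * b = 1 - \<eta>" using \<eta> k by (simp_all add: b_def)
  \<comment> \<open>The base graph has about n^a vertices, so a < 1 makes room for a blow-up; this
    is equivalent to the choice of \<open>l\<close>.\<close>
  define a where "a = real (2 * k + 8) * b"
  have a: "a < 1"
  proof -
    have "(1 - \<eta>) * real (2 * k + 8) < real k" using l(2) by (simp add: kl algebra_simps)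
    then show ?thesis using k by (simp add: a_def b_def divide_less_eq mult.commute)
  qed
  define K where "K = 96004 + 128 * real l"
  \<comment> \<open>Rounding \<open>y / 128\<close> down to \<open>h\<close> loses at most a factor
    2, hence 256.\<close>
  define c where "c = (1 / 256 :: real) ^ k"
  \<comment> \<open>128 = 4 * 32 offsets the 32 in the base degree, the factor 2 in
    \<open>card V\<close>, and another 2 lost by integer division.\<close>
  define H where "H n = nat \<lfloor>real n powr b / 128\<rfloor>" for n :: nat
  have c0: "c > 0" by (simp add: c_def)
  have "filterlim H sequentially sequentially"
    unfolding filterlim_at_top
  proof
    fix B
    show "\<forall>\<^sub>F n in sequentially. B \<le> H n"
      using eventually_powr_ge[OF b(1), of "128 * real B"]
      by eventually_elim (simp add: H_def le_nat_floor)
  qed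
  moreover have "0 < 1 - a" using a by simp
  ultimately have "\<forall>\<^sub>F n in sequentially. 4 \<le> real n powr (1 - a)" "filterlim H sequentially sequentially"
    by (auto intro: eventually_powr_ge)
  from eventually_compose_filterlim[OF dense_no_dense_bip[OF l(1)] this(2)] this(1)
    eventually_powr_ge[OF b(1), of 256] eventually_gt_at_top[of 0]
  have "\<forall>\<^sub>F n in sequentially. \<forall>k. forces_induced_bipartite \<eta> n k \<longrightarrow> k \<le> (K / c^2) * real n powr (2 * \<eta> - 1)"
  proof eventually_elim
    case (elim n)
    define h where "h = H n"
    define y where "y = real n powr b"
    obtain V :: "(nat + nat \<times> nat) set" and E where V: "card V = 2 * h ^ (2 * k + 8)"
      "no_dense_bip V E (real h ^ (k + 8) / 32) (K * real h ^ 8)"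
      using elim(1) unfolding h_def K_def k by blast
    have n0: "n > 0" using elim by simp
    have h: "y / 256 \<le> h" "h \<le> y / 128"
    proof -
      have "y \<ge> 256" using elim by (simp add: y_def)
      then show "y / 256 \<le> h" "h \<le> y / 128" unfolding h_def H_def y_def[symmetric] by linarith+
    qed
    have y0: "y > 0" using n0 by (simp add: y_def)
    have h0: "real h > 0" using h y0 by linarith
    have yk: "y ^ k = real n powr (1 - \<eta>)"
      using n0 b(2) by (simp add: y_def powr_power mult.commute)
    have hk: "c * real n powr (1 - \<eta>) \<le> real h ^ k" "128 * real h ^ k \<le> real n powr (1 - \<eta>)"
    proof -
      have "(y / 256) ^ k \<le> real h ^ k" using h y0 by (intro power_mono) auto
      then show "c * real n powr (1 - \<eta>) \<le> real h ^ k" by (simp add: c_def power_divide yk)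
      have "real h ^ k \<le> (y / 128) ^ k" using h by (intro power_mono) auto
      also have "\<dots> = y ^ k / 128 ^ k" by (simp add: power_divide)
      also have "\<dots> \<le> y ^ k / 128 ^ 1" using k y0 by (intro divide_left_mono power_increasing) auto
      finally show "128 * real h ^ k \<le> real n powr (1 - \<eta>)" by (simp add: yk)
    qed
    have nV: "2 * real (card V) \<le> n"
    proof -
      have "real h ^ (2 * k + 8) \<le> y ^ (2 * k + 8)" using h y0 by (intro power_mono) auto
      also have "\<dots> = real n powr a" using n0 by (simp add: y_def powr_power a_def mult.commute)
      finally have "4 * real h ^ (2 * k + 8) \<le> real n powr (1 - a) * real n powr a"
        using elim by (intro mult_mono) auto
      also have "\<dots> = n" using n0 by (simp flip: powr_add)
      finally show ?thesis by (simp add: V(1))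
    qed
    have cV: "card V > 0" "card V \<le> n" "real (card V) = 2 * real h ^ (2 * k + 8)"
    proof -
      show "real (card V) = 2 * real h ^ (2 * k + 8)" by (simp add: V(1))
      show "card V > 0" using h0 by (simp add: V(1))
      show "card V \<le> n" using nV by linarith
    qed
    have dv: "n / (2 * real (card V)) \<le> real (n div card V)" "real (n div card V) \<le> n / card V"
    proof -
      show "real (n div card V) \<le> n / card V" by (rule of_nat_div_le_of_nat)
      have "n < card V * (n div card V) + card V"
        using cV(1) mod_less_divisor[of "card V" n] mult_div_mod_eq[of "card V" n] by linarith
      then have "real n < real (card V * (n div card V) + card V)" by (rule of_nat_less_iff[THEN iffD2])
      then have "real n / card V - 1 \<le> real (n div card V)" using cV(1) by (simp add: field_simps)
      moreover have "1 \<le> n / (2 * real (card V))" using nV cV(1) by (simp add: le_divide_eq)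
      moreover have "n / card V = n / (2 * real (card V)) + n / (2 * real (card V))" by simp
      ultimately show "n / (2 * real (card V)) \<le> real (n div card V)" by linarith
    qed
    have pw: "real h ^ (2 * k + 8) = real h ^ k * real h ^ k * real h ^ 8" "real h ^ (k + 8) = real h ^ k * real h ^ 8"
      by (simp_all only: mult_2 power_add)
    show ?case
    proof (intro allI impI)
      fix j assume j: "forces_induced_bipartite \<eta> n j"
      have "j \<le> 2 * real (n div card V) * (K * real h ^ 8)"
      proof (rule blow_up_forces_upper[OF V(2) cV(1,2), where \<eta> = \<eta>])
        have "real n powr \<eta> * (128 * real h ^ k) \<le> real n powr \<eta> * real n powr (1 - \<eta>)"
          using hk by (intro mult_left_mono) auto
        also have "\<dots> = n" using n0 by (simp flip: powr_add)
        finally have "real n powr \<eta> \<le> n / (128 * real h ^ k)" using h0 by (simp add: field_simps)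
        also have "\<dots> = n / (2 * real (card V)) * (real h ^ (k + 8) / 32)"
          unfolding cV(3) pw using h0 by (simp add: field_simps)
        also have "\<dots> \<le> real (n div card V) * (real h ^ (k + 8) / 32)"
          using dv by (intro mult_right_mono) auto
        finally show "real n powr \<eta> \<le> real (n div card V) * (real h ^ (k + 8) / 32)" .
      qed (use j in \<open>auto simp: K_def\<close>)
      also have "\<dots> \<le> 2 * (n / card V) * (K * real h ^ 8)"
        using dv by (intro mult_right_mono mult_left_mono) (auto simp: K_def)
      also have "\<dots> = K * n / (real h ^ k * real h ^ k)" unfolding cV(3) pw using h0 by (simp add: field_simps)
      also have "\<dots> \<le> K * n / ((c * real n powr (1 - \<eta>)) * (c * real n powr (1 - \<eta>)))"
        using hk c0 n0 h0 by (intro divide_left_mono mult_mono mult_pos_pos) (auto simp: K_def)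
      also have "\<dots> = K / c^2 * (n / (real n powr (1 - \<eta>) * real n powr (1 - \<eta>)))"
        by (simp add: power2_eq_square)
      also have "real n / (real n powr (1 - \<eta>) * real n powr (1 - \<eta>)) = real n powr (2 * \<eta> - 1)"
      proof -
        have "real n powr (2 * \<eta> - 1) * (real n powr (1 - \<eta>) * real n powr (1 - \<eta>)) = n"
          using n0 by (simp flip: powr_add)
        then show ?thesis using n0 by (simp add: field_simps)
      qed
      finally show "j \<le> (K / c^2) * real n powr (2 * \<eta> - 1)" .
    qed
  qed
  moreover have "K / c^2 > 0" using c0 by (simp add: K_def add_pos_nonneg)
  ultimately show ?thesis by blast
qed

theorem theorem1:
  fixes \<eta> :: real
  assumes "0 < \<eta>" and "\<eta> < 1"
  shows "(\<lambda>n. real (max_forced_degree \<eta> n)) \<in>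
           \<Theta>(\<lambda>n. max (ln (real n)) (real n powr (2 * \<eta> - 1)))"
proof -
  let ?m = "\<lambda>n. max (ln (real n)) (real n powr (2 * \<eta> - 1))"
  have "\<exists>C > 0. \<forall>\<^sub>F n in sequentially. \<forall>k. forces_induced_bipartite \<eta> n k \<longrightarrow> k \<le> C * ?m n"
  proof (cases "\<eta> \<le> 1 / 2")
    case True
    have "\<forall>\<^sub>F n in sequentially. \<forall>k. forces_induced_bipartite \<eta> n k \<longrightarrow> k \<le> 500000000 * ?m n"
      using upper_sparse[OF True] by eventually_elim (auto intro: order_trans)
    then show ?thesis by (intro exI[of _ 500000000]) simp
  next
    case False
    then obtain C where C: "C > 0"
      "\<forall>\<^sub>F n in sequentially. \<forall>k. forces_induced_bipartite \<eta> n k \<longrightarrow> k \<le> C * real n powr (2 * \<eta> - 1)"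
      using upper_dense assms by force
    have "\<forall>\<^sub>F n in sequentially. \<forall>k. forces_induced_bipartite \<eta> n k \<longrightarrow> k \<le> C * ?m n"
      using C(2)
    proof eventually_elim
      case (elim n)
      have "C * real n powr (2 * \<eta> - 1) \<le> C * ?m n" using C(1) by (intro mult_left_mono) auto
      then show ?case using elim by (auto intro: order_trans)
    qed
    then show ?thesis using C(1) by blast
  qed
  then obtain C where C: "C > 0"
    "\<forall>\<^sub>F n in sequentially. \<forall>k. forces_induced_bipartite \<eta> n k \<longrightarrow> k \<le> C * ?m n" by blast
  have "\<forall>\<^sub>F n in sequentially. \<eta> / 128 * ?m n \<le> max_forced_degree \<eta> n \<and> max_forced_degree \<eta> n \<le> C * ?m n"
    using C(2) forces_lower[OF assms(1)] eventually_gt_at_top[of 0]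
  proof eventually_elim
    case (elim n)
    let ?P = "forces_induced_bipartite \<eta> n"
    \<comment> \<open>\<open>GREATEST\<close> is an attained maximum only for a bounded nonempty set
      of values; the upper estimate supplies the bound.\<close>
    define b where "b = nat \<lfloor>C * ?m n\<rfloor>"
    have le_b: "k \<le> b" if "?P k" for k using elim that unfolding b_def by (simp add: le_nat_floor)
    have le: "k \<le> max_forced_degree \<eta> n" if "?P k" for k
      unfolding max_forced_degree_def using that le_b by (rule Greatest_le_nat)
    have "?P (nat \<lceil>\<eta> / 128 * ln (real n)\<rceil>)" using elim by simp
    then have "?P (max_forced_degree \<eta> n)"
      unfolding max_forced_degree_def using le_b by (rule GreatestI_nat)
    then have up: "max_forced_degree \<eta> n \<le> C * ?m n" using elim by blast
    have 1: "\<eta> / 128 * ln (real n) \<le> max_forced_degree \<eta> n"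
      using le[of "nat \<lceil>\<eta> / 128 * ln (real n)\<rceil>"] elim by (simp add: nat_le_iff ceiling_le_iff)
    have "real n powr (2 * \<eta> - 1) / 4 \<le> max_forced_degree \<eta> n"
      using le[of "nat \<lceil>real n powr (2 * \<eta> - 1) / 4\<rceil>"] elim by (simp add: nat_le_iff ceiling_le_iff)
    moreover have "\<eta> / 128 * real n powr (2 * \<eta> - 1) \<le> 1 / 4 * real n powr (2 * \<eta> - 1)"
      using assms by (intro mult_right_mono) auto
    ultimately have "\<eta> / 128 * real n powr (2 * \<eta> - 1) \<le> max_forced_degree \<eta> n" by linarith
    with 1 have "\<eta> / 128 * ?m n \<le> max_forced_degree \<eta> n" by (simp add: max_def)
    with up show ?case by simp
  qed
  then have ev: "\<forall>\<^sub>F n in sequentially. \<eta> / 128 * ?m n \<le> max_forced_degree \<eta> n"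
    "\<forall>\<^sub>F n in sequentially. max_forced_degree \<eta> n \<le> C * ?m n"
    by (auto elim: eventually_mono)
  have nonneg: "0 \<le> ?m n" for n by (simp add: le_max_iff_disj)
  show ?thesis
  proof (rule bigthetaI)
    show "(\<lambda>n. real (max_forced_degree \<eta> n)) \<in> O(?m)"
      by (rule bigoI[of _ C], use ev(2) in eventually_elim) (use nonneg in simp)
    show "(\<lambda>n. real (max_forced_degree \<eta> n)) \<in> \<Omega>(?m)"
      by (rule landau_omega.bigI[of "\<eta> / 128"], use assms in simp, use ev(1) in eventually_elim)
        (use nonneg in simp)
  qed
qed

end
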